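(* For $n\ge 3$ let $\mathbf X_1,\dots,\mathbf X_n$ be independent standard normal random vectors in $\mathbb R^{n-2}$, let $\{\mathcal A_n,\mathcal B_n\}$ be their (almost surely unique) Radon partition, let $\mathcal S_n$ be one of the two parts chosen uniformly at random, and let $S_n=|\mathcal S_n|$. Then, as $n\to\infty$, \[ \frac{S_n-n/2}{\sigma\sqrt n}\ \xrightarrow{\ \mathrm{dist}\ }\ \mathcal N(0,1),\qquad\text{where } \sigma^2=\frac14-\frac1{2\pi}. \]
   Context: A Radon partition of a finite set $X\subset\mathbb R^d$ is a partition of $X$ into two sets whose convex hulls intersect; $n$ points of $\mathbb R^{n-2}$ in general position have exactly one such partition. *)

theory Defs
  imports "HOL-Probability.Probability" "HOL-Library.Function_Algebras"
begin

text \<open>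
  Since the dimension varies with \<open>n\<close>, the space $\mathbb{R}^d$ is represented by the functions
  \<open>nat \<Rightarrow> real\<close> that are extensional on \<open>{..<d}\<close>, with the product Borel sigma-algebra.  The
  pointwise vector space structure below makes the library's \<open>convex hull\<close> available on them:
  all such functions take the same value \<open>undefined\<close> outside \<open>{..<d}\<close>, and convex combinations
  preserve that value, so hulls are formed inside $\mathbb{R}^d$.
\<close>

instantiation "fun" :: (type, real_vector) real_vector
begin

definition scaleR_fun_def: "scaleR c f = (\<lambda>x. c *\<^sub>R f x)"

instance
  by standard (simp_all add: scaleR_fun_def fun_eq_iff scaleR_add_right scaleR_add_left)

end

definition Rd :: "nat \<Rightarrow> (nat \<Rightarrow> real) measure" where
  "Rd d = PiM {..<d} (\<lambda>_. borel)"

definition std_normal_vector :: "nat \<Rightarrow> (nat \<Rightarrow> real) measure" where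
  "std_normal_vector d = PiM {..<d} (\<lambda>_. std_normal_distribution)"

text \<open>
  The library's \<open>indep_var\<close> forces both random variables to have the same value type; this is its
  characterization \<open>indep_var_eq\<close> with two different value types.
\<close>

definition (in prob_space) indep_var2 ::
    "'b measure \<Rightarrow> ('a \<Rightarrow> 'b) \<Rightarrow> 'c measure \<Rightarrow> ('a \<Rightarrow> 'c) \<Rightarrow> bool" where
  "indep_var2 S X T Y \<longleftrightarrow>
     random_variable S X \<and> random_variable T Y \<and>
     indep_set
       (sigma_sets (space M) {X -` A \<inter> space M | A. A \<in> sets S})
       (sigma_sets (space M) {Y -` A \<inter> space M | A. A \<in> sets T})"

definition radon_partition :: "'v::real_vector set \<Rightarrow> 'v set set \<Rightarrow> bool" where
  "radon_partition X P \<longleftrightarrow>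
     (\<exists>A B. P = {A, B} \<and> A \<union> B = X \<and> A \<inter> B = {} \<and> convex hull A \<inter> convex hull B \<noteq> {})"

end

theory Submission
  imports Defs "HOL-Real_Asymp.Real_Asymp"
begin

text \<open>
  Write the points as the rows of an $n \times (n-2)$ Gaussian array.  The coefficient vectors of the
  affine dependences of the points are the vectors orthogonal to the all-ones vector and to the
  columns of the array.  Almost surely they form a line whose vectors have no zero entry, and then
  the signs along the line give the only Radon partition.  The line is the span of the Gram-Schmidt
  residual of one more independent Gaussian column.

  The direction of this residual is invariant under the reflections fixing the all-ones vector, and
  so is the direction of a centered Gaussian vector \<open>g - mean g\<close>.  An invariant law on the sphere is
  unique: by Fubini two such laws give the same mass to every spherical cap, and a set with null
  boundary is recovered by averaging over shrinking caps.  Hence the size of a random part has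
  the law of the number of coordinates of \<open>g\<close> exceeding their mean.

  This number differs by $o(\sqrt n)$ in probability from the sum of the independent variables
  $1_{g_i > 0} - g_i / \sqrt{2 \pi}$, because the number of coordinates above $t / \sqrt n$ is monotone
  in $t$ and concentrates around its mean. The variance of a summand is $1/4 - 1/(2\pi)$.
\<close>

subsection \<open>Gram-Schmidt residuals and reflections\<close>

text \<open>The extra column turns the line of dependences into a measurable vector.
  \<open>normal_vec n K\<close> is the residual of the last of \<open>K\<close> Gaussian columns
  after \<open>ones n\<close> and the other \<open>K - 1\<close> columns: \<open>K = n - 1\<close>
  gives the dependence of the points, and \<open>K = 1\<close> gives \<open>g - mean g\<close>. Both
  models are thus one construction, and equivariance is checked once. Reflections suffice as the
  symmetry group, because any two vectors of equal norm orthogonal to \<open>ones n\<close> are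
  exchanged by a single reflection that fixes \<open>ones n\<close>. Which part is called
  \<open>A n\<close> may depend on the points in any way. The fair coin leaves only the sum of the
  laws of the two parts, and both signs of the dependence have the same law, since the negative of
  an equivariant vector is equivariant. The coefficient \<open>1 / sqrt (2 * pi)\<close> is the
  normal density at 0: moving the threshold from 0 to the mean removes about
  \<open>(\<Sum>i<n. g i) / sqrt (2 * pi)\<close> coordinates from the count. It is also the
  expectation of \<open>g\<close> times the indicator of \<open>g > 0\<close>, so the variance is
  \<open>1/4 - 2 / (2 * pi) + 1 / (2 * pi)\<close>.\<close>

lemma sum_fun_apply: "(\<Sum>a\<in>A. f a) x = (\<Sum>a\<in>A. f a x)"
  by (induction A rule: infinite_finite_induct) auto

lemma scaleR_fun_apply [simp]: "(c *\<^sub>R f) x = c *\<^sub>R f x"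
  by (simp add: scaleR_fun_def)

text \<open>The dimension is a parameter, so vectors are functions on \<open>nat\<close> of which
  only the first \<open>n\<close> entries count. The form is therefore only semidefinite, and
  identities between functions need control of the entries from \<open>n\<close> on.\<close>

definition ip :: "nat \<Rightarrow> (nat \<Rightarrow> real) \<Rightarrow> (nat \<Rightarrow> real) \<Rightarrow> real" where
  "ip n x y = (\<Sum>i<n. x i * y i)"

lemma ip_commute: "ip n x y = ip n y x"
  by (simp add: ip_def mult.commute)

lemma ip_add: "ip n (x + y) z = ip n x z + ip n y z" "ip n z (x + y) = ip n z x + ip n z y"
  by (simp_all add: ip_def algebra_simps sum.distrib)

lemma ip_diff: "ip n (x - y) z = ip n x z - ip n y z" "ip n z (x - y) = ip n z x - ip n z y"
  by (simp_all add: ip_def algebra_simps sum_subtractf)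

lemma ip_scale: "ip n (c *\<^sub>R x) z = c * ip n x z" "ip n z (c *\<^sub>R x) = c * ip n z x"
  by (simp_all add: ip_def sum_distrib_left algebra_simps)

lemmas ip_simps = ip_add ip_diff ip_scale

lemma ip_self_nonneg [simp]: "0 \<le> ip n x x"
  by (simp add: ip_def sum_nonneg)

lemma ip_self_eq_0_iff: "ip n x x = 0 \<longleftrightarrow> (\<forall>i<n. x i = 0)"
  by (auto simp: ip_def sum_nonneg_eq_0_iff)

lemma ip_eq_0_of_self: "ip n x x = 0 \<Longrightarrow> ip n y x = 0" "ip n x x = 0 \<Longrightarrow> ip n x y = 0"
  unfolding ip_self_eq_0_iff by (simp_all add: ip_def)

definition axis_fun :: "nat \<Rightarrow> nat \<Rightarrow> real" where
  "axis_fun i = (\<lambda>j. if j = i then 1 else 0)"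

lemma ip_axis_fun: "i < n \<Longrightarrow> ip n x (axis_fun i) = x i" "i < n \<Longrightarrow> ip n (axis_fun i) x = x i"
  by (simp_all add: ip_def axis_fun_def if_distrib[of "\<lambda>t. _ * t"] if_distrib[of "\<lambda>t. t * _"] cong: if_cong)

text \<open>
  When the residual of \<open>u k\<close> vanishes, its coefficient is \<open>x / 0 = 0\<close>, so dependent vectors are skipped.
\<close>

fun gs_residual :: "nat \<Rightarrow> (nat \<Rightarrow> nat \<Rightarrow> real) \<Rightarrow> nat \<Rightarrow> (nat \<Rightarrow> real) \<Rightarrow> nat \<Rightarrow> real" where
  "gs_residual n u 0 y = y"
| "gs_residual n u (Suc k) y =
     gs_residual n u k y -
       (ip n y (gs_residual n u k (u k)) / ip n (gs_residual n u k (u k)) (gs_residual n u k (u k)))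
         *\<^sub>R gs_residual n u k (u k)"

abbreviation gs_vec :: "nat \<Rightarrow> (nat \<Rightarrow> nat \<Rightarrow> real) \<Rightarrow> nat \<Rightarrow> nat \<Rightarrow> real" where
  "gs_vec n u k \<equiv> gs_residual n u k (u k)"

text \<open>On the first \<open>n\<close> entries, \<open>gs_residual n u k\<close> is the
  orthogonal projection onto the complement of \<open>u 0, ..., u (k - 1)\<close>. Linearity,
  symmetry and the absorption of earlier projections are derived separately, straight from the
  recursion.\<close>

lemma gs_residual_linear:
  "gs_residual n u k (y + z) = gs_residual n u k y + gs_residual n u k z"
  "gs_residual n u k (y - z) = gs_residual n u k y - gs_residual n u k z"
  "gs_residual n u k (c *\<^sub>R y) = c *\<^sub>R gs_residual n u k y"
  by (induction k)
     (simp_all add: ip_simps fun_eq_iff algebra_simps add_divide_distrib diff_divide_distrib)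

lemma ip_gs_residual_orth:
  "(\<And>j. j < k \<Longrightarrow> ip n (gs_vec n u j) z = 0) \<Longrightarrow> ip n (gs_residual n u k y) z = ip n y z"
  by (induction k) (simp_all add: ip_simps)

lemma ip_gs_residual_gs_vec: "j < k \<Longrightarrow> ip n (gs_residual n u k y) (gs_vec n u j) = 0"
proof (induction k arbitrary: j y)
  case (Suc k)
  let ?a = "gs_vec n u k"
  have orth: "ip n ?a (gs_vec n u j) = 0" if "j < k" for j
    using Suc.IH that .
  show ?case
  proof (cases "j = k")
    case True
    have "ip n (gs_residual n u k y) ?a = ip n y ?a"
      by (rule ip_gs_residual_orth) (metis orth ip_commute)
    \<comment> \<open>If \<open>?a\<close> is null, the quotient is 0 by convention, and the term
      \<open>ip n y ?a\<close> that remains vanishes because a null vector is orthogonal to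
      everything.\<close>
    then show ?thesis
      using ip_eq_0_of_self(1)[of n ?a y] unfolding True gs_residual.simps ip_simps by simp
  next
    case False
    with Suc.prems have "j < k" by simp
    then show ?thesis using Suc.IH[of j] unfolding gs_residual.simps ip_simps by simp
  qed
qed simp

text \<open>Each step composes with nothing but subtracts the rank-one map sending \<open>y\<close>
  to \<open>(ip n y a / ip n a a) *\<^sub>R a\<close>, and this map is symmetric.\<close>

lemma ip_gs_residual_sym: "ip n (gs_residual n u k y) z = ip n y (gs_residual n u k z)"
proof (induction k)
  case (Suc k)
  then show ?case
    using ip_commute[of n "gs_vec n u k" z] by (simp only: gs_residual.simps ip_simps) simp
qed simp

text \<open>What \<open>gs_residual n u j\<close> removes from \<open>z\<close> is a combination of
  Gram-Schmidt vectors of index below \<open>j\<close>, all orthogonal to the left argument. The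
  case \<open>j = k\<close> says that the projection is idempotent.\<close>

lemma ip_gs_residual_gs_residual:
  "j \<le> k \<Longrightarrow> ip n (gs_residual n u k y) (gs_residual n u j z) = ip n (gs_residual n u k y) z"
  by (induction j) (simp_all add: ip_simps ip_gs_residual_gs_vec)

lemma ip_gs_residual_vec: "j < k \<Longrightarrow> ip n (gs_residual n u k y) (u j) = 0"
  using ip_gs_residual_gs_residual[of j k n u y "u j"] ip_gs_residual_gs_vec[of j k n u y] by simp

text \<open>Symmetry moves the projection from \<open>u k\<close> to \<open>z\<close>, on which it
  acts trivially by induction, so every coefficient vanishes.\<close>

lemma gs_residual_fixed: "(\<And>j. j < k \<Longrightarrow> ip n z (u j) = 0) \<Longrightarrow> gs_residual n u k z = z"
proof (induction k)
  case (Suc k)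
  then have "gs_residual n u k z = z" by simp
  moreover have "ip n z (gs_vec n u k) = 0"
    using calculation Suc.prems[of k] ip_gs_residual_sym[of n u k z "u k"] by simp
  ultimately show ?case by (simp)
qed simp

text \<open>The sum over \<open>i\<close> is the trace of the projection. A step subtracts a
  rank-one projection of trace 1, or nothing if the vector is skipped, so the trace does the
  dimension counting.\<close>

lemma gs_residual_trace_Suc:
  "(\<Sum>i<n. ip n (gs_residual n u (Suc k) (axis_fun i)) (axis_fun i)) =
   (\<Sum>i<n. ip n (gs_residual n u k (axis_fun i)) (axis_fun i)) -
     (if ip n (gs_vec n u k) (gs_vec n u k) = 0 then 0 else 1)"
proof -
  let ?a = "gs_vec n u k"
  have "(\<Sum>i<n. ip n (gs_residual n u (Suc k) (axis_fun i)) (axis_fun i)) =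
    (\<Sum>i<n. ip n (gs_residual n u k (axis_fun i)) (axis_fun i) - ?a i * ?a i / ip n ?a ?a)"
    by (intro sum.cong refl) (simp add: ip_simps ip_axis_fun)
  also have "\<dots> = (\<Sum>i<n. ip n (gs_residual n u k (axis_fun i)) (axis_fun i)) - ip n ?a ?a / ip n ?a ?a"
    by (simp add: sum_subtractf ip_def flip: sum_divide_distrib)
  finally show ?thesis by auto
qed

lemma gs_residual_trace_ge:
  "real n - real k \<le> (\<Sum>i<n. ip n (gs_residual n u k (axis_fun i)) (axis_fun i))"
proof (induction k)
  case (Suc k)
  then show ?case by (simp only: gs_residual_trace_Suc) simp
qed (simp add: ip_axis_fun, simp add: axis_fun_def)

lemma gs_residual_trace_eq:
  "(\<And>j. j < k \<Longrightarrow> ip n (gs_vec n u j) (gs_vec n u j) \<noteq> 0) \<Longrightarrow>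
   (\<Sum>i<n. ip n (gs_residual n u k (axis_fun i)) (axis_fun i)) = real n - real k"
proof (induction k)
  case (Suc k)
  then show ?case by (simp only: gs_residual_trace_Suc) simp
qed (simp add: ip_axis_fun, simp add: axis_fun_def)

lemma ex_gs_residual_axis_neq_0:
  assumes "k < n"
  shows "\<exists>i<n. gs_residual n u k (axis_fun i) i \<noteq> 0"
proof (rule ccontr)
  assume "\<not> ?thesis"
  then have "(\<Sum>i<n. ip n (gs_residual n u k (axis_fun i)) (axis_fun i)) = 0"
    by (simp add: ip_axis_fun)
  with gs_residual_trace_ge[of n k u] assms show False by simp
qed

text \<open>A positive semidefinite matrix with trace zero vanishes.\<close>

lemma gs_residual_full:
  assumes "\<And>j. j < n \<Longrightarrow> ip n (gs_vec n u j) (gs_vec n u j) \<noteq> 0" "i < n"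
  shows "gs_residual n u n y i = 0"
proof -
  have "(\<Sum>i<n. ip n (gs_residual n u n (axis_fun i)) (axis_fun i)) = 0"
    using gs_residual_trace_eq[of n n u] assms by simp
  \<comment> \<open>By symmetry and idempotence each diagonal entry is the squared norm of a
    projected axis vector, so a zero sum forces every one of them to vanish.\<close>
  then have "ip n (gs_residual n u n (axis_fun i)) (gs_residual n u n (axis_fun i)) = 0"
    using assms(2)
    by (subst (asm) ip_gs_residual_gs_residual[of n n, symmetric])
       (simp_all add: sum_nonneg_eq_0_iff)
  then have "ip n y (gs_residual n u n (axis_fun i)) = 0"
    by (rule ip_eq_0_of_self)
  then show ?thesis
    using assms(2) by (simp add: ip_gs_residual_sym[symmetric] ip_axis_fun)
qed

text \<open>The projection after \<open>n - 1\<close> vectors fixes \<open>z\<close> and the one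
  after \<open>n\<close> vectors kills it; the two differ by a multiple of the last Gram-Schmidt
  vector.\<close>

lemma orthogonal_line:
  assumes "\<And>j. j < n \<Longrightarrow> ip n (gs_vec n u j) (gs_vec n u j) \<noteq> 0"
    and "\<And>j. Suc j < n \<Longrightarrow> ip n z (u j) = 0"
  shows "\<exists>c. \<forall>i<n. z i = c * gs_vec n u (n - 1) i"
proof (cases n)
  case (Suc m)
  have "gs_residual n u m z = z"
    by (rule gs_residual_fixed) (use assms(2) Suc in auto)
  then have "gs_residual n u n z =
      z - (ip n z (gs_vec n u m) / ip n (gs_vec n u m) (gs_vec n u m)) *\<^sub>R gs_vec n u m"
    using Suc by (simp)
  with gs_residual_full[of n u _ z] assms(1) Suc show ?thesis
    by (intro exI[of _ "ip n z (gs_vec n u m) / ip n (gs_vec n u m) (gs_vec n u m)"])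
       (fastforce simp: fun_eq_iff)
qed simp

text \<open>The reflection in the hyperplane orthogonal to \<open>v\<close>. For a null
  \<open>v\<close> the convention \<open>x / 0 = 0\<close> makes it the identity, which lets the
  lemmas below quantify over all \<open>v\<close>.\<close>

definition reflect :: "nat \<Rightarrow> (nat \<Rightarrow> real) \<Rightarrow> (nat \<Rightarrow> real) \<Rightarrow> nat \<Rightarrow> real" where
  "reflect n v y = y - (2 * ip n v y / ip n v v) *\<^sub>R v"

lemma reflect_linear:
  "reflect n v (y - z) = reflect n v y - reflect n v z"
  "reflect n v (c *\<^sub>R y) = c *\<^sub>R reflect n v y"
  by (simp_all add: reflect_def ip_simps fun_eq_iff algebra_simps diff_divide_distrib)

lemma ip_reflect: "ip n (reflect n v y) (reflect n v z) = ip n y z"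
proof (cases "ip n v v = 0")
  case False
  then show ?thesis
    by (simp add: reflect_def ip_simps ip_commute[of n y v] field_simps)
qed (simp add: reflect_def)

lemma reflect_reflect: "reflect n v (reflect n v y) = y"
  by (cases "ip n v v = 0") (simp_all add: reflect_def ip_simps fun_eq_iff field_simps)

lemma reflect_fixed: "ip n v y = 0 \<Longrightarrow> reflect n v y = y"
  by (simp add: reflect_def)

text \<open>The hyperplane bisecting two vectors of equal norm exchanges them, since
  \<open>2 * ip n (x - y) x = ip n (x - y) (x - y)\<close>. This is the transitivity on spheres
  behind the cap argument. The second assumption covers the entries that \<open>ip n\<close> does
  not see.\<close>

lemma reflect_diff:
  assumes "ip n x x = ip n y y" "\<And>i. i \<ge> n \<Longrightarrow> x i = y i"
  shows "reflect n (x - y) x = y"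
proof (cases "ip n (x - y) (x - y) = 0")
  case True
  then have "x i = y i" for i
    using assms(2)[of i] by (cases "i < n") (auto simp: ip_self_eq_0_iff)
  then show ?thesis using True by (simp add: reflect_def fun_eq_iff)
next
  case False
  have *: "2 * ip n (x - y) x = ip n (x - y) (x - y)"
    using assms(1) by (simp add: ip_simps ip_commute[of n y x])
  show ?thesis
    using False unfolding reflect_def * by (simp add: fun_eq_iff)
qed

text \<open>The recursion is built from inner products and linear combinations, and a linear
  isometry respects both.\<close>

lemma gs_residual_reflect:
  "gs_residual n (\<lambda>j. reflect n v (u j)) k (reflect n v y) = reflect n v (gs_residual n u k y)"
  by (induction k arbitrary: y) (simp_all add: ip_reflect reflect_linear)

lemma gs_residual_cong:
  "(\<And>j. j < k \<Longrightarrow> u j = u' j) \<Longrightarrow> gs_residual n u k y = gs_residual n u' k y"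
  by (induction k arbitrary: y) (simp_all)

lemma gs_residual_outside:
  "(\<And>j. j < k \<Longrightarrow> u j i = 0) \<Longrightarrow> y i = 0 \<Longrightarrow> gs_residual n u k y i = 0"
  by (induction k arbitrary: y) (simp_all)

text \<open>A Radon partition is an affine dependence in disguise: take the weights of a common
  point of the hulls, negated on the second part. As all dependences are multiples of
  \<open>t\<close>, its signs are those of \<open>t\<close> up to one global sign, which the
  unordered pair absorbs.\<close>

lemma radon_partition_unique:
  fixes p :: "nat \<Rightarrow> nat \<Rightarrow> real" and t :: "nat \<Rightarrow> real"
  assumes n: "3 \<le> n"
    and ext: "\<And>i k. i < n \<Longrightarrow> d \<le> k \<Longrightarrow> p i k = undefined"
    and t_nz: "\<And>i. i < n \<Longrightarrow> t i \<noteq> 0"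
    and t_sum: "(\<Sum>i<n. t i) = 0"
    and t_dep: "\<And>k. k < d \<Longrightarrow> (\<Sum>i<n. t i * p i k) = 0"
    and line: "\<And>z. (\<Sum>i<n. z i) = 0 \<Longrightarrow> (\<And>k. k < d \<Longrightarrow> (\<Sum>i<n. z i * p i k) = 0) \<Longrightarrow>
                 \<exists>c. \<forall>i<n. z i = c * t i"
  shows "inj_on p {..<n}"
    and "radon_partition (p ` {..<n}) P \<longleftrightarrow> P = {p ` {i\<in>{..<n}. t i > 0}, p ` {i\<in>{..<n}. t i < 0}}"
proof -
  show inj: "inj_on p {..<n}"
  proof (rule inj_onI)
    fix i j assume ij: "i \<in> {..<n}" "j \<in> {..<n}" "p i = p j"
    show "i = j"
    proof (rule ccontr)
      assume "i \<noteq> j"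
      \<comment> \<open>Equal points would give the dependence with entries 1 and -1 at
        \<open>i\<close> and \<open>j\<close>. It vanishes at a third index, available as
        \<open>n \<ge> 3\<close>, where \<open>t\<close> does not vanish.\<close>
      define z where "z l = (axis_fun i l - axis_fun j l)" for l
      have sum_axis: "(\<Sum>l<n. axis_fun i' l * f l) = f i'" if "i' < n" for i' and f :: "nat \<Rightarrow> real"
        using ip_axis_fun(2)[OF that, of f] by (simp add: ip_def)
      have "\<exists>c. \<forall>i<n. z i = c * t i"
        using ij sum_axis[of i "\<lambda>_. 1"] sum_axis[of j "\<lambda>_. 1"] sum_axis[of i "\<lambda>l. p l _"]
          sum_axis[of j "\<lambda>l. p l _"]
        by (intro line) (simp_all add: z_def sum_subtractf algebra_simps)
      then obtain c where c: "\<And>l. l < n \<Longrightarrow> z l = c * t l" by blast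
      have "card {i, j} < card {..<n}" using n by (simp add: card_insert_if)
      then obtain l where l: "l < n" "l \<noteq> i" "l \<noteq> j"
        by (metis card_mono finite.emptyI finite_insert insertCI lessThan_iff not_le subsetI)
      then have "c = 0" using c[of l] t_nz[of l] by (simp add: z_def axis_fun_def)
      with c[of i] ij \<open>i \<noteq> j\<close> show False by (simp add: z_def axis_fun_def)
    qed
  qed
  define Pos where "Pos = {i\<in>{..<n}. t i > 0}"
  define Neg where "Neg = {i\<in>{..<n}. t i < 0}"
  have PN: "Pos \<union> Neg = {..<n}" "Pos \<inter> Neg = {}" "finite Pos" "finite Neg"
    using t_nz by (auto simp: Pos_def Neg_def neq_iff)
  have inj': "inj_on p Pos" "inj_on p Neg"
    using inj by (auto intro: inj_on_subset simp: Pos_def Neg_def)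
  have split: "(\<Sum>i<n. f i) = (\<Sum>i\<in>Pos. f i) + (\<Sum>i\<in>Neg. f i)" for f :: "nat \<Rightarrow> real"
    using PN by (metis sum.union_disjoint)
  define s where "s = (\<Sum>i\<in>Pos. t i)"
  have s_neg: "(\<Sum>i\<in>Neg. t i) = - s" using t_sum split[of t] by (simp add: s_def)
  have "s > 0"
  proof -
    have "s \<ge> 0" unfolding s_def by (rule sum_nonneg) (auto simp: Pos_def)
    moreover have "s \<noteq> 0"
    proof
      assume "s = 0"
      then have "sum t Pos = 0" "(\<Sum>i\<in>Neg. - t i) = 0"
        using s_neg by (simp_all add: s_def sum_negf)
      moreover have "(sum t Pos = 0) = (\<forall>i\<in>Pos. t i = 0)"
        by (rule sum_nonneg_eq_0_iff) (auto simp: Pos_def)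
      moreover have "((\<Sum>i\<in>Neg. - t i) = 0) = (\<forall>i\<in>Neg. - t i = 0)"
        by (rule sum_nonneg_eq_0_iff) (auto simp: Neg_def)
      moreover have "0 \<in> Pos \<or> 0 \<in> Neg" using PN n by auto
      ultimately show False using t_nz[of 0] n by auto
    qed
    ultimately show ?thesis by simp
  qed
  have rp: "radon_partition (p ` {..<n}) {p ` Pos, p ` Neg}"
    unfolding radon_partition_def
  proof (intro exI conjI)
    show "p ` Pos \<inter> p ` Neg = {}"
      using inj PN by (metis inj_on_image_Int Un_upper1 Un_upper2 image_empty)
    have comb: "(\<Sum>i\<in>Q. (c i / s') *\<^sub>R p i) \<in> convex hull (p ` Q)"
      if "finite Q" "\<And>i. i \<in> Q \<Longrightarrow> c i \<ge> 0" "sum c Q = s'" "s' > 0" for Q c s'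
      by (rule convex_sum)
         (use that in \<open>auto simp: convex_convex_hull hull_inc simp flip: sum_divide_distrib\<close>)
    \<comment> \<open>The positive and the negative half of the dependence, both normalized by
      \<open>s\<close>, are two convex combinations of the same point.\<close>
    have "(\<Sum>i\<in>Pos. (t i / s) *\<^sub>R p i) = (\<Sum>i\<in>Neg. ((- t i) / s) *\<^sub>R p i)"
    proof
      fix k
      show "(\<Sum>i\<in>Pos. (t i / s) *\<^sub>R p i) k = (\<Sum>i\<in>Neg. ((- t i) / s) *\<^sub>R p i) k"
      proof (cases "k < d")
        case True
        from t_dep[OF True] show ?thesis
          unfolding split[of "\<lambda>i. t i * p i k"] using \<open>s > 0\<close>
          by (simp add: sum_fun_apply sum_negf field_simps flip: sum_divide_distrib)
      next
        case False
        \<comment> \<open>From \<open>d\<close> on every point has the entry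
          \<open>undefined\<close>, and both combinations have total weight 1, so they agree there
          too.\<close>
        then have "(\<Sum>i\<in>Pos. (t i / s) *\<^sub>R p i) k = (\<Sum>i\<in>Pos. (t i / s) * undefined)"
          "(\<Sum>i\<in>Neg. ((- t i) / s) *\<^sub>R p i) k = (\<Sum>i\<in>Neg. ((- t i) / s) * undefined)"
          unfolding sum_fun_apply using ext by (auto intro!: sum.cong simp: Pos_def Neg_def)
        then show ?thesis
          using s_neg by (simp add: s_def sum_negf flip: sum_distrib_right sum_divide_distrib)
      qed
    qed
    moreover have "(\<Sum>i\<in>Pos. (t i / s) *\<^sub>R p i) \<in> convex hull (p ` Pos)"
      by (rule comb) (use PN \<open>s > 0\<close> in \<open>auto simp: Pos_def s_def\<close>)
    moreover have "(\<Sum>i\<in>Neg. ((- t i) / s) *\<^sub>R p i) \<in> convex hull (p ` Neg)"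
      by (rule comb) (use PN \<open>s > 0\<close> s_neg in \<open>auto simp: Neg_def sum_negf\<close>)
    ultimately show "convex hull (p ` Pos) \<inter> convex hull (p ` Neg) \<noteq> {}" by auto
  qed (use PN in auto)
  have "P = {p ` Pos, p ` Neg}" if R: "radon_partition (p ` {..<n}) P"
  proof -
    obtain A B where P: "P = {A, B}" "A \<union> B = p ` {..<n}" "A \<inter> B = {}"
      "convex hull A \<inter> convex hull B \<noteq> {}"
      using R unfolding radon_partition_def by blast
    have fin: "finite A" "finite B" using P(2) by (metis finite_Un finite_imageI finite_lessThan)+
    obtain u v where u: "\<And>x. x \<in> A \<Longrightarrow> u x \<ge> 0" "sum u A = 1"
      and v: "\<And>x. x \<in> B \<Longrightarrow> v x \<ge> 0" "sum v B = 1"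
      and eq: "(\<Sum>x\<in>A. u x *\<^sub>R x) = (\<Sum>x\<in>B. v x *\<^sub>R x)"
      using P(4) unfolding convex_hull_finite[OF fin(1)] convex_hull_finite[OF fin(2)] by force
    \<comment> \<open>The weights of the common point, with the sign recording the part.\<close>
    define z where "z i = (if p i \<in> A then u (p i) else - v (p i))" for i
    have z_sum: "(\<Sum>i<n. z i * f (p i)) = (\<Sum>x\<in>A. u x * f x) - (\<Sum>x\<in>B. v x * f x)"
      for f :: "(nat \<Rightarrow> real) \<Rightarrow> real"
    proof -
      have "(\<Sum>i<n. z i * f (p i)) = (\<Sum>x\<in>A \<union> B. (if x \<in> A then u x else - v x) * f x)"
        unfolding P(2) by (subst sum.reindex[OF inj]) (simp add: z_def)
      also have "\<dots> = (\<Sum>x\<in>A. (if x \<in> A then u x else - v x) * f x)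
          + (\<Sum>x\<in>B. (if x \<in> A then u x else - v x) * f x)"
        by (rule sum.union_disjoint) (use fin P(3) in auto)
      also have "(\<Sum>x\<in>B. (if x \<in> A then u x else - v x) * f x) = (\<Sum>x\<in>B. - (v x * f x))"
        by (intro sum.cong) (use P(3) in auto)
      finally show ?thesis by (simp add: sum_negf)
    qed
    have "\<exists>c. \<forall>i<n. z i = c * t i"
    proof (rule line)
      show "(\<Sum>i<n. z i) = 0" using z_sum[of "\<lambda>_. 1"] u v by simp
      show "(\<Sum>i<n. z i * p i k) = 0" for k
        using z_sum[of "\<lambda>x. x k"] fun_cong[OF eq, of k] by (simp add: sum_fun_apply)
    qed
    then obtain c where c: "\<And>i. i < n \<Longrightarrow> z i = c * t i" by blast
    have "c \<noteq> 0"
    proof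
      assume "c = 0"
      have "(\<Sum>x\<in>A. u x) = 0"
      proof (rule sum.neutral, rule ballI)
        fix x assume "x \<in> A"
        then obtain i where "i < n" "x = p i" using P(2) by blast
        with c[of i] \<open>c = 0\<close> \<open>x \<in> A\<close> show "u x = 0" by (simp add: z_def)
      qed
      with u show False by simp
    qed
    have inA: "p i \<in> A" if "i < n" "c * t i > 0" for i
      using c[OF that(1)] that P(2) v(1)[of "p i"] by (auto simp: z_def split: if_splits)
    have inB: "p i \<in> B" if "i < n" "c * t i < 0" for i
      using c[OF that(1)] that P(2) u(1)[of "p i"] by (fastforce simp: z_def split: if_splits)
    have sgn: "c * t i > 0 \<or> c * t i < 0" if "i < n" for i
      using \<open>c \<noteq> 0\<close> t_nz[OF that] by (simp add: linorder_neq_iff[symmetric])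
    have "A \<subseteq> p ` {i\<in>{..<n}. c * t i > 0}"
    proof
      fix x assume "x \<in> A"
      then obtain i where "i < n" "x = p i" using P(2) by blast
      then show "x \<in> p ` {i\<in>{..<n}. c * t i > 0}"
        using sgn[of i] inB[of i] \<open>x \<in> A\<close> P(3) by auto
    qed
    moreover have "B \<subseteq> p ` {i\<in>{..<n}. c * t i < 0}"
    proof
      fix x assume "x \<in> B"
      then obtain i where "i < n" "x = p i" using P(2) by blast
      then show "x \<in> p ` {i\<in>{..<n}. c * t i < 0}"
        using sgn[of i] inA[of i] \<open>x \<in> B\<close> P(3) by auto
    qed
    ultimately have AB: "A = p ` {i\<in>{..<n}. c * t i > 0}" "B = p ` {i\<in>{..<n}. c * t i < 0}"
      using inA inB by blast+
    show ?thesis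
    proof (cases "c > 0")
      case True
      then show ?thesis using AB P(1) by (simp add: Pos_def Neg_def zero_less_mult_iff mult_less_0_iff)
    next
      case False
      with \<open>c \<noteq> 0\<close> have "c < 0" by simp
      then show ?thesis using AB P(1)
        by (simp add: Pos_def Neg_def zero_less_mult_iff mult_less_0_iff insert_commute)
    qed
  qed
  with rp show "radon_partition (p ` {..<n}) P \<longleftrightarrow>
      P = {p ` {i\<in>{..<n}. t i > 0}, p ` {i\<in>{..<n}. t i < 0}}"
    unfolding Pos_def Neg_def by blast
qed

subsection \<open>Reflection invariance of Gaussian product measures\<close>

abbreviation lebesgue_product :: "'i set \<Rightarrow> ('i \<Rightarrow> real) measure" where
  "lebesgue_product I \<equiv> PiM I (\<lambda>_. lborel)"

abbreviation gaussian :: "'i set \<Rightarrow> ('i \<Rightarrow> real) measure" where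
  "gaussian I \<equiv> PiM I (\<lambda>_. std_normal_distribution)"

lemma prob_space_gaussian: "prob_space (gaussian I)"
  by (intro prob_space_PiM real_distribution.axioms(1) real_dist_normal_dist)

definition preserves :: "'a measure \<Rightarrow> ('a \<Rightarrow> 'a) \<Rightarrow> bool" where
  "preserves M T \<longleftrightarrow> T \<in> measurable M M \<and> distr M M T = M"

lemma preserves_comp:
  assumes "preserves M S" "preserves M T"
  shows "preserves M (\<lambda>x. S (T x))"
proof -
  have "distr M M (\<lambda>x. S (T x)) = distr (distr M M T) M S"
    using assms by (subst distr_distr) (auto simp: preserves_def comp_def)
  with assms show ?thesis by (auto simp: preserves_def)
qed

lemma preserves_cong:
  assumes "preserves M S" "\<And>x. x \<in> space M \<Longrightarrow> T x = S x"
  shows "preserves M T"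
proof -
  have "distr M M T = distr M M S" by (rule distr_cong) (use assms in auto)
  with assms measurable_cong[of M T S M] show ?thesis by (simp add: preserves_def)
qed

lemma preserves_ident: "preserves M (\<lambda>x. x)"
  by (simp add: preserves_def)

text \<open>With the other coordinates fixed, the map acts on a line by a translation and possibly a
  sign change, both harmless to Lebesgue measure; Fubini over the other coordinates does the rest.
  By \<open>s_indep\<close>, the amount of the translation is constant on that line.\<close>

lemma preserves_shear:
  fixes I :: "'i set"
  assumes I: "finite I" "i \<in> I" and c: "\<bar>c\<bar> = 1"
    and s: "s \<in> borel_measurable (lebesgue_product I)"
    and s_indep: "\<And>x y. s (x(i := y)) = s x"
  shows "preserves (lebesgue_product I) (\<lambda>x. x(i := c * x i + s x))"
proof -
  interpret product_sigma_finite "\<lambda>_::'i. lborel :: real measure"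
    by (simp add: product_sigma_finite_def sigma_finite_lborel)
  let ?L = "lebesgue_product I" and ?T = "\<lambda>x. x(i := c * x i + s x)"
  define J where "J = I - {i}"
  have J: "finite J" "i \<notin> J" "I = insert i J" using I by (auto simp: J_def)
  note [measurable] = s
  have T: "?T \<in> measurable ?L ?L"
  proof (rule measurable_PiM_single')
    show "(\<lambda>x. ?T x l) \<in> measurable ?L lborel" if "l \<in> I" for l
      using that I by (cases "l = i") auto
    show "?T \<in> space ?L \<rightarrow> (\<Pi>\<^sub>E i\<in>I. space lborel)"
      using I by (auto simp: space_PiM PiE_iff extensional_def)
  qed
  have "distr ?L ?L ?T = ?L"
  proof (rule measure_eqI)
    fix A assume "A \<in> sets (distr ?L ?L ?T)"
    then have A[measurable]: "A \<in> sets ?L" by simp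
    have ins: "(\<integral>\<^sup>+x. f x \<partial>?L) = (\<integral>\<^sup>+x. (\<integral>\<^sup>+y. f (x(i := y)) \<partial>lborel) \<partial>lebesgue_product J)"
      if "f \<in> borel_measurable ?L" for f
      using that unfolding J(3) by (rule product_nn_integral_insert[OF J(1,2)])
    have "emeasure (distr ?L ?L ?T) A = (\<integral>\<^sup>+x. indicator A (?T x) \<partial>?L)"
      using nn_integral_distr[OF T, of "indicator A"] A by simp
    also have "\<dots> = (\<integral>\<^sup>+x. (\<integral>\<^sup>+y. indicator A (?T (x(i := y))) \<partial>lborel) \<partial>lebesgue_product J)"
      by (rule ins) (use T in measurable)
    also have "\<dots> = (\<integral>\<^sup>+x. (\<integral>\<^sup>+y. indicator A (x(i := s x + c * y)) \<partial>lborel) \<partial>lebesgue_product J)"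
      by (simp add: s_indep add.commute)
    also have "\<dots> = (\<integral>\<^sup>+x. (\<integral>\<^sup>+y. indicator A (x(i := y)) \<partial>lborel) \<partial>lebesgue_product J)"
    proof (rule nn_integral_cong)
      fix x assume x: "x \<in> space (lebesgue_product J)"
      have "(\<lambda>y. x(i := y)) \<in> measurable borel ?L"
      proof (rule measurable_PiM_single')
        show "(\<lambda>y. (x(i := y)) l) \<in> measurable borel lborel" for l
          by (cases "l = i") auto
        show "(\<lambda>y. x(i := y)) \<in> space borel \<rightarrow> (\<Pi>\<^sub>E i\<in>I. space lborel)"
          using x J(3) by (auto simp: space_PiM PiE_iff extensional_def)
      qed
      then have "(\<lambda>y. indicator A (x(i := y)) :: ennreal) \<in> borel_measurable borel"
        by measurable
      from nn_integral_real_affine[OF this, of c "s x"] c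
      show "(\<integral>\<^sup>+y. indicator A (x(i := s x + c * y)) \<partial>lborel) =
            (\<integral>\<^sup>+y. indicator A (x(i := y)) \<partial>lborel)"
        by auto
    qed
    also have "\<dots> = (\<integral>\<^sup>+x. indicator A x \<partial>?L)"
      by (rule ins[symmetric]) measurable
    finally show "emeasure (distr ?L ?L ?T) A = emeasure ?L A" by simp
  qed simp
  with T show ?thesis by (simp add: preserves_def)
qed

text \<open>The index set is arbitrary so that it can be a grid of entries, where a vector supported
  on one column reflects that column alone.\<close>

definition reflect_on :: "'i set \<Rightarrow> ('i \<Rightarrow> real) \<Rightarrow> ('i \<Rightarrow> real) \<Rightarrow> 'i \<Rightarrow> real" where
  "reflect_on I v x = (\<lambda>i\<in>I. x i - 2 * (\<Sum>l\<in>I. v l * x l) / (\<Sum>l\<in>I. v l * v l) * v i)"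

text \<open>
  In the coordinates where \<open>x j\<close> is replaced by the shear \<open>(\<Sum>l\<in>I. v l * x l) / v j\<close>, the reflection
  flips coordinate \<open>j\<close> and adds multiples of it to the other coordinates.
\<close>

lemma preserves_lebesgue_reflect_on:
  fixes I :: "'i set"
  assumes I: "finite I"
  shows "preserves (lebesgue_product I) (reflect_on I v)"
proof (cases "\<forall>j\<in>I. v j = 0")
  case True
  then show ?thesis
    by (intro preserves_cong[OF preserves_ident])
       (auto simp: reflect_on_def space_PiM PiE_iff extensional_def)
next
  case False
  then obtain j where j: "j \<in> I" "v j \<noteq> 0" by blast
  let ?L = "lebesgue_product I"
  define J where "J = I - {j}"
  have J: "finite J" "j \<notin> J" "I = insert j J" using I j by (auto simp: J_def)
  define V where "V = (\<Sum>l\<in>I. v l * v l)"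
  have V: "V > 0"
    unfolding V_def by (rule sum_pos2[OF I j(1)]) (use j in \<open>auto simp: zero_less_mult_iff\<close>)
  define s where "s x = (\<Sum>l\<in>J. v l * x l) / v j" for x
  \<comment> \<open>After the shear, coordinate \<open>j\<close> holds
    \<open>q = (\<Sum>l\<in>I. v l * x l) / v j\<close>. The reflection changes entry
    \<open>l\<close> by \<open>- 2 * (v j * q) / V * v l\<close>, which determines this multiplier
    of \<open>q\<close>.\<close>
  define b where "b l = - 2 * v j * v l / V" for l
  have s_upd: "s (x(j := y)) = s x" for x y
    unfolding s_def using J(2) by (intro arg_cong2[where f="(/)"] sum.cong) auto
  have [measurable]: "s \<in> borel_measurable ?L"
    unfolding s_def using J(3) by (intro borel_measurable_divide borel_measurable_sum borel_measurable_times
        borel_measurable_const) (auto intro!: measurable_component_singleton[THEN measurable_compose])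
  have shear: "preserves ?L (\<lambda>x. x(j := 1 * x j + s x))" "preserves ?L (\<lambda>x. x(j := 1 * x j + - s x))"
    "preserves ?L (\<lambda>x. x(j := - 1 * x j + 0))"
    by (rule preserves_shear; use I j s_upd in simp)+
  \<comment> \<open>One shear for each \<open>l\<close>; all of them read coordinate
    \<open>j\<close>, which lies outside \<open>J\<close> and stays unchanged meanwhile.\<close>
  have B: "preserves ?L (\<lambda>x l. if l \<in> F then x l + b l * x j else x l)" if "finite F" "F \<subseteq> J" for F
    using that
  proof (induction F)
    case (insert l F)
    have "preserves ?L (\<lambda>x. x(l := 1 * x l + b l * x j))"
      by (rule preserves_shear) (use insert J I in auto)
    from preserves_comp[OF this insert.IH] insert show ?case
      by (rule_tac preserves_cong) (use J(2) in \<open>auto simp: fun_eq_iff\<close>)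
  qed (simp add: preserves_ident)
  \<comment> \<open>From the inside out: bring \<open>q\<close> into coordinate \<open>j\<close>,
    spread its multiples over \<open>J\<close>, flip its sign, and subtract \<open>s\<close> again,
    now evaluated at the changed entries.\<close>
  show ?thesis
  proof (rule preserves_cong[OF preserves_comp[OF shear(2) preserves_comp[OF shear(3)
        preserves_comp[OF B[OF J(1) order.refl] shear(1)]]]])
    fix x assume x: "x \<in> space ?L"
    define p where "p = (\<Sum>l\<in>I. v l * x l)"
    have p: "p = v j * x j + v j * s x" "V = v j * v j + v j * s v"
      unfolding p_def V_def s_def using J j(2) by (auto simp: J(3))
    define y where "y = (\<lambda>l. if l \<in> J then x l + b l * (x j + s x) else (x(j := 1 * x j + s x)) l)"
    define q where "q = x j + s x"
    have y_q: "y = (\<lambda>l. if l \<in> J then x l + b l * q else (x(j := 1 * x j + s x)) l)"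
      unfolding y_def q_def ..
    have s_y: "s (y(j := c)) = s x + q * (- 2 * v j * s v / V)" for c
    proof -
      have "s (y(j := c)) = (\<Sum>l\<in>J. v l * x l + q * (- 2 * v j / V) * (v l * v l)) / v j"
        unfolding s_def[of "y(j := c)"] using J(2)
        by (intro arg_cong2[where f="(/)"] sum.cong)
           (auto simp: y_q b_def algebra_simps)
      also have "\<dots> = s x + q * (- 2 * v j / V) * s v"
        unfolding sum.distrib sum_distrib_left[symmetric] add_divide_distrib s_def by simp
      finally show ?thesis by simp
    qed
    show "reflect_on I v x =
      (\<lambda>x. x(j := 1 * x j + - s x)) ((\<lambda>x. x(j := - 1 * x j + 0))
        ((\<lambda>x l. if l \<in> J then x l + b l * x j else x l) (x(j := 1 * x j + s x))))"
    proof
      fix l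
      consider "l = j" | "l \<in> J" | "l \<notin> I" using J by blast
      then show "reflect_on I v x l =
        ((\<lambda>x. x(j := 1 * x j + - s x)) ((\<lambda>x. x(j := - 1 * x j + 0))
          ((\<lambda>x l. if l \<in> J then x l + b l * x j else x l) (x(j := 1 * x j + s x))))) l"
      proof cases
        case 1
        have eq: "(\<lambda>l. if l \<in> J then (x(j := 1 * x j + s x)) l + b l * (x(j := 1 * x j + s x)) j
            else (x(j := 1 * x j + s x)) l) = y"
          using J(2) by (auto simp: y_def fun_eq_iff)
        have vs: "v j * s v = V - v j * v j" using p by simp
        have "- (x j + s x) - (s x + (x j + s x) * (- 2 * (v j * s v) / V)) =
            x j - 2 * (v j * x j + v j * s x) / V * v j"
          unfolding vs using V by (simp add: field_simps)
        then have "- (x j + s x) - s (y(j := - (x j + s x))) = x j - 2 * p / V * v j"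
          unfolding s_y q_def p(1) by (simp add: mult.assoc)
        moreover have "y j = x j + s x" using J(2) by (simp add: y_def)
        ultimately show ?thesis
          unfolding eq using 1 j(1) J(2) by (simp add: reflect_on_def p_def V_def)
      next
        case 2
        then have "l \<noteq> j" "l \<in> I" using J by auto
        with 2 show ?thesis
          unfolding reflect_on_def p_def[symmetric] V_def[symmetric]
          by (simp add: p b_def field_simps)
      next
        case 3
        with x J show ?thesis
          by (auto simp: reflect_on_def space_PiM PiE_iff extensional_def)
      qed
    qed
  qed
qed

lemma gaussian_eq_density:
  fixes I :: "'i set"
  assumes I: "finite I"
  shows "gaussian I = density (lebesgue_product I) (\<lambda>x. \<Prod>i\<in>I. ennreal (std_normal_density (x i)))"
proof -
  interpret L: product_sigma_finite "\<lambda>_::'i. lborel :: real measure"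
    by (simp add: product_sigma_finite_def sigma_finite_lborel)
  interpret N: product_sigma_finite "\<lambda>_::'i. std_normal_distribution"
    by (simp add: product_sigma_finite_def real_distribution.axioms(1) real_dist_normal_dist
        prob_space_imp_sigma_finite)
  have "density (lebesgue_product I) (\<lambda>x. \<Prod>i\<in>I. ennreal (std_normal_density (x i))) = gaussian I"
  proof (rule N.PiM_eqI[OF I])
    show "sets (density (lebesgue_product I) (\<lambda>x. \<Prod>i\<in>I. ennreal (std_normal_density (x i)))) =
        sets (gaussian I)"
      by (simp cong: sets_PiM_cong)
    fix A :: "'i \<Rightarrow> real set" assume A: "\<And>i. i \<in> I \<Longrightarrow> A i \<in> sets std_normal_distribution"
    have [measurable]: "Pi\<^sub>E I A \<in> sets (lebesgue_product I)"
      using A I by (intro sets_PiM_I_finite) auto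
    have "emeasure (density (lebesgue_product I) (\<lambda>x. \<Prod>i\<in>I. ennreal (std_normal_density (x i)))) (Pi\<^sub>E I A)
      = (\<integral>\<^sup>+x. (\<Prod>i\<in>I. ennreal (std_normal_density (x i))) * indicator (Pi\<^sub>E I A) x \<partial>lebesgue_product I)"
      by (rule emeasure_density) (use I in measurable)
    also have "\<dots> = (\<integral>\<^sup>+x. (\<Prod>i\<in>I. ennreal (std_normal_density (x i)) * indicator (A i) (x i)) \<partial>lebesgue_product I)"
    proof (rule nn_integral_cong)
      fix x assume x: "x \<in> space (lebesgue_product I)"
      then have "(indicator (Pi\<^sub>E I A) x :: ennreal) = (\<Prod>i\<in>I. indicator (A i) (x i))"
        using I by (auto simp: space_PiM PiE_iff indicator_def prod.neutral split: if_splits)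
      then show "(\<Prod>i\<in>I. ennreal (std_normal_density (x i))) * indicator (Pi\<^sub>E I A) x =
          (\<Prod>i\<in>I. ennreal (std_normal_density (x i)) * indicator (A i) (x i))"
        by (simp add: prod.distrib)
    qed
    also have "\<dots> = (\<Prod>i\<in>I. (\<integral>\<^sup>+t. ennreal (std_normal_density t) * indicator (A i) t \<partial>lborel))"
      using A by (intro L.product_nn_integral_prod[OF I]) auto
    also have "\<dots> = (\<Prod>i\<in>I. emeasure std_normal_distribution (A i))"
      using A by (intro prod.cong refl) (simp add: emeasure_density)
    finally show "emeasure (density (lebesgue_product I) (\<lambda>x. \<Prod>i\<in>I. ennreal (std_normal_density (x i)))) (Pi\<^sub>E I A) = \<dots>" .
  qed
  then show ?thesis ..
qed

text \<open>The Gaussian density depends only on the norm, which a reflection keeps, and the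
  underlying Lebesgue measure is preserved as well.\<close>

lemma preserves_gaussian_reflect_on:
  fixes I :: "'i set"
  assumes I: "finite I"
  shows "preserves (gaussian I) (reflect_on I v)"
proof -
  let ?L = "lebesgue_product I" and ?R = "reflect_on I v"
  let ?g = "\<lambda>x. \<Prod>i\<in>I. ennreal (std_normal_density (x i))"
  have R: "?R \<in> measurable ?L ?L" "distr ?L ?L ?R = ?L"
    using preserves_lebesgue_reflect_on[OF I] by (auto simp: preserves_def)
  have g: "?g x = ennreal ((1 / sqrt (2 * pi)) ^ card I * exp (- (\<Sum>i\<in>I. x i * x i) / 2))" for x
    unfolding prod_ennreal[OF normal_density_nonneg]
    using I by (simp add: std_normal_density_def prod.distrib exp_sum[symmetric] sum_negf
        sum_divide_distrib power2_eq_square prod_dividef power_one_over)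
  have norm: "(\<Sum>i\<in>I. ?R x i * ?R x i) = (\<Sum>i\<in>I. x i * x i)" for x
  proof (cases "(\<Sum>l\<in>I. v l * v l) = 0")
    case True
    then show ?thesis by (simp add: reflect_on_def)
  next
    case False
    define c where "c = 2 * (\<Sum>l\<in>I. v l * x l) / (\<Sum>l\<in>I. v l * v l)"
    have "(\<Sum>i\<in>I. ?R x i * ?R x i) = (\<Sum>i\<in>I. x i * x i - 2 * c * (v i * x i) + c * c * (v i * v i))"
      by (intro sum.cong) (auto simp: reflect_on_def c_def[symmetric] algebra_simps)
    also have "\<dots> = (\<Sum>i\<in>I. x i * x i) - 2 * c * (\<Sum>l\<in>I. v l * x l) + c * c * (\<Sum>l\<in>I. v l * v l)"
      by (simp add: sum.distrib sum_subtractf sum_distrib_left)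
    also have "\<dots> = (\<Sum>i\<in>I. x i * x i)"
      using False by (simp add: c_def)
    finally show ?thesis .
  qed
  have gR: "?g (?R x) = ?g x" for x
    unfolding g norm ..
  have gm: "?g \<in> borel_measurable ?L" using I by measurable
  have "distr (density ?L ?g) ?L ?R = distr (density ?L (\<lambda>x. ?g (?R x))) ?L ?R"
    unfolding gR ..
  also have "\<dots> = density (distr ?L ?L ?R) ?g"
    by (rule density_distr[symmetric]) (use R gm in auto)
  also have "\<dots> = density ?L ?g" using R by simp
  finally have "distr (density ?L ?g) ?L ?R = density ?L ?g" .
  moreover have "distr (density ?L ?g) (density ?L ?g) ?R = distr (density ?L ?g) ?L ?R"
    by (rule distr_cong) auto
  ultimately show ?thesis
    using R(1) unfolding preserves_def gaussian_eq_density[OF I] by simp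
qed

subsection \<open>Number of coordinates above the mean\<close>

text \<open>A form of Slutsky's theorem: outside the event that \<open>X n\<close> and
  \<open>Y n\<close> differ by more than \<open>\<delta>\<close>, the event
  \<open>Y n \<le> x\<close> lies between \<open>X n \<le> x - \<delta>\<close> and
  \<open>X n \<le> x + \<delta>\<close>. Since \<open>\<mu>\<close> has no atoms, its distribution
  function is continuous at \<open>x\<close>, so a small \<open>\<delta>\<close> costs
  little.\<close>

lemma weak_conv_m_close:
  fixes X Y :: "nat \<Rightarrow> 'a \<Rightarrow> real"
  assumes M: "prob_space M" and \<mu>: "real_distribution \<mu>" and atomless: "\<And>x. measure \<mu> {x} = 0"
    and [measurable]: "\<And>n. X n \<in> borel_measurable M" "\<And>n. Y n \<in> borel_measurable M"
    and conv: "weak_conv_m (\<lambda>n. distr M borel (X n)) \<mu>"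
    and close: "\<And>\<delta>. \<delta> > 0 \<Longrightarrow> (\<lambda>n. measure M {\<omega>\<in>space M. \<bar>X n \<omega> - Y n \<omega>\<bar> > \<delta>}) \<longlonglongrightarrow> 0"
  shows "weak_conv_m (\<lambda>n::nat. distr M borel (Y n)) \<mu>"
proof -
  interpret prob_space M by fact
  interpret \<mu>: real_distribution \<mu> by fact
  let ?F = "cdf \<mu>"
  have cont: "isCont ?F x" for x using \<mu>.isCont_cdf atomless by blast
  have cdf_distr: "cdf (distr M borel Z) x = prob {\<omega>\<in>space M. Z \<omega> \<le> x}"
    if "Z \<in> borel_measurable M" for Z x
    using that by (simp add: cdf_def measure_distr vimage_def Int_def conj_commute)
  have convX: "(\<lambda>n. prob {\<omega>\<in>space M. X n \<omega> \<le> x}) \<longlonglongrightarrow> ?F x" for x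
    using conv cont[of x] by (simp add: weak_conv_m_def weak_conv_def cdf_distr)
  have "(\<lambda>n. prob {\<omega>\<in>space M. Y n \<omega> \<le> x}) \<longlonglongrightarrow> ?F x" for x
  proof (rule LIMSEQ_I)
    fix r :: real assume r: "r > 0"
    obtain d where d: "d > 0" "\<And>y. dist y x < d \<Longrightarrow> dist (?F y) (?F x) < r / 3"
      using cont[of x] r unfolding continuous_at_eps_delta by (meson divide_pos_pos zero_less_numeral)
    define \<delta> where "\<delta> = d / 2"
    have \<delta>: "\<delta> > 0" using d by (simp add: \<delta>_def)
    have Fp: "\<bar>?F (x + \<delta>) - ?F x\<bar> < r / 3" and Fm: "\<bar>?F (x - \<delta>) - ?F x\<bar> < r / 3"
      using d(2)[of "x + \<delta>"] d(2)[of "x - \<delta>"] d(1) by (auto simp: dist_real_def \<delta>_def)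
    let ?B = "\<lambda>n. {\<omega>\<in>space M. \<bar>X n \<omega> - Y n \<omega>\<bar> > \<delta>}"
    have "\<forall>\<^sub>F n in sequentially. \<bar>prob {\<omega>\<in>space M. X n \<omega> \<le> x + \<delta>} - ?F (x + \<delta>)\<bar> < r / 3"
      "\<forall>\<^sub>F n in sequentially. \<bar>prob {\<omega>\<in>space M. X n \<omega> \<le> x - \<delta>} - ?F (x - \<delta>)\<bar> < r / 3"
      "\<forall>\<^sub>F n in sequentially. \<bar>prob (?B n)\<bar> < r / 3"
      using tendstoD[OF convX[of "x + \<delta>"], of "r/3"] tendstoD[OF convX[of "x - \<delta>"], of "r/3"]
        tendstoD[OF close[OF \<delta>], of "r/3"] r
      by (simp_all add: dist_real_def)
    then have "\<forall>\<^sub>F n in sequentially. norm (prob {\<omega>\<in>space M. Y n \<omega> \<le> x} - ?F x) < r"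
    proof eventually_elim
      case (elim n)
      have "prob {\<omega>\<in>space M. Y n \<omega> \<le> x} \<le> prob ({\<omega>\<in>space M. X n \<omega> \<le> x + \<delta>} \<union> ?B n)"
        by (rule finite_measure_mono) (auto simp: abs_if split: if_splits)
      also have "\<dots> \<le> prob {\<omega>\<in>space M. X n \<omega> \<le> x + \<delta>} + prob (?B n)"
        by (rule measure_Un_le; measurable)
      finally have 1: "prob {\<omega>\<in>space M. Y n \<omega> \<le> x} \<le> \<dots>" .
      have "prob {\<omega>\<in>space M. X n \<omega> \<le> x - \<delta>} \<le> prob ({\<omega>\<in>space M. Y n \<omega> \<le> x} \<union> ?B n)"
        by (rule finite_measure_mono) (auto simp: abs_if split: if_splits)
      also have "\<dots> \<le> prob {\<omega>\<in>space M. Y n \<omega> \<le> x} + prob (?B n)"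
        by (rule measure_Un_le; measurable)
      finally have 2: "prob {\<omega>\<in>space M. X n \<omega> \<le> x - \<delta>} \<le> \<dots>" .
      have "prob {\<omega>\<in>space M. X n \<omega> \<le> x + \<delta>} < ?F (x + \<delta>) + r / 3" "prob (?B n) < r / 3"
        "?F (x - \<delta>) - r / 3 < prob {\<omega>\<in>space M. X n \<omega> \<le> x - \<delta>}"
        "?F (x + \<delta>) < ?F x + r / 3" "?F x - r / 3 < ?F (x - \<delta>)"
        using elim Fp Fm by (simp_all only: abs_less_iff) linarith+
      with 1 2 have "prob {\<omega>\<in>space M. Y n \<omega> \<le> x} - ?F x < r" "?F x - prob {\<omega>\<in>space M. Y n \<omega> \<le> x} < r"
        by linarith+
      then show ?case by (simp add: abs_less_iff)
    qed
    then show "\<exists>no. \<forall>n\<ge>no. norm (prob {\<omega>\<in>space M. Y n \<omega> \<le> x} - ?F x) < r"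
      by (simp add: eventually_sequentially)
  qed
  then show ?thesis by (simp add: weak_conv_m_def weak_conv_def cdf_distr)
qed

section \<open>Moments and interval probabilities of the standard normal law\<close>

interpretation N: real_distribution std_normal_distribution
  by (rule real_dist_normal_dist)

lemma std_normal_singleton: "measure std_normal_distribution {x} = 0"
proof -
  have "AE y in lborel. y \<in> {x} \<longrightarrow> ennreal (std_normal_density y) \<le> 0"
    by (rule AE_I'[of "{x}"]) (auto simp: null_sets_def)
  then have "emeasure std_normal_distribution {x} = 0"
    using null_sets_density_iff[of "\<lambda>y. ennreal (std_normal_density y)" lborel "{x}"]
    by (auto simp: null_sets_def)
  then show ?thesis by (simp add: measure_def)
qed

lemma integral_std_normal:
  fixes f :: "real \<Rightarrow> real"
  assumes "f \<in> borel_measurable borel"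
  shows "integral\<^sup>L std_normal_distribution f = (\<integral>x. std_normal_density x * f x \<partial>lborel)"
    and "integrable std_normal_distribution f \<longleftrightarrow> integrable lborel (\<lambda>x. std_normal_density x * f x)"
  using assms by (simp_all add: integral_density integrable_density)

lemma std_normal_second_moment:
  "integrable std_normal_distribution (\<lambda>x. x\<^sup>2)" "(\<integral>x. x\<^sup>2 \<partial>std_normal_distribution) = 1"
  using std_normal_moment_even[of 1]
  by (simp_all add: integral_std_normal has_bochner_integral_iff)

lemma std_normal_first_moment:
  "integrable std_normal_distribution (\<lambda>x. x)" "(\<integral>x. x \<partial>std_normal_distribution) = 0"
  using std_normal_moment_odd[of 0]
  by (simp_all add: integral_std_normal has_bochner_integral_iff)

lemma std_normal_abs_moment:
  "integrable std_normal_distribution (\<lambda>x. \<bar>x\<bar>)" "(\<integral>x. \<bar>x\<bar> \<partial>std_normal_distribution) = sqrt (2 / pi)"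
  using std_normal_moment_abs_odd[of 0]
  by (simp_all add: integral_std_normal has_bochner_integral_iff)

lemma std_normal_positive_half: "measure std_normal_distribution {0<..} = 1 / 2"
proof -
  have "emeasure std_normal_distribution {0<..} =
      (\<integral>\<^sup>+x. ennreal (std_normal_density x) * indicator {0<..} x \<partial>lborel)"
    by (simp add: emeasure_density)
  also have "\<dots> = (\<integral>\<^sup>+x. ennreal (std_normal_density (-x)) * indicator {0<..} (-x) \<partial>lborel)"
    by (subst nn_integral_real_affine[where c="-1" and t=0]) auto
  also have "\<dots> = (\<integral>\<^sup>+x. ennreal (std_normal_density x) * indicator {..<0} x \<partial>lborel)"
    by (intro nn_integral_cong) (auto simp: std_normal_density_def indicator_def)
  also have "\<dots> = emeasure std_normal_distribution {..<0}"
    by (simp add: emeasure_density)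
  finally have sym: "measure std_normal_distribution {0<..} = measure std_normal_distribution {..<0}"
    by (simp add: measure_def)
  have "measure std_normal_distribution ({..<0} \<union> {0} \<union> {0<..}) =
      measure std_normal_distribution ({..<0} \<union> {0}) + measure std_normal_distribution {0<..}"
    by (rule N.finite_measure_Union) auto
  also have "measure std_normal_distribution ({..<0} \<union> {0}) =
      measure std_normal_distribution {..<0} + measure std_normal_distribution {0}"
    by (rule N.finite_measure_Union) auto
  also have "{..<0} \<union> {0} \<union> {0<..} = (UNIV :: real set)" by auto
  finally show ?thesis
    using sym std_normal_singleton[of 0] N.prob_space by simp
qed

lemma std_normal_positive_part:
  "integrable std_normal_distribution (\<lambda>x. x * indicator {0<..} x)"
  "(\<integral>x. x * indicator {0<..} x \<partial>std_normal_distribution) = 1 / sqrt (2 * pi)"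
proof -
  have eq: "(\<lambda>x::real. x * indicator {0<..} x) = (\<lambda>x. (\<bar>x\<bar> + x) / 2)"
    by (auto simp: indicator_def fun_eq_iff)
  show "integrable std_normal_distribution (\<lambda>x. x * indicator {0<..} x)"
    unfolding eq using std_normal_abs_moment std_normal_first_moment by simp
  have "(\<integral>x. x * indicator {0<..} x \<partial>std_normal_distribution) = sqrt (2 / pi) / 2"
    unfolding eq using std_normal_abs_moment std_normal_first_moment by simp
  also have "\<dots> = 1 / sqrt (2 * pi)"
    by (simp add: real_sqrt_divide real_sqrt_mult field_simps)
  finally show "(\<integral>x. x * indicator {0<..} x \<partial>std_normal_distribution) = 1 / sqrt (2 * pi)" .
qed

text \<open>On the interval the density lies between \<open>1 / sqrt (2 * pi) - c\<^sup>2\<close>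
  and \<open>1 / sqrt (2 * pi)\<close>, because
  \<open>1 - x\<^sup>2 / 2 \<le> exp (- (x\<^sup>2 / 2))\<close>. Between 0 and \<open>s\<close> the
  error is cubic in \<open>s\<close>; summed over \<open>n\<close> coordinates with \<open>s\<close>
  of order \<open>1 / sqrt n\<close> and divided by \<open>sqrt n\<close>, it is of order
  \<open>1 / n\<close>.\<close>

lemma std_normal_interval:
  assumes "a \<le> b" "\<And>x. a < x \<Longrightarrow> x \<le> b \<Longrightarrow> \<bar>x\<bar> \<le> c"
  shows "\<bar>measure std_normal_distribution {a<..b} - (b - a) / sqrt (2 * pi)\<bar> \<le> c\<^sup>2 * (b - a)"
proof -
  let ?\<phi> = "1 / sqrt (2 * pi)"
  have "measure std_normal_distribution {a<..b} = (\<integral>x. indicator {a<..b} x \<partial>std_normal_distribution)"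
    by simp
  also have "\<dots> = (\<integral>x. std_normal_density x * indicator {a<..b} x \<partial>lborel)"
    by (rule integral_std_normal) simp
  finally have m: "measure std_normal_distribution {a<..b} =
      (\<integral>x. std_normal_density x * indicator {a<..b} x \<partial>lborel)" .
  have int: "integrable lborel (\<lambda>x. std_normal_density x * indicator {a<..b} x)"
    using integral_std_normal(2)[of "indicator {a<..b}"]
      integrable_real_indicator[of "{a<..b}" std_normal_distribution]
    by (simp add: N.emeasure_finite less_top[symmetric])
  have const: "integrable lborel (\<lambda>x. k * indicator {a<..b} x)"
    "(\<integral>x. k * indicator {a<..b} x \<partial>lborel) = k * (b - a)" for k :: real
    using assms(1) by (simp_all add: integrable_mult_right_iff)
  have pi: "0 < ?\<phi>" "?\<phi> \<le> 1"
    using pi_gt3 real_sqrt_ge_1_iff[of "2 * pi"] by (auto simp: field_simps)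
  have "(\<integral>x. std_normal_density x * indicator {a<..b} x \<partial>lborel) \<le> (\<integral>x. ?\<phi> * indicator {a<..b} x \<partial>lborel)"
    by (rule integral_mono[OF int const(1)])
       (auto simp: std_normal_density_def indicator_def field_simps)
  moreover have "(\<integral>x. (?\<phi> - c\<^sup>2) * indicator {a<..b} x \<partial>lborel) \<le>
      (\<integral>x. std_normal_density x * indicator {a<..b} x \<partial>lborel)"
  proof (rule integral_mono[OF const(1) int])
    fix x :: real
    show "(?\<phi> - c\<^sup>2) * indicator {a<..b} x \<le> std_normal_density x * indicator {a<..b} x"
    proof (cases "x \<in> {a<..b}")
      case True
      then have "x\<^sup>2 \<le> c\<^sup>2" using assms(2)[of x] by (simp add: abs_le_square_iff[symmetric])
      have "?\<phi> - c\<^sup>2 \<le> ?\<phi> - ?\<phi> * (x\<^sup>2 / 2)"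
        using mult_mono[OF pi(2), of "x\<^sup>2 / 2" "x\<^sup>2"] \<open>x\<^sup>2 \<le> c\<^sup>2\<close> by simp
      also have "\<dots> = ?\<phi> * (1 + - (x\<^sup>2 / 2))" by (simp add: algebra_simps)
      also have "\<dots> \<le> ?\<phi> * exp (- (x\<^sup>2 / 2))"
        using pi(1) by (intro mult_left_mono exp_ge_add_one_self) auto
      finally show ?thesis using True by (simp add: std_normal_density_def)
    qed simp
  qed
  ultimately show ?thesis unfolding m const by (simp add: abs_le_iff algebra_simps)
qed


section \<open>One Gaussian sequence for all dimensions, and deviations of its sums\<close>

lemma distr_gaussian_coordinate:
  "distr (gaussian UNIV) borel (\<lambda>\<omega>. \<omega> (i::nat)) = std_normal_distribution"
proof -
  have "distr (gaussian UNIV) borel (\<lambda>\<omega>. \<omega> i) =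
      distr (gaussian UNIV) std_normal_distribution (\<lambda>\<omega>. \<omega> i)"
    by (rule distr_cong) auto
  then show ?thesis by (simp add: distr_PiM_component[OF N.prob_space_axioms])
qed

lemma indep_vars_gaussian: "prob_space.indep_vars (gaussian UNIV) (\<lambda>_::nat. borel) (\<lambda>i \<omega>. \<omega> i) UNIV"
proof -
  interpret prob_space "gaussian (UNIV :: nat set)" by (rule prob_space_gaussian)
  have "distr (gaussian UNIV) (PiM UNIV (\<lambda>_. borel)) (\<lambda>\<omega>. \<lambda>i\<in>UNIV. \<omega> i) =
      distr (gaussian (UNIV :: nat set)) (gaussian UNIV) (\<lambda>\<omega>. \<omega>)"
    by (rule distr_cong) (auto cong: sets_PiM_cong)
  then show ?thesis
    by (subst indep_vars_iff_distr_eq_PiM') (auto simp: distr_gaussian_coordinate)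
qed

lemma gaussian_coordinate:
  fixes f :: "real \<Rightarrow> real" and i :: nat
  assumes "f \<in> borel_measurable borel"
  shows "(\<integral>\<omega>. f (\<omega> i) \<partial>gaussian UNIV) = integral\<^sup>L std_normal_distribution f"
    and "integrable (gaussian UNIV) (\<lambda>\<omega>. f (\<omega> i)) \<longleftrightarrow> integrable std_normal_distribution f"
  using assms integral_distr[of "\<lambda>\<omega>. \<omega> i" "gaussian UNIV" borel f]
    integrable_distr_eq[of "\<lambda>\<omega>. \<omega> i" "gaussian UNIV" borel f]
  by (simp_all add: distr_gaussian_coordinate)

text \<open>Chebyshev's inequality: by independence only the diagonal terms of the squared centered
  sum have nonzero expectation. The variance is bounded by the second moment, which is easy to
  evaluate where \<open>f\<close> is a difference of indicators.\<close>

lemma gaussian_sum_deviation: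
  fixes f :: "real \<Rightarrow> real" and n :: nat
  assumes f[measurable]: "f \<in> borel_measurable borel"
    and int: "integrable std_normal_distribution (\<lambda>x. (f x)\<^sup>2)" and a: "a > 0"
  shows "measure (gaussian UNIV) {\<omega>\<in>space (gaussian UNIV).
      a \<le> \<bar>(\<Sum>i<n. f (\<omega> i)) - n * integral\<^sup>L std_normal_distribution f\<bar>} \<le>
      n * (\<integral>x. (f x)\<^sup>2 \<partial>std_normal_distribution) / a\<^sup>2"
proof -
  interpret G: prob_space "gaussian (UNIV :: nat set)" by (rule prob_space_gaussian)
  let ?m = "integral\<^sup>L std_normal_distribution f"
  define g where "g x = f x - ?m" for x
  have [measurable]: "g \<in> borel_measurable borel" unfolding g_def by measurable
  have f_int: "integrable std_normal_distribution f"
    by (rule N.square_integrable_imp_integrable) (use int in auto)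
  have g_int: "integrable std_normal_distribution g" "integral\<^sup>L std_normal_distribution g = 0"
    unfolding g_def using f_int N.prob_space by simp_all
  have g2: "integrable std_normal_distribution (\<lambda>x. g x * g x)"
    "(\<integral>x. g x * g x \<partial>std_normal_distribution) \<le> (\<integral>x. (f x)\<^sup>2 \<partial>std_normal_distribution)"
  proof -
    have eq: "g x * g x = (f x)\<^sup>2 - 2 * ?m * f x + ?m\<^sup>2" for x
      by (simp add: g_def power2_eq_square algebra_simps)
    show "integrable std_normal_distribution (\<lambda>x. g x * g x)"
      unfolding eq using int f_int by simp
    have "(\<integral>x. g x * g x \<partial>std_normal_distribution) =
        (\<integral>x. (f x)\<^sup>2 \<partial>std_normal_distribution) - 2 * ?m * ?m + ?m\<^sup>2"
      unfolding eq using int f_int N.prob_space by simp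
    then show "(\<integral>x. g x * g x \<partial>std_normal_distribution) \<le> (\<integral>x. (f x)\<^sup>2 \<partial>std_normal_distribution)"
      by (simp add: power2_eq_square)
  qed
  have pair: "integrable (gaussian UNIV) (\<lambda>\<omega>. g (\<omega> i) * g (\<omega> j)) \<and>
      (\<integral>\<omega>. g (\<omega> i) * g (\<omega> j) \<partial>gaussian UNIV) =
        (if i = j then \<integral>x. g x * g x \<partial>std_normal_distribution else 0)" for i j :: nat
  proof (cases "i = j")
    case True
    then show ?thesis
      using gaussian_coordinate[of "\<lambda>x. g x * g x" i] g2(1) by simp
  next
    case False
    have "G.indep_vars (\<lambda>_. borel) (\<lambda>l \<omega>. g (\<omega> l)) {i, j}"
      using G.indep_vars_compose2[OF indep_vars_gaussian, of "\<lambda>_. g" "\<lambda>_. borel"]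
      by (rule G.indep_vars_subset) auto
    from G.indep_vars_lebesgue_integral[OF _ this] G.indep_vars_integrable[OF _ this] False
    show ?thesis
      using gaussian_coordinate[of g] g_int by simp
  qed
  define Z where "Z \<omega> = (\<Sum>i<n. g (\<omega> i))" for \<omega> :: "nat \<Rightarrow> real"
  have Z2: "(Z \<omega>)\<^sup>2 = (\<Sum>i<n. \<Sum>j<n. g (\<omega> i) * g (\<omega> j))" for \<omega>
    by (simp add: Z_def power2_eq_square sum_product)
  have [measurable]: "Z \<in> borel_measurable (gaussian UNIV)" unfolding Z_def by measurable
  have "(\<integral>\<omega>. (Z \<omega>)\<^sup>2 \<partial>gaussian UNIV) = (\<Sum>i<n. \<Sum>j<n. if i = j then \<integral>x. g x * g x \<partial>std_normal_distribution else 0)"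
    unfolding Z2 using pair by (simp add: Bochner_Integration.integral_sum)
  then have EZ2: "(\<integral>\<omega>. (Z \<omega>)\<^sup>2 \<partial>gaussian UNIV) = n * (\<integral>x. g x * g x \<partial>std_normal_distribution)"
    by simp
  have EZ: "(\<integral>\<omega>. Z \<omega> \<partial>gaussian UNIV) = 0"
    unfolding Z_def using gaussian_coordinate[of g] g_int by (simp add: Bochner_Integration.integral_sum)
  have "integrable (gaussian UNIV) (\<lambda>\<omega>. (Z \<omega>)\<^sup>2)"
    unfolding Z2 using pair by (intro Bochner_Integration.integrable_sum) simp
  from G.Chebyshev_inequality[OF _ this a]
  have "G.prob {\<omega>\<in>space (gaussian UNIV). a \<le> \<bar>Z \<omega>\<bar>} \<le> n * (\<integral>x. g x * g x \<partial>std_normal_distribution) / a\<^sup>2"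
    by (simp add: EZ EZ2)
  also have "\<dots> \<le> n * (\<integral>x. (f x)\<^sup>2 \<partial>std_normal_distribution) / a\<^sup>2"
    using g2(2) by (intro divide_right_mono mult_left_mono) auto
  also have "Z = (\<lambda>\<omega>. (\<Sum>i<n. f (\<omega> i)) - n * ?m)"
    by (simp add: fun_eq_iff Z_def g_def sum_subtractf)
  finally show ?thesis .
qed

text \<open>\<open>excess n t\<close> is the linearization error of the number of coordinates above \<open>t / sqrt n\<close>.\<close>

definition excess :: "nat \<Rightarrow> real \<Rightarrow> (nat \<Rightarrow> real) \<Rightarrow> real" where
  "excess n t \<omega> = ((\<Sum>i<n. indicator {t / sqrt n<..} (\<omega> i)) - (\<Sum>i<n. indicator {0<..} (\<omega> i))) / sqrt n
     + t / sqrt (2 * pi)"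

lemma excess_measurable [measurable]: "excess n t \<in> borel_measurable (gaussian UNIV)"
  unfolding excess_def by measurable

text \<open>Up to sign, \<open>D n\<close> is the indicator of the interval between 0 and
  \<open>s n\<close>. Its mean is \<open>- s n / sqrt (2 * pi)\<close> up to
  \<open>\<bar>s n\<bar> ^ 3\<close>, which is what the last term of \<open>excess\<close>
  compensates, and its second moment is of order \<open>\<bar>s n\<bar>\<close>, so Chebyshev's
  bound tends to 0.\<close>

lemma excess_tendsto_0:
  assumes \<eta>: "\<eta> > 0"
  shows "(\<lambda>n. measure (gaussian UNIV) {\<omega>\<in>space (gaussian UNIV). \<eta> < \<bar>excess n t \<omega>\<bar>}) \<longlonglongrightarrow> 0"
proof -
  interpret G: prob_space "gaussian (UNIV :: nat set)" by (rule prob_space_gaussian)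
  define s where "s n = t / sqrt (real n)" for n
  define D where "D n x = indicator {s n<..} x - (indicator {0<..} x :: real)" for n x
  define V where "V n = (\<integral>x. (D n x)\<^sup>2 \<partial>std_normal_distribution)" for n
  define m where "m n = (\<integral>x. D n x \<partial>std_normal_distribution)" for n
  have [measurable]: "D n \<in> borel_measurable borel" for n unfolding D_def by measurable
  have D2_int: "integrable std_normal_distribution (\<lambda>x. (D n x)\<^sup>2)" for n
    by (rule N.integrable_const_bound[where B=1]) (auto simp: D_def indicator_def)
  have c1: "1 / sqrt (2 * pi) \<le> 1"
    using pi_gt3 by (simp add: field_simps)
  have mV: "\<bar>m n + s n / sqrt (2 * pi)\<bar> \<le> \<bar>s n\<bar> ^ 3 \<and> V n \<le> \<bar>s n\<bar> + \<bar>s n\<bar> ^ 3" for n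
  proof (cases "s n \<ge> 0")
    case True
    let ?\<mu> = "measure std_normal_distribution {0<..s n}"
    have "D n x = - indicator {0<..s n} x" "(D n x)\<^sup>2 = indicator {0<..s n} x" for x
      using True by (auto simp: D_def indicator_def)
    then have eq: "m n = - ?\<mu>" "V n = ?\<mu>" by (simp_all add: m_def V_def)
    have "\<bar>?\<mu> - s n / sqrt (2 * pi)\<bar> \<le> (s n) ^ 3"
      using std_normal_interval[of 0 "s n" "s n"] True by (simp add: power3_eq_cube power2_eq_square)
    moreover have "s n / sqrt (2 * pi) \<le> s n"
      using mult_left_mono[OF c1 True] by simp
    ultimately show ?thesis unfolding eq using True by (simp add: abs_le_iff)
  next
    case False
    let ?\<mu> = "measure std_normal_distribution {s n<..0}"
    have "D n x = indicator {s n<..0} x" "(D n x)\<^sup>2 = indicator {s n<..0} x" for x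
      using False by (auto simp: D_def indicator_def)
    then have eq: "m n = ?\<mu>" "V n = ?\<mu>" by (simp_all add: m_def V_def)
    have "\<bar>?\<mu> - (- s n) / sqrt (2 * pi)\<bar> \<le> (- s n) ^ 3"
      using std_normal_interval[of "s n" 0 "- s n"] False by (simp add: power3_eq_cube power2_eq_square)
    moreover have "(- s n) / sqrt (2 * pi) \<le> - s n"
      using mult_left_mono[OF c1, of "- s n"] False by simp
    ultimately show ?thesis unfolding eq using False by (simp add: abs_le_iff)
  qed
  have s0: "s \<longlonglongrightarrow> 0" unfolding s_def by real_asymp
  have bias0: "(\<lambda>n. sqrt (real n) * \<bar>s n\<bar> ^ 3) \<longlonglongrightarrow> 0"
  proof -
    have "(\<lambda>n. \<bar>t\<bar> ^ 3 / real n) \<longlonglongrightarrow> 0" by real_asymp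
    moreover have "\<forall>\<^sub>F n in sequentially. \<bar>t\<bar> ^ 3 / real n = sqrt (real n) * \<bar>s n\<bar> ^ 3"
      using eventually_gt_at_top[of 0]
      by eventually_elim (simp add: s_def abs_divide power_divide power3_eq_cube)
    ultimately show ?thesis by (rule Lim_transform_eventually)
  qed
  have bound: "G.prob {\<omega>\<in>space (gaussian UNIV). \<eta> < \<bar>excess n t \<omega>\<bar>} \<le>
      4 * (\<bar>s n\<bar> + \<bar>s n\<bar> ^ 3) / \<eta>\<^sup>2" if n: "n > 0" "sqrt n * \<bar>s n\<bar> ^ 3 < \<eta> / 2" for n
  proof -
    \<comment> \<open>Fluctuation plus bias. The bias is below \<open>\<eta> / 2\<close> by
      assumption on \<open>n\<close>, so the fluctuation must account for the other
      \<open>\<eta> / 2\<close>.\<close>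
    have e: "excess n t \<omega> = ((\<Sum>i<n. D n (\<omega> i)) - n * m n) / sqrt n + sqrt n * (m n + s n / sqrt (2 * pi))" for \<omega>
    proof -
      have "n * m n / sqrt n = sqrt n * m n"
        by (metis of_nat_0_le_iff real_div_sqrt times_divide_eq_left)
      moreover have "sqrt n * (s n / sqrt (2 * pi)) = t / sqrt (2 * pi)"
        using n by (simp add: s_def)
      moreover have "excess n t \<omega> = (\<Sum>i<n. D n (\<omega> i)) / sqrt n + t / sqrt (2 * pi)"
        by (simp add: excess_def D_def s_def sum_subtractf)
      ultimately show ?thesis
        unfolding diff_divide_distrib distrib_left by linarith
    qed
    have "sqrt n * \<bar>m n + s n / sqrt (2 * pi)\<bar> \<le> sqrt n * \<bar>s n\<bar> ^ 3"
      using mV[of n] by (intro mult_left_mono) auto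
    moreover have "\<bar>sqrt n * (m n + s n / sqrt (2 * pi))\<bar> = sqrt n * \<bar>m n + s n / sqrt (2 * pi)\<bar>"
      by (simp add: abs_mult)
    ultimately have b: "\<bar>sqrt n * (m n + s n / sqrt (2 * pi))\<bar> < \<eta> / 2" using n(2) by linarith
    have "G.prob {\<omega>\<in>space (gaussian UNIV). \<eta> < \<bar>excess n t \<omega>\<bar>} \<le>
        G.prob {\<omega>\<in>space (gaussian UNIV). sqrt n * (\<eta> / 2) \<le> \<bar>(\<Sum>i<n. D n (\<omega> i)) - n * m n\<bar>}"
    proof (rule G.finite_measure_mono)
      show "{\<omega> \<in> space (gaussian UNIV). \<eta> < \<bar>excess n t \<omega>\<bar>} \<subseteq>
        {\<omega> \<in> space (gaussian UNIV). sqrt n * (\<eta> / 2) \<le> \<bar>(\<Sum>i<n. D n (\<omega> i)) - n * m n\<bar>}"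
      proof safe
        fix \<omega> assume "\<eta> < \<bar>excess n t \<omega>\<bar>"
        moreover have "\<eta> / 2 \<le> \<bar>x\<bar>" if "\<eta> < \<bar>x + y\<bar>" "\<bar>y\<bar> < \<eta> / 2" for x y
          using that by linarith
        ultimately have "\<eta> / 2 \<le> \<bar>((\<Sum>i<n. D n (\<omega> i)) - n * m n) / sqrt n\<bar>"
          using b unfolding e by blast
        then show "sqrt n * (\<eta> / 2) \<le> \<bar>(\<Sum>i<n. D n (\<omega> i)) - n * m n\<bar>"
          using n by (simp add: abs_divide field_simps)
      qed
    qed measurable
    also have "\<dots> \<le> n * V n / (sqrt n * (\<eta> / 2))\<^sup>2"
      unfolding m_def V_def
      by (rule gaussian_sum_deviation) (use D2_int n \<eta> in auto)
    also have "\<dots> = 4 * V n / \<eta>\<^sup>2" using n by (simp add: power_mult_distrib power_divide)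
    also have "\<dots> \<le> 4 * (\<bar>s n\<bar> + \<bar>s n\<bar> ^ 3) / \<eta>\<^sup>2"
      using mV[of n] by (intro divide_right_mono) auto
    finally show ?thesis .
  qed
  show ?thesis
  proof (rule tendsto_sandwich[OF _ _ tendsto_const])
    show "\<forall>\<^sub>F n in sequentially. 0 \<le> G.prob {\<omega>\<in>space (gaussian UNIV). \<eta> < \<bar>excess n t \<omega>\<bar>}" by simp
    have "\<forall>\<^sub>F n in sequentially. sqrt n * \<bar>s n\<bar> ^ 3 < \<eta> / 2"
      using order_tendstoD(2)[OF bias0, of "\<eta> / 2"] \<eta> by simp
    with eventually_gt_at_top[of 0]
    show "\<forall>\<^sub>F n in sequentially. G.prob {\<omega>\<in>space (gaussian UNIV). \<eta> < \<bar>excess n t \<omega>\<bar>} \<le>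
      4 * (\<bar>s n\<bar> + \<bar>s n\<bar> ^ 3) / \<eta>\<^sup>2"
      by eventually_elim (rule bound)
    have "(\<lambda>n. 4 * (\<bar>s n\<bar> + \<bar>s n\<bar> ^ 3) / \<eta>\<^sup>2) \<longlonglongrightarrow> 4 * (\<bar>0\<bar> + \<bar>0\<bar> ^ 3) / \<eta>\<^sup>2"
      by (intro tendsto_intros s0) (use \<eta> in auto)
    then show "(\<lambda>n. 4 * (\<bar>s n\<bar> + \<bar>s n\<bar> ^ 3) / \<eta>\<^sup>2) \<longlonglongrightarrow> 0" by simp
  qed
qed


text \<open>The count is decreasing in the threshold, and the linear term moves by at most
  \<open>b - a\<close> on the interval. The bound holds for each \<open>\<omega>\<close> separately,
  so it may be applied with a \<open>t\<close> that depends on \<open>\<omega>\<close>.\<close>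

lemma excess_between:
  assumes "a \<le> t" "t \<le> b" "n > 0"
  shows "\<bar>excess n t \<omega>\<bar> \<le> max \<bar>excess n a \<omega>\<bar> \<bar>excess n b \<omega>\<bar> + (b - a)"
proof -
  let ?I = "\<lambda>t. (\<Sum>i<n. indicator {t / sqrt n<..} (\<omega> i)) :: real"
  have mono: "?I y \<le> ?I x" if "x \<le> y" for x y
  proof (rule sum_mono)
    have "x / sqrt n \<le> y / sqrt n" using that by (simp add: divide_right_mono)
    then show "indicator {y / sqrt n<..} (\<omega> i) \<le> (indicator {x / sqrt n<..} (\<omega> i) :: real)" for i
      by (auto simp: indicator_def)
  qed
  let ?H = "(\<Sum>i<n. indicator {0<..} (\<omega> i)) :: real"
  have "(?I b - ?H) / sqrt n \<le> (?I t - ?H) / sqrt n" "(?I t - ?H) / sqrt n \<le> (?I a - ?H) / sqrt n"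
    using mono[OF assms(1)] mono[OF assms(2)] by (simp_all add: divide_right_mono)
  moreover have "(y - x) / sqrt (2 * pi) \<le> y - x" if "x \<le> y" for x y :: real
  proof -
    have "1 / sqrt (2 * pi) \<le> 1" using pi_gt3 by (simp add: field_simps)
    from mult_left_mono[OF this, of "y - x"] that show ?thesis by simp
  qed
  from this[OF assms(1)] this[OF assms(2)]
  have "t / sqrt (2 * pi) - a / sqrt (2 * pi) \<le> t - a" "b / sqrt (2 * pi) - t / sqrt (2 * pi) \<le> b - t"
    by (simp_all add: diff_divide_distrib)
  ultimately have "excess n t \<omega> \<le> excess n a \<omega> + (b - a)" "excess n b \<omega> - (b - a) \<le> excess n t \<omega>"
    using assms(1,2) unfolding excess_def by linarith+
  then show ?thesis by (simp add: abs_le_iff max_def) linarith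
qed

text \<open>The random argument has mean 0 and variance 1, so it leaves \<open>[-K, K]\<close> with
  probability at most \<open>1 / K\<^sup>2\<close> for every \<open>n > 0\<close>. On that interval
  finitely many grid points, their number independent of \<open>n\<close>, control all values by
  monotonicity.\<close>

lemma excess_random_tendsto_0:
  assumes \<delta>: "\<delta> > 0"
  shows "(\<lambda>n. measure (gaussian UNIV) {\<omega>\<in>space (gaussian UNIV).
      \<delta> < \<bar>excess n ((\<Sum>i<n. \<omega> i) / sqrt n) \<omega>\<bar>}) \<longlonglongrightarrow> 0"
proof (rule LIMSEQ_I)
  interpret G: prob_space "gaussian (UNIV :: nat set)" by (rule prob_space_gaussian)
  fix r :: real assume r: "r > 0"
  define T where "T n \<omega> = (\<Sum>i<n. \<omega> i) / sqrt n" for n and \<omega> :: "nat \<Rightarrow> real"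
  have [measurable]: "T n \<in> borel_measurable (gaussian UNIV)" for n unfolding T_def by measurable
  \<comment> \<open>One half of \<open>\<delta>\<close> for the values at the grid points, the other
    half for the mesh.\<close>
  define \<eta> where "\<eta> = \<delta> / 2"
  have \<eta>: "\<eta> > 0" using \<delta> by (simp add: \<eta>_def)
  obtain k :: nat where k: "inverse (real (Suc k)) < r / 2"
    using reals_Archimedean[of "r / 2"] r by auto
  define K where "K = real (Suc k)"
  have K: "K \<ge> 1" "1 / K\<^sup>2 < r / 2"
  proof -
    show "K \<ge> 1" by (simp add: K_def)
    then have "1 / K\<^sup>2 \<le> 1 / K" by (intro divide_left_mono) (auto simp: power2_eq_square)
    with k show "1 / K\<^sup>2 < r / 2" by (simp add: K_def inverse_eq_divide)
  qed
  define t where "t j = - K + real j * \<eta>" for j :: nat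
  obtain J :: nat where J: "2 * K / \<eta> \<le> real J" using real_arch_simple by blast
  have cover: "\<exists>j\<le>J. t j \<le> x \<and> x \<le> t (Suc j)" if "\<bar>x\<bar> \<le> K" for x
  proof -
    define j where "j = nat \<lfloor>(x + K) / \<eta>\<rfloor>"
    have nn: "(x + K) / \<eta> \<ge> 0" using that \<eta> by auto
    have rj: "real j = of_int \<lfloor>(x + K) / \<eta>\<rfloor>" using nn by (simp add: j_def)
    have "real j \<le> (x + K) / \<eta>" "(x + K) / \<eta> \<le> real j + 1" unfolding rj by linarith+
    then have b: "real j * \<eta> \<le> x + K" "x + K \<le> (real j + 1) * \<eta>" using \<eta> by (simp_all add: field_simps)
    have "(x + K) / \<eta> \<le> 2 * K / \<eta>" using that \<eta> by (intro divide_right_mono) auto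
    with J \<open>real j \<le> (x + K) / \<eta>\<close> have "j \<le> J" by linarith
    with b show ?thesis by (intro exI[of _ j]) (auto simp: t_def algebra_simps)
  qed
  have T_tail: "G.prob {\<omega>\<in>space (gaussian UNIV). K \<le> \<bar>T n \<omega>\<bar>} \<le> 1 / K\<^sup>2" if "n > 0" for n
  proof -
    have "{\<omega>\<in>space (gaussian UNIV). K \<le> \<bar>T n \<omega>\<bar>} = {\<omega>\<in>space (gaussian UNIV).
        sqrt n * K \<le> \<bar>(\<Sum>i<n. \<omega> i) - n * integral\<^sup>L std_normal_distribution (\<lambda>x. x)\<bar>}"
      using that by (simp add: T_def std_normal_first_moment abs_divide field_simps)
    also have "G.prob \<dots> \<le> n * (\<integral>x. x\<^sup>2 \<partial>std_normal_distribution) / (sqrt n * K)\<^sup>2"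
      by (rule gaussian_sum_deviation) (use std_normal_second_moment that K in auto)
    also have "\<dots> = 1 / K\<^sup>2" using that by (simp add: std_normal_second_moment power_mult_distrib)
    finally show ?thesis .
  qed
  let ?E = "\<lambda>n j. {\<omega>\<in>space (gaussian UNIV). \<eta> < \<bar>excess n (t j) \<omega>\<bar>}"
  have bound: "G.prob {\<omega>\<in>space (gaussian UNIV). \<delta> < \<bar>excess n (T n \<omega>) \<omega>\<bar>} \<le>
      1 / K\<^sup>2 + (\<Sum>j\<le>Suc J. G.prob (?E n j))" if n: "n > 0" for n
  proof -
    have "G.prob {\<omega>\<in>space (gaussian UNIV). \<delta> < \<bar>excess n (T n \<omega>) \<omega>\<bar>} \<le>
      G.prob ({\<omega>\<in>space (gaussian UNIV). K \<le> \<bar>T n \<omega>\<bar>} \<union> (\<Union>j\<in>{..Suc J}. ?E n j))"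
    proof (rule G.finite_measure_mono)
      show "{\<omega>\<in>space (gaussian UNIV). \<delta> < \<bar>excess n (T n \<omega>) \<omega>\<bar>} \<subseteq>
        {\<omega>\<in>space (gaussian UNIV). K \<le> \<bar>T n \<omega>\<bar>} \<union> (\<Union>j\<in>{..Suc J}. ?E n j)"
      proof (rule subsetI, rule ccontr)
        fix \<omega> assume w: "\<omega> \<in> {\<omega>\<in>space (gaussian UNIV). \<delta> < \<bar>excess n (T n \<omega>) \<omega>\<bar>}"
          and "\<omega> \<notin> {\<omega>\<in>space (gaussian UNIV). K \<le> \<bar>T n \<omega>\<bar>} \<union> (\<Union>j\<in>{..Suc J}. ?E n j)"
        then have "\<bar>T n \<omega>\<bar> \<le> K" and "\<forall>j\<in>{..Suc J}. \<bar>excess n (t j) \<omega>\<bar> \<le> \<eta>"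
          by (auto simp: not_less)
        then have e: "\<And>j. j \<le> Suc J \<Longrightarrow> \<bar>excess n (t j) \<omega>\<bar> \<le> \<eta>" by simp
        obtain j where j: "j \<le> J" "t j \<le> T n \<omega>" "T n \<omega> \<le> t (Suc j)"
          using cover \<open>\<bar>T n \<omega>\<bar> \<le> K\<close> by blast
        from excess_between[OF j(2,3) n, of \<omega>] e[of j] e[of "Suc j"] j(1)
        have "\<bar>excess n (T n \<omega>) \<omega>\<bar> \<le> \<eta> + \<eta>" by (simp add: t_def algebra_simps)
        with w show False by (simp add: \<eta>_def)
      qed
    qed measurable
    also have "\<dots> \<le> G.prob {\<omega>\<in>space (gaussian UNIV). K \<le> \<bar>T n \<omega>\<bar>} + G.prob (\<Union>j\<in>{..Suc J}. ?E n j)"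
      by (rule measure_Un_le; measurable)
    also have "\<dots> \<le> 1 / K\<^sup>2 + (\<Sum>j\<in>{..Suc J}. G.prob (?E n j))"
      by (intro add_mono T_tail n G.finite_measure_subadditive_finite) auto
    finally show ?thesis .
  qed
  have "(\<lambda>n. \<Sum>j\<le>Suc J. G.prob (?E n j)) \<longlonglongrightarrow> (\<Sum>j\<le>Suc J. 0)"
    by (intro tendsto_sum excess_tendsto_0 \<eta>)
  then have "\<forall>\<^sub>F n in sequentially. (\<Sum>j\<le>Suc J. G.prob (?E n j)) < r / 2"
    using r by (intro order_tendstoD(2)) auto
  with eventually_gt_at_top[of 0]
  have "\<forall>\<^sub>F n in sequentially. norm (G.prob {\<omega>\<in>space (gaussian UNIV). \<delta> < \<bar>excess n (T n \<omega>) \<omega>\<bar>} - 0) < r"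
  proof eventually_elim
    case (elim n)
    with bound[of n] K(2) show ?case by simp
  qed
  then show "\<exists>no. \<forall>n\<ge>no. norm (G.prob {\<omega>\<in>space (gaussian UNIV).
      \<delta> < \<bar>excess n ((\<Sum>i<n. \<omega> i) / sqrt n) \<omega>\<bar>} - 0) < r"
    by (simp add: eventually_sequentially T_def)
qed

text \<open>The mean equals \<open>t / sqrt n\<close> for
  \<open>t = (\<Sum>i<n. \<omega> i) / sqrt n\<close>, so \<open>excess\<close> at this random
  \<open>t\<close> compares the count above the mean with the count above 0, less a multiple of the
  sum of the coordinates. Collecting the terms of one coordinate gives the summand
  \<open>f\<close>.\<close>

lemma clt_above_mean:
  assumes \<sigma>: "\<sigma> > 0" "\<sigma>\<^sup>2 = 1 / 4 - 1 / (2 * pi)"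
  shows "weak_conv_m (\<lambda>n::nat. distr (gaussian UNIV) borel (\<lambda>\<omega>::nat \<Rightarrow> real.
      (real (card {i\<in>{..<n}. \<omega> i > (\<Sum>j<n. \<omega> j) / n}) - n / 2) / (\<sigma> * sqrt n))) std_normal_distribution"
proof -
  interpret G: prob_space "gaussian (UNIV :: nat set)" by (rule prob_space_gaussian)
  let ?c = "1 / sqrt (2 * pi)"
  define f where "f x = indicator {0<..} x - ?c * x" for x :: real
  have [measurable]: "f \<in> borel_measurable borel" unfolding f_def by measurable
  have ind: "integrable std_normal_distribution (indicator {0<..} :: real \<Rightarrow> real)"
    by (rule N.integrable_const_bound[where B=1]) (auto simp: indicator_def)
  have f1: "integrable std_normal_distribution f" "integral\<^sup>L std_normal_distribution f = 1 / 2"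
    unfolding f_def using ind std_normal_first_moment std_normal_positive_half by simp_all
  have f2_eq: "(f x)\<^sup>2 = indicator {0<..} x - 2 * ?c * (x * indicator {0<..} x) + ?c\<^sup>2 * x\<^sup>2" for x
    by (auto simp: f_def indicator_def power2_eq_square algebra_simps)
  have f2: "integrable std_normal_distribution (\<lambda>x. (f x)\<^sup>2)"
    unfolding f2_eq using ind std_normal_second_moment std_normal_positive_part by simp
  have "(\<integral>x. (f x)\<^sup>2 \<partial>std_normal_distribution) = 1 / 2 - 2 * ?c * ?c + ?c\<^sup>2"
    \<comment> \<open>The mixed term contributes \<open>- 2 * ?c * ?c\<close> because the mean of
      the positive part is again \<open>?c\<close>.\<close>
    unfolding f2_eq using ind std_normal_second_moment std_normal_positive_part std_normal_positive_half
    by simp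
  also have "\<dots> = 1 / 2 - 1 / (2 * pi)" by (simp add: power2_eq_square)
  finally have f2_val: "(\<integral>x. (f x)\<^sup>2 \<partial>std_normal_distribution) = 1 / 2 - 1 / (2 * pi)" .
  have mean: "G.expectation (\<lambda>\<omega>. f (\<omega> i)) = 1 / 2" for i :: nat
    using gaussian_coordinate[of f i] f1 by simp
  have sq: "integrable (gaussian UNIV) (\<lambda>\<omega>. (f (\<omega> i))\<^sup>2)" for i :: nat
    using gaussian_coordinate[of "\<lambda>x. (f x)\<^sup>2" i] f2 by simp
  have "weak_conv_m (\<lambda>n::nat. distr (gaussian UNIV) borel (\<lambda>\<omega>::nat \<Rightarrow> real. (\<Sum>i<n. f (\<omega> i) - 1 / 2) / sqrt (n * \<sigma>\<^sup>2)))
      std_normal_distribution"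
  proof (rule G.central_limit_theorem[where \<mu> = "distr std_normal_distribution borel f"])
    show "G.indep_vars (\<lambda>_. borel) (\<lambda>i \<omega>. f (\<omega> i)) UNIV"
      using G.indep_vars_compose2[OF indep_vars_gaussian, of "\<lambda>_. f" "\<lambda>_. borel"] by simp
    show "G.variance (\<lambda>\<omega>. f (\<omega> i)) = \<sigma>\<^sup>2" for i :: nat
    proof -
      have "integrable (gaussian UNIV) (\<lambda>\<omega>. f (\<omega> i))"
        using gaussian_coordinate[of f i] f1 by simp
      from G.variance_eq[OF this sq]
      show ?thesis
        using gaussian_coordinate[of "\<lambda>x. (f x)\<^sup>2" i] f2_val \<sigma>(2)
        by (simp add: mean power2_eq_square)
    qed
    show "distr (gaussian UNIV) borel (\<lambda>\<omega>. f (\<omega> i)) = distr std_normal_distribution borel f" for i :: nat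
      by (subst distr_gaussian_coordinate[of i, symmetric], subst distr_distr) (auto simp: comp_def)
  qed (use mean sq \<sigma> in auto)
  then show ?thesis
  proof (rule weak_conv_m_close[rotated -2])
    fix \<delta> :: real assume \<delta>: "\<delta> > 0"
    have "\<forall>\<^sub>F n in sequentially. G.prob {\<omega>\<in>space (gaussian UNIV).
        \<delta> * \<sigma> < \<bar>excess n ((\<Sum>i<n. \<omega> i) / sqrt n) \<omega>\<bar>} =
      G.prob {\<omega>\<in>space (gaussian UNIV). \<delta> < \<bar>(\<Sum>i<n. f (\<omega> i) - 1 / 2) / sqrt (n * \<sigma>\<^sup>2) -
        (real (card {i\<in>{..<n}. \<omega> i > (\<Sum>j<n. \<omega> j) / n}) - n / 2) / (\<sigma> * sqrt n)\<bar>}"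
      using eventually_gt_at_top[of 0]
    proof eventually_elim
      case (elim n)
      \<comment> \<open>An exact identity: the centering terms cancel and the whole difference is
        the linearization error, rescaled by \<open>\<sigma>\<close>.\<close>
      have "(\<Sum>i<n. f (\<omega> i) - 1 / 2) / sqrt (n * \<sigma>\<^sup>2) -
        (real (card {i\<in>{..<n}. \<omega> i > (\<Sum>j<n. \<omega> j) / n}) - n / 2) / (\<sigma> * sqrt n) =
        - excess n ((\<Sum>i<n. \<omega> i) / sqrt n) \<omega> / \<sigma>" for \<omega> :: "nat \<Rightarrow> real"
      proof -
        have alg: "(h - q - m) / (v * r) - (c - m) / (v * r) = - ((c - h) / r + q / r) / v"
          if "r > 0" "v > 0" for h q m v r c :: real
          using that by (simp add: field_simps)
        define C where "C = real (card {i\<in>{..<n}. \<omega> i > (\<Sum>j<n. \<omega> j) / n})"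
        define H where "H = (\<Sum>i<n. indicator {0<..} (\<omega> i) :: real)"
        define Q where "Q = (\<Sum>i<n. \<omega> i)"
        have "(\<Sum>i<n. indicator {Q / n<..} (\<omega> i)) = C"
          unfolding C_def Q_def by (simp add: indicator_def of_bool_def sum.If_cases Int_def)
        then have 1: "excess n (Q / sqrt n) \<omega> = (C - H) / sqrt n + ?c * (Q / sqrt n)"
          using elim by (simp add: excess_def H_def)
        have 2: "(\<Sum>i<n. f (\<omega> i) - 1 / 2) = H - ?c * Q - n / 2"
          by (simp add: f_def sum_subtractf H_def Q_def sum_distrib_left)
        have 3: "sqrt (n * \<sigma>\<^sup>2) = \<sigma> * sqrt n" using \<sigma>(1) by (simp add: real_sqrt_mult)
        show ?thesis
          unfolding C_def[symmetric] unfolding Q_def[symmetric] 1 2 3 times_divide_eq_right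
          by (rule alg) (use \<sigma>(1) elim in auto)
      qed
      then show ?case using \<sigma>(1) by (simp add: abs_divide pos_less_divide_eq)
    qed
    then show "(\<lambda>n. G.prob {\<omega>\<in>space (gaussian UNIV). \<delta> < \<bar>(\<Sum>i<n. f (\<omega> i) - 1 / 2) / sqrt (n * \<sigma>\<^sup>2) -
        (real (card {i\<in>{..<n}. \<omega> i > (\<Sum>j<n. \<omega> j) / n}) - n / 2) / (\<sigma> * sqrt n)\<bar>}) \<longlonglongrightarrow> 0"
      by (rule Lim_transform_eventually[OF excess_random_tendsto_0[OF mult_pos_pos[OF \<delta> \<sigma>(1)]]])
  next
    fix n
    have "real (card {i\<in>{..<n}. \<omega> i > (\<Sum>j<n. \<omega> j) / n}) =
        (\<Sum>i<n. if \<omega> i > (\<Sum>j<n. \<omega> j) / n then 1 else 0)" for \<omega> :: "nat \<Rightarrow> real"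
      by (simp add: sum.If_cases Int_def)
    then show "(\<lambda>\<omega>::nat \<Rightarrow> real. (real (card {i\<in>{..<n}. \<omega> i > (\<Sum>j<n. \<omega> j) / n}) - n / 2) / (\<sigma> * sqrt n))
        \<in> borel_measurable (gaussian UNIV)"
      by simp
  qed (simp_all add: prob_space_gaussian real_dist_normal_dist std_normal_singleton)
qed

subsection \<open>Gram-Schmidt vectors of a Gaussian array\<close>

abbreviation grid :: "nat \<Rightarrow> nat \<Rightarrow> (nat \<times> nat) set" where
  "grid n K \<equiv> {..<n} \<times> {..<K}"

text \<open>Entries off the grid are \<open>undefined\<close> in the product space. Filling with 0,
  as in \<open>ones n\<close>, makes reflections and residuals vanish from \<open>n\<close>
  on.\<close>

definition col :: "nat \<Rightarrow> (nat \<times> nat \<Rightarrow> real) \<Rightarrow> nat \<Rightarrow> nat \<Rightarrow> real" where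
  "col n x k = (\<lambda>i. if i < n then x (i, k) else 0)"

definition ones :: "nat \<Rightarrow> nat \<Rightarrow> real" where
  "ones n = (\<lambda>i. if i < n then 1 else 0)"

lemma ip_ones: "ip n x (ones n) = (\<Sum>i<n. x i)"
  by (simp add: ip_def ones_def)

lemma ip_ones_ones: "ip n (ones n) (ones n) = real n"
  by (simp add: ip_def ones_def cong: sum.cong_simp)

text \<open>Deterministic vectors precede the random columns: \<open>ones n\<close> alone
  (\<open>m = 1\<close>) for affine dependences, or \<open>ones n\<close> and an axis vector
  (\<open>m = 2\<close>) to show that an entry of the dependence is not zero.\<close>

definition frame :: "nat \<Rightarrow> nat \<Rightarrow> (nat \<Rightarrow> nat \<Rightarrow> real) \<Rightarrow> (nat \<times> nat \<Rightarrow> real) \<Rightarrow> nat \<Rightarrow> nat \<Rightarrow> real" where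
  "frame n m f x j = (if j < m then f j else col n x (j - m))"

lemma frame_measurable:
  "j < m + K \<Longrightarrow> (\<lambda>x. frame n m f x j i) \<in> borel_measurable (gaussian (grid n K))"
  by (cases "j < m"; cases "i < n") (auto simp: frame_def col_def)

lemma ip_measurable:
  assumes "\<And>i. (\<lambda>x. f x i) \<in> borel_measurable M" "\<And>i. (\<lambda>x. g x i) \<in> borel_measurable M"
  shows "(\<lambda>x. ip n (f x) (g x)) \<in> borel_measurable M"
  unfolding ip_def by (intro borel_measurable_sum borel_measurable_times assms)

lemma gs_residual_measurable:
  assumes "\<And>j i. j < k \<Longrightarrow> (\<lambda>x. u x j i) \<in> borel_measurable M"
    and "\<And>i. (\<lambda>x. y x i) \<in> borel_measurable M"
  shows "(\<lambda>x. gs_residual n (u x) k (y x) i) \<in> borel_measurable M"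
  using assms
proof (induction k arbitrary: y i)
  case (Suc k)
  have a: "(\<lambda>x. gs_residual n (u x) k (u x k) i) \<in> borel_measurable M" for i
    by (rule Suc.IH) (use Suc.prems in auto)
  have r: "(\<lambda>x. gs_residual n (u x) k (y x) i) \<in> borel_measurable M" for i
    by (rule Suc.IH) (use Suc.prems in auto)
  note [measurable] = a r ip_measurable[OF Suc.prems(2) a] ip_measurable[OF a a]
  show ?case by simp
qed simp

text \<open>Every line in direction \<open>p\<close> meets \<open>A\<close> in at most one point,
  and the normal law has no atoms; integrate over the other coordinates.\<close>

lemma gaussian_null_single_coordinate:
  fixes I :: "'i set"
  assumes I: "finite I" "p \<in> I" and A: "A \<in> sets (gaussian I)"
    and single: "\<And>x y y'. x(p := y) \<in> A \<Longrightarrow> x(p := y') \<in> A \<Longrightarrow> y = y'"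
  shows "A \<in> null_sets (gaussian I)"
proof -
  interpret product_sigma_finite "\<lambda>_::'i. std_normal_distribution"
    by (simp add: product_sigma_finite_def N.sigma_finite_measure_axioms)
  define J where "J = I - {p}"
  have J: "finite J" "p \<notin> J" "I = insert p J" using I by (auto simp: J_def)
  have "emeasure (gaussian I) A = (\<integral>\<^sup>+x. indicator A x \<partial>gaussian (insert p J))"
    using A J(3) by simp
  also have "\<dots> = (\<integral>\<^sup>+x. (\<integral>\<^sup>+y. indicator A (x(p := y)) \<partial>std_normal_distribution) \<partial>gaussian J)"
    by (rule product_nn_integral_insert[OF J(1,2)]) (use A J(3) in simp)
  also have "\<dots> = (\<integral>\<^sup>+x. 0 \<partial>gaussian J)"
  proof (rule nn_integral_cong)
    fix x :: "'i \<Rightarrow> real"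
    obtain z where z: "{y. x(p := y) \<in> A} \<subseteq> {z}" using single[of x] by blast
    have "emeasure std_normal_distribution {z} = 0"
      by (simp add: N.emeasure_eq_measure std_normal_singleton)
    then have "AE y in std_normal_distribution. indicator A (x(p := y)) = (0::ennreal)"
      using z by (intro AE_I'[of "{z}"]) (auto simp: null_sets_def indicator_def)
    then show "(\<integral>\<^sup>+y. indicator A (x(p := y)) \<partial>std_normal_distribution) = 0"
      using nn_integral_cong_AE[of _ "\<lambda>_. 0" std_normal_distribution] by simp
  qed
  finally show ?thesis using A by (simp add: null_sets_def)
qed

text \<open>
  The \<open>i\<close>-th coordinate of a residual is affine in the single entry \<open>x (i, k)\<close>.  The slope is a diagonal
  entry of the projection matrix, and these do not all vanish because the trace is positive.
\<close>

lemma AE_gs_vec_frame: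
  assumes f: "\<And>j. j < m \<Longrightarrow> ip n (gs_vec n f j) (gs_vec n f j) \<noteq> 0"
    and L: "L \<le> K" "m + L \<le> n"
  shows "AE x in gaussian (grid n K). \<forall>j<m + L.
    ip n (gs_vec n (frame n m f x) j) (gs_vec n (frame n m f x) j) \<noteq> 0"
proof -
  let ?u = "frame n m f" and ?G = "gaussian (grid n K)"
  have "AE x in ?G. \<forall>k\<in>{..<L}. ip n (gs_vec n (?u x) (m + k)) (gs_vec n (?u x) (m + k)) \<noteq> 0"
  proof (rule AE_finite_allI)
    fix k assume "k \<in> {..<L}"
    then have k: "k < L" by simp
    define c where "c i x = gs_residual n (?u x) (m + k) (axis_fun i) i" for i x
    define A where "A i = {x\<in>space ?G. c i x \<noteq> 0 \<and> gs_vec n (?u x) (m + k) i = 0}" for i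
    have [measurable]: "(\<lambda>x. c i x) \<in> borel_measurable ?G"
      "(\<lambda>x. gs_vec n (?u x) (m + k) i) \<in> borel_measurable ?G" for i
      unfolding c_def using k L by (auto intro!: gs_residual_measurable frame_measurable)
    have "A i \<in> null_sets ?G" if i: "i < n" for i
    proof (rule gaussian_null_single_coordinate)
      show "(i, k) \<in> grid n K" using i k L by auto
      show "A i \<in> sets ?G" unfolding A_def by measurable
      fix x :: "nat \<times> nat \<Rightarrow> real" and y y' assume yy: "x((i, k) := y) \<in> A i" "x((i, k) := y') \<in> A i"
      \<comment> \<open>The vectors before index \<open>m + k\<close> come from \<open>f\<close> and
        the columns before \<open>k\<close>, so the projection, and with it the slope, ignores the
        entry \<open>(i, k)\<close>.\<close>
      have u_upd: "?u (x((i, k) := y)) j = ?u x j" if "j < m + k" for j y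
        using that by (auto simp: frame_def col_def fun_eq_iff)
      have res: "gs_residual n (?u (x((i, k) := y))) (m + k) = gs_residual n (?u x) (m + k)" for y
        by (rule ext, rule gs_residual_cong) (rule u_upd)
      have cc: "c i (x((i, k) := y)) = c i x" for y
        by (simp add: c_def res)
      have "?u (x((i, k) := y)) (m + k) = ?u x (m + k) + (y - x (i, k)) *\<^sub>R axis_fun i" for y
        using i by (auto simp: frame_def col_def axis_fun_def fun_eq_iff)
      then have lin: "gs_vec n (?u (x((i, k) := y))) (m + k) i =
          gs_vec n (?u x) (m + k) i + (y - x (i, k)) * c i x" for y
        by (simp add: res gs_residual_linear c_def)
      have zero: "gs_vec n (?u (x((i, k) := y))) (m + k) i = 0"
        "gs_vec n (?u (x((i, k) := y'))) (m + k) i = 0" "c i x \<noteq> 0"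
        using yy unfolding A_def mem_Collect_eq cc by blast+
      have "(y - x (i, k)) * c i x = (y' - x (i, k)) * c i x"
        using zero(1,2) unfolding lin by linarith
      with zero(3) show "y = y'" by simp
    qed simp
    then have "AE x in ?G. \<forall>i\<in>{..<n}. x \<notin> A i"
      by (intro AE_finite_allI) (auto intro: AE_not_in)
    moreover have "AE x in ?G. x \<in> space ?G" by simp
    ultimately show "AE x in ?G. ip n (gs_vec n (?u x) (m + k)) (gs_vec n (?u x) (m + k)) \<noteq> 0"
    proof eventually_elim
      case (elim x)
      obtain i where "i < n" "c i x \<noteq> 0"
        using ex_gs_residual_axis_neq_0[of "m + k" n "?u x"] k L unfolding c_def by auto
      with elim have "gs_vec n (?u x) (m + k) i \<noteq> 0" unfolding A_def by blast
      with \<open>i < n\<close> show ?case unfolding ip_self_eq_0_iff by blast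
    qed
  qed simp
  then show ?thesis
  proof eventually_elim
    case (elim x)
    have "ip n (gs_vec n (?u x) j) (gs_vec n (?u x) j) \<noteq> 0" if "j < m" for j
    proof -
      have "gs_residual n (?u x) j (?u x j) = gs_residual n f j (f j)"
        using that gs_residual_cong[of j "?u x" f n] by (simp add: frame_def)
      with f[OF that] show ?thesis by simp
    qed
    moreover have "ip n (gs_vec n (?u x) j) (gs_vec n (?u x) j) \<noteq> 0" if "\<not> j < m" "j < m + L" for j
    proof -
      have "j - m \<in> {..<L}" "m + (j - m) = j" using that by auto
      moreover from this elim have "ip n (gs_vec n (?u x) (m + (j - m))) (gs_vec n (?u x) (m + (j - m))) \<noteq> 0"
        by blast
      ultimately show ?thesis by simp
    qed
    ultimately show ?case by blast
  qed
qed

section \<open>Reflections of all columns at once, and vectors equivariant under them\<close>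

definition act :: "nat \<Rightarrow> nat \<Rightarrow> (nat \<Rightarrow> real) \<Rightarrow> (nat \<times> nat \<Rightarrow> real) \<Rightarrow> nat \<times> nat \<Rightarrow> real" where
  "act n K v x = (\<lambda>(i, k)\<in>grid n K. reflect n v (col n x k) i)"

text \<open>Columns are reflected one at a time, \<open>P m\<close> having treated the first
  \<open>m\<close>. Reflecting column \<open>m\<close> is a reflection of the whole array in the
  vector \<open>w\<close> that carries \<open>v\<close> on that column and 0 elsewhere.\<close>

lemma preserves_act: "preserves (gaussian (grid n K)) (act n K v)"
proof -
  define P where "P m x = (\<lambda>(i, k)\<in>grid n K. if k < m then reflect n v (col n x k) i else x (i, k))"
    for m x
  have "preserves (gaussian (grid n K)) (P m)" if "m \<le> K" for m
    using that
  proof (induction m)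
    case 0
    show ?case
      by (rule preserves_cong[OF preserves_ident])
         (auto simp: P_def space_PiM PiE_iff extensional_def fun_eq_iff)
  next
    case (Suc m)
    define w where "w = (\<lambda>(i, k). if k = m then v i else 0)"
    have col_P: "col n (P m x) m = col n x m" for x
      using Suc.prems by (auto simp: col_def P_def fun_eq_iff)
    have s: "(\<Sum>l\<in>grid n K. w l * x l) = (\<Sum>i<n. v i * x (i, m))" for x
    proof -
      have "(\<Sum>l\<in>grid n K. w l * x l) = (\<Sum>i<n. \<Sum>k<K. w (i, k) * x (i, k))"
        by (simp add: sum.cartesian_product)
      also have "\<dots> = (\<Sum>i<n. v i * x (i, m))"
        using Suc.prems by (intro sum.cong refl) (simp add: w_def if_distrib[of "\<lambda>t. t * _"] cong: if_cong)
      finally show ?thesis .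
    qed
    have ww: "(\<Sum>l\<in>grid n K. w l * w l) = ip n v v" unfolding s by (simp add: ip_def w_def)
    have wP: "(\<Sum>l\<in>grid n K. w l * P m x l) = ip n v (col n x m)" for x
      unfolding s ip_def using Suc.prems by (intro sum.cong) (auto simp: P_def col_def)
    have "reflect_on (grid n K) w (P m x) = P (Suc m) x" for x
    proof
      fix l :: "nat \<times> nat"
      obtain i k where l: "l = (i, k)" by (cases l)
      show "reflect_on (grid n K) w (P m x) l = P (Suc m) x l"
      proof (cases "l \<in> grid n K")
        case True
        consider "k < m" | "k = m" | "k > m" by linarith
        then show ?thesis
          unfolding reflect_on_def ww wP using True
          by cases (auto simp: l P_def w_def reflect_def col_def)
      qed (simp only: reflect_on_def P_def restrict_apply if_False)
    qed
    with preserves_comp[OF preserves_gaussian_reflect_on Suc.IH, of w] Suc.prems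
    show ?case by (simp add: finite_cartesian_product)
  qed
  from this[of K] show ?thesis
    by (rule preserves_cong) (auto simp: P_def act_def fun_eq_iff)
qed

text \<open>The hyperplane orthogonal to the all-ones vector, as functions vanishing from
  \<open>n\<close> on. Reflections in such vectors fix \<open>ones n\<close>.\<close>

definition centered :: "nat \<Rightarrow> (nat \<Rightarrow> real) \<Rightarrow> bool" where
  "centered n v \<longleftrightarrow> ip n v (ones n) = 0 \<and> (\<forall>i\<ge>n. v i = 0)"

lemma col_act:
  assumes "centered n v" "k < K"
  shows "col n (act n K v x) k = reflect n v (col n x k)"
  using assms by (auto simp: act_def col_def reflect_def centered_def fun_eq_iff)

text \<open>All that the cap argument uses of a random direction. Pointwise commutation is easy to
  check for an explicit formula, and it makes the law of \<open>F\<close> invariant, because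
  \<open>act\<close> preserves the Gaussian measure.\<close>

definition equivariant :: "nat \<Rightarrow> nat \<Rightarrow> ((nat \<times> nat \<Rightarrow> real) \<Rightarrow> nat \<Rightarrow> real) \<Rightarrow> bool" where
  "equivariant n K F \<longleftrightarrow>
     (\<forall>i. (\<lambda>x. F x i) \<in> borel_measurable (gaussian (grid n K))) \<and>
     (\<forall>x. centered n (F x)) \<and>
     (\<forall>v x. centered n v \<longrightarrow> F (act n K v x) = reflect n v (F x)) \<and>
     (AE x in gaussian (grid n K). ip n (F x) (F x) \<noteq> 0)"

definition normal_vec :: "nat \<Rightarrow> nat \<Rightarrow> (nat \<times> nat \<Rightarrow> real) \<Rightarrow> nat \<Rightarrow> real" where
  "normal_vec n K x = gs_vec n (frame n 1 (\<lambda>_. ones n) x) K"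

lemma frame_outside: "n \<le> i \<Longrightarrow> frame n 1 (\<lambda>_. ones n) x j i = 0"
  by (simp add: frame_def ones_def col_def)

text \<open>A reflection in a centered \<open>v\<close> fixes \<open>ones n\<close> and acts on the
  columns, hence reflects the entire frame, and the residual follows. With \<open>K < n\<close> the
  frame has at most \<open>n\<close> vectors, so its Gram-Schmidt vectors are almost surely
  nonzero.\<close>

lemma equivariant_normal_vec:
  assumes "1 \<le> K" "K < n"
  shows "equivariant n K (normal_vec n K)"
  unfolding equivariant_def
proof (intro conjI allI impI)
  let ?u = "frame n 1 (\<lambda>_. ones n)"
  show "(\<lambda>x. normal_vec n K x i) \<in> borel_measurable (gaussian (grid n K))" for i
    unfolding normal_vec_def by (intro gs_residual_measurable frame_measurable) auto
  show "centered n (normal_vec n K x)" for x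
    unfolding centered_def normal_vec_def
  proof (intro conjI allI impI)
    show "ip n (gs_vec n (?u x) K) (ones n) = 0"
      using ip_gs_residual_vec[of 0 K n "?u x" "?u x K"] assms by (simp add: frame_def)
    show "gs_vec n (?u x) K i = 0" if "n \<le> i" for i
      by (rule gs_residual_outside) (rule frame_outside[OF that])+
  qed
  have ones: "ip n (ones n) (ones n) \<noteq> 0" using assms by (simp add: ip_ones_ones)
  have "AE x in gaussian (grid n K). \<forall>j<1 + K. ip n (gs_vec n (?u x) j) (gs_vec n (?u x) j) \<noteq> 0"
    by (rule AE_gs_vec_frame) (use assms ones in auto)
  then show "AE x in gaussian (grid n K). ip n (normal_vec n K x) (normal_vec n K x) \<noteq> 0"
    by eventually_elim (simp add: normal_vec_def)
  fix v x assume v: "centered n v"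
  have u: "?u (act n K v x) j = reflect n v (?u x j)" if "j \<le> K" for j
  proof (cases "j = 0")
    case True
    have "reflect n v (ones n) = ones n"
      by (rule reflect_fixed) (use v in \<open>simp add: centered_def\<close>)
    then show ?thesis using True by (simp add: frame_def)
  next
    case False
    with that v show ?thesis by (simp add: frame_def col_act)
  qed
  show "normal_vec n K (act n K v x) = reflect n v (normal_vec n K x)"
    unfolding normal_vec_def gs_residual_reflect[symmetric] u[OF order.refl]
    by (rule gs_residual_cong, rule u) simp
qed

lemma ip_uminus: "ip n (- x) z = - ip n x z" "ip n z (- x) = - ip n z x"
  by (simp_all add: ip_def sum_negf)

text \<open>The negative entries form the other Radon part, which thereby has the same law as the
  positive ones.\<close>

lemma equivariant_uminus:
  assumes "equivariant n K F"
  shows "equivariant n K (\<lambda>x. - F x)"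
proof -
  have "reflect n v (- y) = - reflect n v y" for v y
    by (simp add: reflect_def ip_uminus fun_eq_iff)
  with assms show ?thesis
    unfolding equivariant_def centered_def ip_uminus by simp
qed

text \<open>
  The vectors \<open>ones n\<close>, \<open>axis_fun i\<close> and the first \<open>n - 2\<close> columns are independent, so no nonzero vector is
  orthogonal to all of them.
\<close>

lemma normal_vec_nonzero:
  assumes n: "2 \<le> n"
  shows "AE x in gaussian (grid n (n - 1)). \<forall>i<n. normal_vec n (n - 1) x i \<noteq> 0"
proof -
  let ?G = "gaussian (grid n (n - 1))" and ?u = "frame n 1 (\<lambda>_. ones n)"
  have "AE x in ?G. \<forall>i\<in>{..<n}. normal_vec n (n - 1) x i \<noteq> 0"
  proof (rule AE_finite_allI)
    fix i assume "i \<in> {..<n}"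
    then have i: "i < n" by simp
    define f where "f j = (if j = 0 then ones n else axis_fun i)" for j :: nat
    have "ip n (gs_vec n f j) (gs_vec n f j) \<noteq> 0" if "j < 2" for j
    proof (cases "j = 0")
      case True
      then show ?thesis using n by (simp add: f_def ip_ones_ones)
    next
      case False
      with that have "j = 1" by simp
      \<comment> \<open>Away from \<open>i\<close>, the residual of \<open>axis_fun i\<close> after
        \<open>ones n\<close> has the entries \<open>- 1 / n\<close>.\<close>
      obtain l where l: "l < n" "l \<noteq> i"
        using n by (cases "i = 0") (auto intro: that[of 1] that[of 0])
      have "gs_vec n f 1 l \<noteq> 0"
        using l i n by (simp add: f_def ip_ones ip_axis_fun)
          (simp add: ones_def axis_fun_def)
      with l \<open>j = 1\<close> show ?thesis by (auto simp: ip_self_eq_0_iff)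
    qed
    then have "AE x in ?G. \<forall>j<2 + (n - 2). ip n (gs_vec n (frame n 2 f x) j) (gs_vec n (frame n 2 f x) j) \<noteq> 0"
      by (rule AE_gs_vec_frame) (use n in auto)
    moreover have "AE x in ?G. ip n (normal_vec n (n - 1) x) (normal_vec n (n - 1) x) \<noteq> 0"
    proof -
      have "equivariant n (n - 1) (normal_vec n (n - 1))"
        by (rule equivariant_normal_vec) (use n in auto)
      then show ?thesis unfolding equivariant_def by blast
    qed
    ultimately show "AE x in ?G. normal_vec n (n - 1) x i \<noteq> 0"
    proof eventually_elim
      case (elim x)
      let ?t = "normal_vec n (n - 1) x"
      show "?t i \<noteq> 0"
      proof
        assume ti: "?t i = 0"
        have orth: "ip n ?t (?u x j) = 0" if "j < n - 1" for j
          unfolding normal_vec_def by (rule ip_gs_residual_vec[OF that])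
        have "ip n ?t (frame n 2 f x j) = 0" if "j < n" for j
        proof -
          consider "j = 0" | "j = 1" | "j \<ge> 2" by linarith
          then show ?thesis
          proof cases
            case 1
            then show ?thesis using orth[of 0] n by (simp add: frame_def f_def)
          next
            case 2
            then show ?thesis using ti i by (simp add: frame_def f_def ip_axis_fun)
          next
            case 3
            \<comment> \<open>The axis vector pushes the columns back by one place, so index
              \<open>j < n\<close> refers to a column before the last one, to which the residual is
              orthogonal.\<close>
            then have "frame n 2 f x j = ?u x (j - 1)" by (simp add: frame_def numeral_2_eq_2)
            then show ?thesis using orth[of "j - 1"] that 3 by simp
          qed
        qed
        then have "gs_residual n (frame n 2 f x) n ?t = ?t" by (rule gs_residual_fixed)
        moreover have "gs_residual n (frame n 2 f x) n ?t l = 0" if "l < n" for l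
          by (rule gs_residual_full) (use elim(1) n that in auto)
        ultimately show False using elim(2) by (simp add: ip_self_eq_0_iff)
      qed
    qed
  qed simp
  then show ?thesis by eventually_elim simp
qed

subsection \<open>Spherical caps\<close>

text \<open>The cosine of the angle exceeds \<open>1 - \<epsilon>\<close>. In the multiplied form no
  normalization is involved, and strictness excludes null vectors.\<close>

definition cap :: "nat \<Rightarrow> real \<Rightarrow> (nat \<Rightarrow> real) \<Rightarrow> (nat \<Rightarrow> real) \<Rightarrow> bool" where
  "cap n \<epsilon> x y \<longleftrightarrow> (1 - \<epsilon>) * (sqrt (ip n x x) * sqrt (ip n y y)) < ip n x y"

definition unit_vec :: "nat \<Rightarrow> (nat \<Rightarrow> real) \<Rightarrow> nat \<Rightarrow> real" where
  "unit_vec n x = (1 / sqrt (ip n x x)) *\<^sub>R x"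

lemma cap_commute: "cap n \<epsilon> x y \<longleftrightarrow> cap n \<epsilon> y x"
  by (simp add: cap_def ip_commute mult.commute)

lemma cap_scale:
  assumes "0 < c" shows "cap n \<epsilon> x (c *\<^sub>R y) \<longleftrightarrow> cap n \<epsilon> x y"
proof -
  have "sqrt (ip n (c *\<^sub>R y) (c *\<^sub>R y)) = c * sqrt (ip n y y)"
    using assms by (simp add: ip_simps real_sqrt_mult flip: mult.assoc)
  moreover have "(1 - \<epsilon>) * (a * (c * b)) = c * ((1 - \<epsilon>) * (a * b))" for a b
    by simp
  ultimately show ?thesis using assms by (simp add: cap_def ip_simps)
qed

text \<open>The squared distance of two unit vectors is 2 minus twice their inner product, whence
  \<open>2 * \<epsilon>\<close>.\<close>

lemma cap_iff_dist:
  assumes "ip n x x \<noteq> 0" "ip n y y \<noteq> 0"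
  shows "cap n \<epsilon> x y \<longleftrightarrow>
    ip n (unit_vec n x - unit_vec n y) (unit_vec n x - unit_vec n y) < 2 * \<epsilon>"
proof -
  let ?a = "sqrt (ip n x x)" and ?b = "sqrt (ip n y y)"
  have pos: "0 < ?a" "0 < ?b" using assms ip_self_nonneg[of n x] ip_self_nonneg[of n y] by (simp_all add: less_le)
  have self: "ip n (unit_vec n z) (unit_vec n z) = 1" if "ip n z z \<noteq> 0" for z
    using that ip_self_nonneg[of n z] by (simp add: unit_vec_def ip_simps real_sqrt_mult[symmetric])
  have "ip n (unit_vec n x) (unit_vec n y) = ip n x y / (?a * ?b)"
    by (simp add: unit_vec_def ip_simps)
  then have "ip n (unit_vec n x - unit_vec n y) (unit_vec n x - unit_vec n y) = 2 - 2 * (ip n x y / (?a * ?b))"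
    using self[OF assms(1)] self[OF assms(2)] by (simp add: ip_simps ip_commute[of n "unit_vec n y" "unit_vec n x"])
  moreover have "cap n \<epsilon> x y \<longleftrightarrow> 1 - \<epsilon> < ip n x y / (?a * ?b)"
    using pos by (simp add: cap_def pos_less_divide_eq)
  ultimately show ?thesis by auto
qed

definition positives :: "nat \<Rightarrow> (nat \<Rightarrow> real) \<Rightarrow> nat set" where
  "positives n x = {i\<in>{..<n}. 0 < x i}"

text \<open>An entry of the unit vector of \<open>y\<close> that is zero or of the wrong sign would
  lie at distance at least \<open>\<bar>unit_vec n x i\<bar>\<close> from that of \<open>x\<close>,
  more than the cap allows.\<close>

lemma cap_imp_positives_eq:
  assumes nz: "ip n x x \<noteq> 0" "ip n y y \<noteq> 0" and cap: "cap n \<epsilon> x y"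
    and \<epsilon>: "\<And>i. i < n \<Longrightarrow> 2 * \<epsilon> \<le> (unit_vec n x i)\<^sup>2"
  shows "positives n y = positives n x"
proof -
  have "0 < y i \<longleftrightarrow> 0 < x i" if i: "i < n" for i
  proof -
    let ?p = "unit_vec n x i" and ?q = "unit_vec n y i"
    have sgn: "0 < unit_vec n z i \<longleftrightarrow> 0 < z i" "unit_vec n z i < 0 \<longleftrightarrow> z i < 0" if "ip n z z \<noteq> 0" for z
    proof -
      have "0 < ip n z z" using that by (simp add: less_le)
      then show "0 < unit_vec n z i \<longleftrightarrow> 0 < z i" "unit_vec n z i < 0 \<longleftrightarrow> z i < 0"
        by (simp_all add: unit_vec_def zero_less_divide_iff divide_less_0_iff)
    qed
    have "(?p - ?q)\<^sup>2 \<le> ip n (unit_vec n x - unit_vec n y) (unit_vec n x - unit_vec n y)"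
      unfolding ip_def power2_eq_square
      using member_le_sum[of i "{..<n}" "\<lambda>i. (unit_vec n x - unit_vec n y) i * (unit_vec n x - unit_vec n y) i"] i
      by simp
    also have "\<dots> < 2 * \<epsilon>" using cap cap_iff_dist[OF nz] by simp
    also have "\<dots> \<le> ?p\<^sup>2" by (rule \<epsilon>[OF i])
    finally have "(?p - ?q)\<^sup>2 < ?p\<^sup>2" .
    then have "?q * ?q < 2 * (?p * ?q)" by (simp add: power2_eq_square algebra_simps)
    then have "0 < ?p * ?q" using zero_le_square[of ?q] by linarith
    then show ?thesis using sgn[OF nz(1)] sgn[OF nz(2)] by (auto simp: zero_less_mult_iff)
  qed
  then show ?thesis by (auto simp: positives_def)
qed

lemma cap_measurable:
  assumes "\<And>i. (\<lambda>x. f x i) \<in> borel_measurable M" "\<And>i. (\<lambda>x. g x i) \<in> borel_measurable M"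
  shows "Measurable.pred M (\<lambda>x. cap n \<epsilon> (f x) (g x))"
proof -
  note [measurable] = ip_measurable[OF assms] ip_measurable[OF assms(1,1)] ip_measurable[OF assms(2,2)]
  show ?thesis unfolding cap_def by measurable
qed

lemma positives_measurable:
  fixes Q :: "nat set \<Rightarrow> bool"
  assumes [measurable]: "\<And>i. (\<lambda>x. f x i) \<in> borel_measurable M"
  shows "Measurable.pred M (\<lambda>x. Q (positives n (f x)))"
proof -
  have "Q (positives n (f x)) \<longleftrightarrow> (\<exists>A\<in>Pow {..<n}. Q A \<and> (\<forall>i\<in>{..<n}. i \<in> A \<longleftrightarrow> 0 < f x i))" for x
  proof
    assume "Q (positives n (f x))"
    then show "\<exists>A\<in>Pow {..<n}. Q A \<and> (\<forall>i\<in>{..<n}. i \<in> A \<longleftrightarrow> 0 < f x i)"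
      by (intro bexI[of _ "positives n (f x)"]) (auto simp: positives_def)
  next
    assume "\<exists>A\<in>Pow {..<n}. Q A \<and> (\<forall>i\<in>{..<n}. i \<in> A \<longleftrightarrow> 0 < f x i)"
    then obtain A where "A \<subseteq> {..<n}" "Q A" "\<forall>i\<in>{..<n}. i \<in> A \<longleftrightarrow> 0 < f x i" by blast
    moreover from this have "A = positives n (f x)" by (auto simp: positives_def)
    ultimately show "Q (positives n (f x))" by simp
  qed
  then show ?thesis by simp measurable
qed

abbreviation cap_set :: "nat \<Rightarrow> nat \<Rightarrow> ((nat \<times> nat \<Rightarrow> real) \<Rightarrow> nat \<Rightarrow> real) \<Rightarrow> real \<Rightarrow> (nat \<Rightarrow> real) \<Rightarrow>
    (nat \<times> nat \<Rightarrow> real) set" where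
  "cap_set n K F \<epsilon> y \<equiv> {x\<in>space (gaussian (grid n K)). cap n \<epsilon> (F x) y}"

text \<open>Rescale \<open>z\<close> to the norm of \<open>y\<close>, which leaves the caps alone. A
  reflection in a centered vector then exchanges the two centers, and by equivariance the
  corresponding \<open>act\<close> carries one event to the other.\<close>

lemma cap_measure_eq:
  assumes F: "equivariant n K F"
    and y: "centered n y" "ip n y y \<noteq> 0" and z: "centered n z" "ip n z z \<noteq> 0"
  shows "measure (gaussian (grid n K)) (cap_set n K F \<epsilon> y) = measure (gaussian (grid n K)) (cap_set n K F \<epsilon> z)"
proof -
  let ?G = "gaussian (grid n K)"
  have [measurable]: "(\<lambda>x. F x i) \<in> borel_measurable ?G" for i using F by (simp add: equivariant_def)
  define c where "c = sqrt (ip n y y / ip n z z)"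
  have pos: "ip n y y > 0" "ip n z z > 0" using y z by (simp_all add: less_le)
  have c: "c > 0" "c * c = ip n y y / ip n z z" using pos by (simp_all add: c_def)
  define z' where "z' = c *\<^sub>R z"
  have z': "centered n z'" "ip n z' z' = ip n y y"
    using z c by (simp_all add: z'_def centered_def ip_simps flip: mult.assoc)
  define v where "v = y - z'"
  have v: "centered n v" using y z' by (simp add: v_def centered_def ip_simps)
  have vy: "reflect n v y = z'"
    unfolding v_def by (rule reflect_diff) (use y z' in \<open>auto simp: centered_def\<close>)
  have P: "act n K v \<in> measurable ?G ?G" "distr ?G ?G (act n K v) = ?G"
    using preserves_act by (auto simp: preserves_def)
  have [measurable]: "Measurable.pred ?G (\<lambda>x. cap n \<epsilon> (F x) y)" by (rule cap_measurable) auto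
  have m: "cap_set n K F \<epsilon> y \<in> sets ?G" by measurable
  have "cap n \<epsilon> (F (act n K v x)) y \<longleftrightarrow> cap n \<epsilon> (F x) z" for x
  proof -
    have "cap n \<epsilon> (F (act n K v x)) y \<longleftrightarrow> cap n \<epsilon> (reflect n v (F x)) (reflect n v z')"
      using F v vy reflect_reflect[of n v y] by (simp add: equivariant_def)
    also have "\<dots> \<longleftrightarrow> cap n \<epsilon> (F x) z'" by (simp add: cap_def ip_reflect)
    finally show ?thesis using cap_scale[OF c(1)] by (simp add: z'_def)
  qed
  then have "act n K v -` cap_set n K F \<epsilon> y \<inter> space ?G = cap_set n K F \<epsilon> z"
    using measurable_space[OF P(1)] by auto
  then show ?thesis using measure_distr[OF P(1) m] P(2) by simp
qed

text \<open>
  The sphere is covered by countably many cells of diameter less than that of a cap, one of which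
  has positive probability.
\<close>

lemma cap_measure_pos:
  assumes F: "equivariant n K F" and \<epsilon>: "\<epsilon> > 0" and y: "centered n y" "ip n y y \<noteq> 0"
  shows "0 < measure (gaussian (grid n K)) (cap_set n K F \<epsilon> y)"
proof -
  let ?G = "gaussian (grid n K)"
  interpret prob_space ?G by (rule prob_space_gaussian)
  have Fm[measurable]: "(\<lambda>x. F x i) \<in> borel_measurable ?G" for i using F by (simp add: equivariant_def)
  note [measurable] = ip_measurable[OF Fm Fm]
  \<comment> \<open>Unit vectors in one cell differ by at most \<open>1 / N\<close> in each entry,
    so their squared distance is at most
    \<open>n / N\<^sup>2 \<le> n / N < 2 * \<epsilon>\<close>.\<close>
  obtain N :: nat where N: "real n / (2 * \<epsilon>) < real N" using reals_Archimedean2 by blast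
  have "N > 0"
  proof -
    have "0 \<le> real n / (2 * \<epsilon>)" using \<epsilon> by simp
    with N show ?thesis by linarith
  qed
  define cell where "cell z = {x\<in>space ?G. ip n (F x) (F x) \<noteq> 0 \<and>
      (\<forall>i\<in>{..<n}. \<lfloor>real N * unit_vec n (F x) i\<rfloor> = z i)}" for z :: "nat \<Rightarrow> int"
  let ?Z = "PiE {..<n} (\<lambda>_. UNIV :: int set)"
  have um[measurable]: "(\<lambda>x. unit_vec n (F x) i) \<in> borel_measurable ?G" for i
    unfolding unit_vec_def by simp
  have cell_sets: "cell z \<in> sets ?G" for z unfolding cell_def by measurable
  have "\<exists>z\<in>?Z. cell z \<notin> null_sets ?G"
  proof (rule ccontr)
    assume "\<not> ?thesis"
    then have "(\<Union>z\<in>?Z. cell z) \<in> null_sets ?G"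
      by (intro null_sets_UN') (auto intro: countable_PiE)
    then have "AE x in ?G. x \<notin> (\<Union>z\<in>?Z. cell z)" by (rule AE_not_in)
    moreover have "AE x in ?G. ip n (F x) (F x) \<noteq> 0" using F by (simp add: equivariant_def)
    moreover have "AE x in ?G. x \<in> space ?G" by simp
    ultimately have "AE x in ?G. False"
    proof eventually_elim
      case (elim x)
      have "x \<in> cell (\<lambda>i\<in>{..<n}. \<lfloor>real N * unit_vec n (F x) i\<rfloor>)"
        unfolding cell_def using elim by simp
      moreover have "(\<lambda>i\<in>{..<n}. \<lfloor>real N * unit_vec n (F x) i\<rfloor>) \<in> ?Z" by simp
      ultimately show False using elim(1) by blast
    qed
    then show False by simp
  qed
  then obtain z where "cell z \<notin> null_sets ?G" by blast
  then have pos: "measure ?G (cell z) > 0"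
    using cell_sets[of z] by (auto simp: null_sets_def emeasure_eq_measure less_le)
  then have "cell z \<noteq> {}" by auto
  then obtain x0 where x0: "x0 \<in> cell z" by blast
  have [measurable]: "Measurable.pred ?G (\<lambda>x. cap n \<epsilon> (F x) (F x0))"
    by (rule cap_measurable) auto
  have "cell z \<subseteq> cap_set n K F \<epsilon> (F x0)"
  proof
    fix x assume x: "x \<in> cell z"
    let ?d = "unit_vec n (F x) - unit_vec n (F x0)"
    have "?d i * ?d i \<le> 1 / real N * (1 / real N)" if i: "i < n" for i
    proof -
      have "\<lfloor>real N * unit_vec n (F x) i\<rfloor> = \<lfloor>real N * unit_vec n (F x0) i\<rfloor>"
        using x x0 i by (simp add: cell_def)
      then have "\<bar>real N * unit_vec n (F x) i - real N * unit_vec n (F x0) i\<bar> < 1" by linarith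
      moreover have "real N * \<bar>?d i\<bar> = \<bar>real N * unit_vec n (F x) i - real N * unit_vec n (F x0) i\<bar>"
        by (simp add: abs_mult flip: right_diff_distrib)
      ultimately have "\<bar>?d i\<bar> \<le> 1 / real N"
        using \<open>N > 0\<close> by (simp only: pos_le_divide_eq of_nat_0_less_iff) (simp add: mult.commute)
      then have "\<bar>?d i\<bar> * \<bar>?d i\<bar> \<le> 1 / real N * (1 / real N)" by (intro mult_mono) auto
      then show ?thesis by simp
    qed
    then have "ip n ?d ?d \<le> (\<Sum>i<n. 1 / real N * (1 / real N))"
      unfolding ip_def by (intro sum_mono) auto
    also have "\<dots> = real n / real N * (1 / real N)" by simp
    also have "\<dots> \<le> real n / real N * 1" using \<open>N > 0\<close> by (intro mult_left_mono) auto
    also have "\<dots> < 2 * \<epsilon>" using N \<epsilon> \<open>N > 0\<close> by (simp add: field_simps)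
    finally show "x \<in> cap_set n K F \<epsilon> (F x0)"
      using x x0 by (simp add: cell_def cap_iff_dist)
  qed
  then have "measure ?G (cell z) \<le> measure ?G (cap_set n K F \<epsilon> (F x0))"
    by (rule finite_measure_mono) measurable
  also have "\<dots> = measure ?G (cap_set n K F \<epsilon> y)"
    \<comment> \<open>The cap found is centered at a point of the cell; its mass does not depend on
      the center.\<close>
    by (rule cap_measure_eq[OF F]) (use F x0 y in \<open>auto simp: equivariant_def cell_def\<close>)
  finally show ?thesis using pos by simp
qed

lemma cap_nonzero: "cap n \<epsilon> x y \<Longrightarrow> ip n x x \<noteq> 0 \<and> ip n y y \<noteq> 0"
  using ip_eq_0_of_self[of n x y] ip_eq_0_of_self[of n y x] by (auto simp: cap_def)

text \<open>For independent \<open>x\<close> and \<open>x'\<close>, consider the event that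
  \<open>Q\<close> holds for \<open>F x\<close> and that \<open>F x\<close> and \<open>G x'\<close>
  lie in a common cap. Integrating over \<open>x'\<close> first gives the probability of
  \<open>Q\<close> times the cap mass. Integrating over \<open>x\<close> first and dividing by the
  cap mass averages the proportion of \<open>Q\<close> in a cap around \<open>G x'\<close>, which
  tends to the indicator of \<open>Q\<close> at \<open>G x'\<close> as the caps shrink.\<close>

lemma positives_distribution_eq:
  assumes F: "equivariant n K F" and G: "equivariant n L G"
    and nz: "AE x in gaussian (grid n L). \<forall>i<n. G x i \<noteq> 0"
  shows "measure (gaussian (grid n K)) {x\<in>space (gaussian (grid n K)). Q (positives n (F x))} =
    measure (gaussian (grid n L)) {x\<in>space (gaussian (grid n L)). Q (positives n (G x))}"
proof -
  let ?P = "gaussian (grid n K)" and ?R = "gaussian (grid n L)"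
  interpret P: prob_space ?P by (rule prob_space_gaussian)
  interpret R: prob_space ?R by (rule prob_space_gaussian)
  interpret PR: pair_prob_space ?P ?R ..
  have [measurable]: "(\<lambda>x. F x i) \<in> borel_measurable ?P" "(\<lambda>x. G x i) \<in> borel_measurable ?R" for i
    using F G by (simp_all add: equivariant_def)
  have cen: "centered n (F x)" "centered n (G x')" for x x'
    using F G by (simp_all add: equivariant_def)
  have F_nz: "AE x in ?P. ip n (F x) (F x) \<noteq> 0" and G_nz: "AE x in ?R. ip n (G x) (G x) \<noteq> 0"
    using F G by (simp_all add: equivariant_def)
  obtain y where y: "centered n y" "ip n y y \<noteq> 0"
  proof -
    have "\<exists>x. ip n (F x) (F x) \<noteq> 0"
    proof (rule ccontr)
      assume "\<nexists>x. ip n (F x) (F x) \<noteq> 0"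
      with F_nz have "AE x in ?P. False" by simp
      then show False by simp
    qed
    then show thesis using cen(1) that by blast
  qed
  define cP where "cP \<epsilon> = P.prob (cap_set n K F \<epsilon> y)" for \<epsilon>
  define cR where "cR \<epsilon> = R.prob (cap_set n L G \<epsilon> y)" for \<epsilon>
  have cP: "P.prob (cap_set n K F \<epsilon> z) = cP \<epsilon>" if "centered n z" "ip n z z \<noteq> 0" for \<epsilon> z
    unfolding cP_def by (rule cap_measure_eq[OF F that y])
  have cR: "R.prob (cap_set n L G \<epsilon> z) = cR \<epsilon>" if "centered n z" "ip n z z \<noteq> 0" for \<epsilon> z
    unfolding cR_def by (rule cap_measure_eq[OF G that y])
  define f where "f Q' \<epsilon> x x' = (if Q' (positives n (F x)) \<and> cap n \<epsilon> (F x) (G x') then 1 else 0 :: real)"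
    for Q' \<epsilon> x x'
  define h where "h Q' \<epsilon> x' = (\<integral>x. f Q' \<epsilon> x x' \<partial>?P)" for Q' \<epsilon> x'
  have f_meas[measurable]: "case_prod (f Q' \<epsilon>) \<in> borel_measurable (?P \<Otimes>\<^sub>M ?R)"
    and f_meas'[measurable]: "(\<lambda>(x', x). f Q' \<epsilon> x x') \<in> borel_measurable (?R \<Otimes>\<^sub>M ?P)" for Q' \<epsilon>
  proof -
    have [measurable]: "Measurable.pred (?P \<Otimes>\<^sub>M ?R) (\<lambda>z. Q' (positives n (F (fst z))))"
      "Measurable.pred (?R \<Otimes>\<^sub>M ?P) (\<lambda>z. Q' (positives n (F (snd z))))"
      by (rule positives_measurable; measurable)+
    have [measurable]: "Measurable.pred (?P \<Otimes>\<^sub>M ?R) (\<lambda>z. cap n \<epsilon> (F (fst z)) (G (snd z)))"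
      "Measurable.pred (?R \<Otimes>\<^sub>M ?P) (\<lambda>z. cap n \<epsilon> (F (snd z)) (G (fst z)))"
      by (rule cap_measurable; measurable)+
    show "case_prod (f Q' \<epsilon>) \<in> borel_measurable (?P \<Otimes>\<^sub>M ?R)"
      "(\<lambda>(x', x). f Q' \<epsilon> x x') \<in> borel_measurable (?R \<Otimes>\<^sub>M ?P)"
      unfolding f_def split_beta' by measurable
  qed
  have Q_meas: "{x\<in>space ?P. Q' (positives n (F x))} \<in> sets ?P" for Q'
    using positives_measurable[of F ?P Q'] by simp
  have h_meas[measurable]: "h Q' \<epsilon> \<in> borel_measurable ?R" for Q' \<epsilon>
    unfolding h_def by (rule P.borel_measurable_lebesgue_integral) (rule f_meas')
  have h_eq: "h Q' \<epsilon> x' = P.prob {x\<in>space ?P. Q' (positives n (F x)) \<and> cap n \<epsilon> (F x) (G x')}" for Q' \<epsilon> x'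
  proof -
    have "h Q' \<epsilon> x' = (\<integral>x. indicator {x\<in>space ?P. Q' (positives n (F x)) \<and> cap n \<epsilon> (F x) (G x')} x \<partial>?P)"
      unfolding h_def by (intro Bochner_Integration.integral_cong) (auto simp: f_def indicator_def)
    also have "\<dots> = P.prob ({x\<in>space ?P. Q' (positives n (F x)) \<and> cap n \<epsilon> (F x) (G x')} \<inter> space ?P)"
      by simp
    also have "\<dots> = P.prob {x\<in>space ?P. Q' (positives n (F x)) \<and> cap n \<epsilon> (F x) (G x')}"
      by (rule arg_cong[where f=P.prob]) auto
    finally show ?thesis .
  qed
  have fubini: "(\<integral>x'. h Q' \<epsilon> x' \<partial>?R) = P.prob {x\<in>space ?P. Q' (positives n (F x))} * cR \<epsilon>" for Q' \<epsilon>
  proof -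
    have "(\<integral>x'. h Q' \<epsilon> x' \<partial>?R) = (\<integral>x. (\<integral>x'. f Q' \<epsilon> x x' \<partial>?R) \<partial>?P)"
      unfolding h_def
      by (rule PR.Fubini_integral, rule PR.integrable_const_bound[where B=1])
         (simp_all add: f_meas, simp add: f_def split_beta)
    also have "\<dots> = (\<integral>x. indicator {x\<in>space ?P. Q' (positives n (F x))} x * cR \<epsilon> \<partial>?P)"
    proof (rule integral_cong_AE)
      show "(\<lambda>x. \<integral>x'. f Q' \<epsilon> x x' \<partial>?R) \<in> borel_measurable ?P"
        by (rule R.borel_measurable_lebesgue_integral) (rule f_meas)
      have "AE x in ?P. x \<in> space ?P" by simp
      with F_nz show "AE x in ?P. (\<integral>x'. f Q' \<epsilon> x x' \<partial>?R) =
          indicator {x\<in>space ?P. Q' (positives n (F x))} x * cR \<epsilon>"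
      proof eventually_elim
        case (elim x)
        have "(\<integral>x'. f Q' \<epsilon> x x' \<partial>?R) =
            (\<integral>x'. indicator {x\<in>space ?P. Q' (positives n (F x))} x * indicator (cap_set n L G \<epsilon> (F x)) x' \<partial>?R)"
          using elim by (intro Bochner_Integration.integral_cong)
            (auto simp: f_def indicator_def cap_commute[of n \<epsilon> "F x"])
        also have "\<dots> = indicator {x\<in>space ?P. Q' (positives n (F x))} x *
            R.prob (cap_set n L G \<epsilon> (F x) \<inter> space ?R)"
          by simp
        also have "cap_set n L G \<epsilon> (F x) \<inter> space ?R = cap_set n L G \<epsilon> (F x)" by auto
        finally show ?case using cR[OF cen(1) elim(1)] by simp
      qed
    next
      show "(\<lambda>x. indicator {x\<in>space ?P. Q' (positives n (F x))} x * cR \<epsilon>) \<in> borel_measurable ?P"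
        by (intro borel_measurable_times borel_measurable_indicator Q_meas) simp
    qed
    also have "\<dots> = P.prob ({x\<in>space ?P. Q' (positives n (F x))} \<inter> space ?P) * cR \<epsilon>"
      by simp
    also have "{x\<in>space ?P. Q' (positives n (F x))} \<inter> space ?P = {x\<in>space ?P. Q' (positives n (F x))}"
      by auto
    finally show ?thesis .
  qed
  have measurable_sets_cap: "cap_set n K F \<epsilon> z \<in> sets ?P" for \<epsilon> z
    using cap_measurable[of F ?P "\<lambda>_. z" n \<epsilon>] by simp
  \<comment> \<open>The double integral for a \<open>Q\<close> that always holds, evaluated in both
    orders.\<close>
  have c_eq: "cP \<epsilon> = cR \<epsilon>" for \<epsilon>
  proof -
    have "cP \<epsilon> = (\<integral>x'. cP \<epsilon> \<partial>?R)" by (simp add: R.prob_space)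
    also have "\<dots> = (\<integral>x'. h (\<lambda>_. True) \<epsilon> x' \<partial>?R)"
    proof (rule integral_cong_AE)
      show "AE x' in ?R. cP \<epsilon> = h (\<lambda>_. True) \<epsilon> x'"
        using G_nz by eventually_elim (simp add: h_eq cP[OF cen(2)])
    qed measurable
    also have "\<dots> = cR \<epsilon>" unfolding fubini by (simp add: P.prob_space)
    finally show ?thesis .
  qed
  define e where "e j = 1 / (real j + 1)" for j :: nat
  have e_pos: "e j > 0" for j by (simp add: e_def)
  have e_lim: "e \<longlonglongrightarrow> 0" unfolding e_def by (rule LIMSEQ_Suc[OF lim_const_over_n[of 1], simplified add.commute[of 1] of_nat_Suc])
  have c_pos: "cP (e j) > 0" for j
    unfolding cP_def by (rule cap_measure_pos[OF F e_pos y])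
  \<comment> \<open>The conditional probability of \<open>Q\<close> given the cap around
    \<open>G x'\<close>.\<close>
  define s where "s j x' = h Q (e j) x' / cP (e j)" for j x'
  let ?B = "{x\<in>space ?R. Q (positives n (G x))}"
  have "(\<lambda>j. \<integral>x'. s j x' \<partial>?R) \<longlonglongrightarrow> (\<integral>x'. indicator ?B x' \<partial>?R)"
  proof (rule integral_dominated_convergence[where w="\<lambda>_. 1"])
    show "s j \<in> borel_measurable ?R" for j unfolding s_def by measurable
    show "AE x' in ?R. norm (s j x') \<le> 1" for j
      using G_nz
    proof eventually_elim
      case (elim x')
      have "h Q (e j) x' \<le> P.prob (cap_set n K F (e j) (G x'))"
        unfolding h_eq by (rule P.finite_measure_mono) (auto intro!: measurable_sets_cap)
      also have "\<dots> = cP (e j)" by (rule cP[OF cen(2) elim])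
      finally show ?case using c_pos[of j] by (simp add: s_def h_eq)
    qed
    have "AE x' in ?R. x' \<in> space ?R" by simp
    with G_nz nz show "AE x' in ?R. (\<lambda>j. s j x') \<longlonglongrightarrow> indicator ?B x'"
    proof eventually_elim
      case (elim x')
      let ?u = "unit_vec n (G x')"
      have "\<forall>\<^sub>F j in sequentially. 2 * e j \<le> (?u i)\<^sup>2" if "i < n" for i
      proof -
        have "?u i \<noteq> 0" using elim(1,2) that by (simp add: unit_vec_def)
        then have "(?u i)\<^sup>2 / 2 > 0" by simp
        from order_tendstoD(2)[OF e_lim this] show ?thesis by eventually_elim simp
      qed
      then have "\<forall>\<^sub>F j in sequentially. \<forall>i\<in>{..<n}. 2 * e j \<le> (?u i)\<^sup>2"
        by (intro eventually_ball_finite) auto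
      then have "\<forall>\<^sub>F j in sequentially. s j x' = indicator ?B x'"
      proof eventually_elim
        case (elim j)
        \<comment> \<open>No entry of \<open>G x'\<close> is zero, so a small enough cap stays
          inside one orthant and \<open>Q\<close> is constant on it.\<close>
        have pos_eq: "positives n (F x) = positives n (G x')" if "cap n (e j) (F x) (G x')" for x
        proof (rule cap_imp_positives_eq)
          show "cap n (e j) (G x') (F x)" using that by (simp add: cap_commute)
        qed (use cap_nonzero[OF that] elim in auto)
        have "{x\<in>space ?P. Q (positives n (F x)) \<and> cap n (e j) (F x) (G x')} =
            (if Q (positives n (G x')) then cap_set n K F (e j) (G x') else {})"
          using pos_eq by auto
        then show ?case
          using c_pos[of j] cP[OF cen(2) \<open>ip n (G x') (G x') \<noteq> 0\<close>, of "e j"] \<open>x' \<in> space ?R\<close>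
          by (simp add: s_def h_eq)
      qed
      then show ?case by (rule tendsto_eventually)
    qed
  next
    have "?B \<in> sets ?R" using positives_measurable[of G ?R Q] by simp
    then show "indicator ?B \<in> borel_measurable ?R" by simp
  qed auto
  moreover have "(\<integral>x'. s j x' \<partial>?R) = P.prob {x\<in>space ?P. Q (positives n (F x))}" for j
    unfolding s_def using c_pos[of j] fubini[of Q "e j"] c_eq[of "e j"] by simp
  moreover have "(\<integral>x'. indicator ?B x' \<partial>?R) = R.prob ?B"
    by (simp add: Int_absorb2)
  ultimately have "(\<lambda>_::nat. P.prob {x\<in>space ?P. Q (positives n (F x))}) \<longlonglongrightarrow> R.prob ?B"
    by simp
  then show ?thesis by (simp only: LIMSEQ_const_iff)
qed

subsection \<open>Radon partitions of Gaussian points\<close>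

definition above_mean :: "nat \<Rightarrow> (nat \<Rightarrow> real) \<Rightarrow> nat set" where
  "above_mean n \<omega> = {i\<in>{..<n}. \<omega> i > (\<Sum>j<n. \<omega> j) / real n}"

lemma above_mean_measurable: "{\<omega>\<in>space (gaussian UNIV). Q (above_mean n \<omega>)} \<in> sets (gaussian UNIV)"
proof -
  have "above_mean n \<omega> = positives n (\<lambda>i. \<omega> i - (\<Sum>j<n. \<omega> j) / real n)" for \<omega>
    by (simp add: above_mean_def positives_def)
  then show ?thesis
    using positives_measurable[of "\<lambda>\<omega> i. \<omega> i - (\<Sum>j<n. \<omega> j) / real n" "gaussian UNIV" Q n] by simp
qed

text \<open>With a single column, the residual after \<open>ones n\<close> is the column minus its
  mean, and the column has the law of the first \<open>n\<close> terms of the Gaussian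
  sequence.\<close>

lemma positives_normal_vec_1:
  assumes "0 < n"
  shows "measure (gaussian (grid n 1)) {x\<in>space (gaussian (grid n 1)). Q (positives n (normal_vec n 1 x))} =
    measure (gaussian UNIV) {\<omega>\<in>space (gaussian UNIV). Q (above_mean n \<omega>)}"
proof -
  let ?r = "\<lambda>\<omega>::nat \<Rightarrow> real. \<lambda>p\<in>grid n 1. \<omega> (fst p)"
  let ?A = "{x\<in>space (gaussian (grid n 1)). Q (positives n (normal_vec n 1 x))}"
  have r: "distr (gaussian UNIV) (gaussian (grid n 1)) ?r = gaussian (grid n 1)"
    by (rule distr_PiM_reindex) (auto simp: inj_on_def N.prob_space_axioms)
  have rm: "?r \<in> measurable (gaussian UNIV) (gaussian (grid n 1))"
    by (rule measurable_restrict) auto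
  have A: "?A \<in> sets (gaussian (grid n 1))"
  proof -
    have "(\<lambda>x. normal_vec n 1 x i) \<in> borel_measurable (gaussian (grid n 1))" for i
      unfolding normal_vec_def by (intro gs_residual_measurable frame_measurable) auto
    from positives_measurable[OF this, of Q n] show ?thesis by simp
  qed
  have "positives n (normal_vec n 1 (?r \<omega>)) = above_mean n \<omega>" for \<omega>
  proof -
    have "normal_vec n 1 x i = x (i, 0) - (\<Sum>j<n. x (j, 0)) / real n" if "i < n" for x i
      using that by (simp add: normal_vec_def frame_def ip_ones_ones ip_ones)
        (simp add: col_def ones_def)
    then show ?thesis by (auto simp: positives_def above_mean_def)
  qed
  then have "?r -` ?A \<inter> space (gaussian UNIV) = {\<omega>\<in>space (gaussian UNIV). Q (above_mean n \<omega>)}"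
    using measurable_space[OF rm] by auto
  then show ?thesis
    using measure_distr[OF rm A] unfolding r by simp
qed

lemma normal_vec_positives_law:
  assumes n: "3 \<le> n"
  shows "measure (gaussian (grid n (n - 1))) {x\<in>space (gaussian (grid n (n - 1))).
      Q (positives n (normal_vec n (n - 1) x))} =
    measure (gaussian UNIV) {\<omega>\<in>space (gaussian UNIV). Q (above_mean n \<omega>)}"
    and "measure (gaussian (grid n (n - 1))) {x\<in>space (gaussian (grid n (n - 1))).
      Q (positives n (- normal_vec n (n - 1) x))} =
    measure (gaussian UNIV) {\<omega>\<in>space (gaussian UNIV). Q (above_mean n \<omega>)}"
proof -
  have eq1: "equivariant n 1 (normal_vec n 1)" by (rule equivariant_normal_vec) (use n in auto)
  have eqn: "equivariant n (n - 1) (normal_vec n (n - 1))" by (rule equivariant_normal_vec) (use n in auto)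
  have nz: "AE x in gaussian (grid n (n - 1)). \<forall>i<n. normal_vec n (n - 1) x i \<noteq> 0"
    by (rule normal_vec_nonzero) (use n in auto)
  have nz': "AE x in gaussian (grid n (n - 1)). \<forall>i<n. (- normal_vec n (n - 1) x) i \<noteq> 0"
    using nz by simp
  have "0 < n" using n by simp
  note * = positives_normal_vec_1[OF this]
  show "measure (gaussian (grid n (n - 1))) {x\<in>space (gaussian (grid n (n - 1))).
      Q (positives n (normal_vec n (n - 1) x))} =
    measure (gaussian UNIV) {\<omega>\<in>space (gaussian UNIV). Q (above_mean n \<omega>)}"
    by (rule trans[OF positives_distribution_eq[OF eq1 eqn nz, symmetric] *])
  show "measure (gaussian (grid n (n - 1))) {x\<in>space (gaussian (grid n (n - 1))).
      Q (positives n (- normal_vec n (n - 1) x))} =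
    measure (gaussian UNIV) {\<omega>\<in>space (gaussian UNIV). Q (above_mean n \<omega>)}"
    by (rule trans[OF positives_distribution_eq[OF eq1 equivariant_uminus[OF eqn] nz', symmetric] *])
qed

section \<open>The points of the theorem for one fixed \<open>n\<close>\<close>

locale gaussian_points = prob_space M for M :: "'a measure" +
  fixes n :: nat and X :: "nat \<Rightarrow> 'a \<Rightarrow> nat \<Rightarrow> real"
  assumes n: "3 \<le> n"
    and indep: "indep_vars (\<lambda>_. Rd (n - 2)) X {..<n}"
    and normal: "\<And>i. i < n \<Longrightarrow> distr M (Rd (n - 2)) (X i) = std_normal_vector (n - 2)"
begin

lemma X_rv: "i < n \<Longrightarrow> X i \<in> measurable M (Rd (n - 2))"
  using indep by (auto simp: indep_vars_def)

lemma X_component: "i < n \<Longrightarrow> k < n - 2 \<Longrightarrow> (\<lambda>\<omega>. X i \<omega> k) \<in> borel_measurable M"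
  by (rule measurable_compose[OF X_rv]) (simp_all add: Rd_def)

lemma X_outside: "i < n \<Longrightarrow> \<omega> \<in> space M \<Longrightarrow> n - 2 \<le> k \<Longrightarrow> X i \<omega> k = undefined"
  using measurable_space[OF X_rv[of i]] by (auto simp: Rd_def space_PiM PiE_iff extensional_def)

lemma X_eq_measurable:
  assumes ij: "i < n" "j < n"
  shows "Measurable.pred M (\<lambda>\<omega>. X i \<omega> = X j \<omega>)"
proof -
  have "X i \<omega> = X j \<omega> \<longleftrightarrow> (\<forall>k\<in>{..<n - 2}. X i \<omega> k = X j \<omega> k)" if "\<omega> \<in> space M" for \<omega>
    using X_outside[OF ij(1) that] X_outside[OF ij(2) that]
    by (metis ext lessThan_iff not_le)
  moreover have "Measurable.pred M (\<lambda>\<omega>. \<forall>k\<in>{..<n - 2}. X i \<omega> k = X j \<omega> k)"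
  proof (rule pred_intros_finite)
    fix k assume "k \<in> {..<n - 2}"
    then have [measurable]: "(\<lambda>\<omega>. X i \<omega> k) \<in> borel_measurable M" "(\<lambda>\<omega>. X j \<omega> k) \<in> borel_measurable M"
      using X_component ij by auto
    show "Measurable.pred M (\<lambda>\<omega>. X i \<omega> k = X j \<omega> k)" by measurable
  qed simp
  ultimately show ?thesis by (simp cong: measurable_cong)
qed

text \<open>The size of a set of points drops where points coincide. As \<open>M\<close> is not
  assumed complete, measurability has to take this null event into account.\<close>

lemma card_image_measurable:
  assumes "a \<subseteq> {..<n}"
  shows "(\<lambda>\<omega>. card ((\<lambda>i. X i \<omega>) ` a)) \<in> measurable M (count_space UNIV)"
proof -
  have "finite a" using assms finite_subset by blast
  then show ?thesis using assms
  proof (induction a)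
    case (insert i a)
    have [measurable]: "Measurable.pred M (\<lambda>\<omega>. \<exists>j\<in>a. X i \<omega> = X j \<omega>)"
      by (rule pred_intros_finite) (use insert in \<open>auto intro: X_eq_measurable\<close>)
    have [measurable]: "(\<lambda>\<omega>. card ((\<lambda>i. X i \<omega>) ` a)) \<in> measurable M (count_space UNIV)"
      using insert by auto
    have "card ((\<lambda>i. X i \<omega>) ` insert i a) =
        (if \<exists>j\<in>a. X i \<omega> = X j \<omega> then card ((\<lambda>i. X i \<omega>) ` a) else Suc (card ((\<lambda>i. X i \<omega>) ` a)))" for \<omega>
      using insert(1) by (auto simp: card_insert_if image_iff)
    then show ?case by simp
  qed simp
qed

text \<open>
  The last column is an auxiliary Gaussian vector, independent of the points.
\<close>

definition array :: "'a \<times> (nat \<Rightarrow> real) \<Rightarrow> nat \<times> nat \<Rightarrow> real" where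
  "array z = (\<lambda>(i, k)\<in>grid n (n - 1). if k < n - 2 then X i (fst z) k else snd z i)"

lemma array_measurable: "array \<in> measurable (M \<Otimes>\<^sub>M gaussian {..<n}) (gaussian (grid n (n - 1)))"
proof (rule measurable_PiM_single')
  show "array \<in> space (M \<Otimes>\<^sub>M gaussian {..<n}) \<rightarrow> (\<Pi>\<^sub>E i\<in>grid n (n - 1). space std_normal_distribution)"
    by (auto simp: array_def)
  fix p assume p: "p \<in> grid n (n - 1)"
  obtain i k where ik: "p = (i, k)" "i < n" using p by auto
  show "(\<lambda>z. array z p) \<in> measurable (M \<Otimes>\<^sub>M gaussian {..<n}) std_normal_distribution"
  proof (cases "k < n - 2")
    case True
    have "(\<lambda>z. X i (fst z) k) \<in> borel_measurable (M \<Otimes>\<^sub>M gaussian {..<n})"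
      by (rule measurable_compose[OF measurable_fst X_component]) (use ik True in auto)
    then show ?thesis using p ik True by (simp add: array_def)
  next
    case False
    have "(\<lambda>z. snd z i) \<in> borel_measurable (M \<Otimes>\<^sub>M gaussian {..<n})"
      by (rule measurable_compose[OF measurable_snd]) (use ik in simp)
    then show ?thesis using p ik False by (simp add: array_def)
  qed
qed

text \<open>The probability of a box factors over the rows by independence of the points, within a
  row by the product form of the normal vector, and over the last column because it lives on its own
  factor.\<close>

lemma distr_array:
  "distr (M \<Otimes>\<^sub>M gaussian {..<n}) (gaussian (grid n (n - 1))) array = gaussian (grid n (n - 1))"
proof -
  interpret G: prob_space "gaussian {..<n}" by (rule prob_space_gaussian)
  interpret P: product_sigma_finite "\<lambda>_::nat \<times> nat. std_normal_distribution"
    by (simp add: product_sigma_finite_def N.sigma_finite_measure_axioms)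
  interpret P1: product_sigma_finite "\<lambda>_::nat. std_normal_distribution"
    by (simp add: product_sigma_finite_def N.sigma_finite_measure_axioms)
  have n1: "n - 1 = Suc (n - 2)" using n by simp
  show ?thesis
  proof (rule P.PiM_eqI)
    fix A :: "nat \<times> nat \<Rightarrow> real set"
    assume "\<And>i. i \<in> grid n (n - 1) \<Longrightarrow> A i \<in> sets std_normal_distribution"
    then have A: "A (i, k) \<in> sets borel" if "i < n" "k < n - 1" for i k using that by auto
    define B where "B i = (\<Pi>\<^sub>E k\<in>{..<n - 2}. A (i, k))" for i
    have B: "B i \<in> sets (Rd (n - 2))" if "i < n" for i
      unfolding B_def Rd_def by (rule sets_PiM_I_finite) (use A that in auto)
    define C where "C = (\<Pi>\<^sub>E i\<in>{..<n}. A (i, n - 2))"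
    have C: "C \<in> sets (gaussian {..<n})"
      unfolding C_def by (rule sets_PiM_I_finite) (use A n1 in auto)
    let ?E = "\<Inter>i\<in>{..<n}. X i -` B i \<inter> space M"
    have E: "?E \<in> events"
      by (rule sets.finite_INT) (use n B X_rv in \<open>auto intro: measurable_sets simp: lessThan_empty_iff\<close>)
    have E_eq: "emeasure M ?E = (\<Prod>i<n. \<Prod>k<n - 2. emeasure std_normal_distribution (A (i, k)))"
    proof -
      have "prob ?E = (\<Prod>i<n. prob (X i -` B i \<inter> space M))"
        by (rule indep_varsD[OF indep]) (use n B in \<open>auto simp: lessThan_empty_iff\<close>)
      then have "emeasure M ?E = (\<Prod>i<n. emeasure M (X i -` B i \<inter> space M))"
        by (simp add: emeasure_eq_measure prod_ennreal)
      also have "\<dots> = (\<Prod>i<n. \<Prod>k<n - 2. emeasure std_normal_distribution (A (i, k)))"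
      proof (rule prod.cong[OF refl])
        fix i assume "i \<in> {..<n}"
        then have i: "i < n" by simp
        have "emeasure M (X i -` B i \<inter> space M) = emeasure (std_normal_vector (n - 2)) (B i)"
          by (simp only: emeasure_distr[OF X_rv[OF i] B[OF i], symmetric] normal[OF i])
        also have "\<dots> = (\<Prod>k<n - 2. emeasure std_normal_distribution (A (i, k)))"
          unfolding std_normal_vector_def B_def by (rule P1.emeasure_PiM) (use A i in auto)
        finally show "emeasure M (X i -` B i \<inter> space M) = \<dots>" .
      qed
      finally show ?thesis .
    qed
    have pre: "array -` (\<Pi>\<^sub>E p\<in>grid n (n - 1). A p) \<inter> space (M \<Otimes>\<^sub>M gaussian {..<n}) = ?E \<times> C"
    proof (intro set_eqI iffI)
      fix z assume z: "z \<in> array -` (\<Pi>\<^sub>E p\<in>grid n (n - 1). A p) \<inter> space (M \<Otimes>\<^sub>M gaussian {..<n})"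
      then have sp: "fst z \<in> space M" "snd z \<in> space (gaussian {..<n})"
        by (auto simp: space_pair_measure)
      have m: "array z (i, k) \<in> A (i, k)" if "i < n" "k < n - 1" for i k
        using z that by (auto simp: PiE_iff)
      have "X i (fst z) \<in> B i" if i: "i < n" for i
      proof -
        have "X i (fst z) k \<in> A (i, k)" if "k < n - 2" for k
          using m[OF i, of k] that i by (simp add: array_def)
        moreover have "X i (fst z) \<in> extensional {..<n - 2}"
          using X_outside[OF i sp(1)] by (simp add: extensional_def)
        ultimately show ?thesis unfolding B_def by (simp add: PiE_iff)
      qed
      moreover have "snd z \<in> C"
      proof -
        have "snd z i \<in> A (i, n - 2)" if "i < n" for i
          using m[OF that, of "n - 2"] that n1 by (simp add: array_def)
        then show ?thesis using sp(2) by (auto simp: C_def space_PiM PiE_iff)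
      qed
      ultimately show "z \<in> ?E \<times> C" using sp n by (cases z) (auto simp: lessThan_empty_iff)
    next
      fix z assume z: "z \<in> ?E \<times> C"
      have XB: "X i (fst z) \<in> B i" "fst z \<in> space M" if "i < n" for i
      proof -
        have "fst z \<in> ?E" using z by (simp only: mem_Times_iff)
        from INT_D[OF this, of i] that have "fst z \<in> X i -` B i \<inter> space M" by simp
        then show "X i (fst z) \<in> B i" "fst z \<in> space M" by auto
      qed
      have sp: "fst z \<in> space M" by (rule XB(2)[of 0]) (use n in simp)
      have "snd z \<in> space (gaussian {..<n})" using z C sets.sets_into_space by (cases z) auto
      moreover have "array z (i, k) \<in> A (i, k)" if "i < n" "k < n - 1" for i k
        using z XB(1)[OF that(1)] that n1 by (cases z) (auto simp: array_def B_def C_def PiE_iff less_Suc_eq)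
      then have "array z \<in> (\<Pi>\<^sub>E p\<in>grid n (n - 1). A p)"
        by (auto simp: PiE_iff) (simp add: array_def)
      ultimately show "z \<in> array -` (\<Pi>\<^sub>E p\<in>grid n (n - 1). A p) \<inter> space (M \<Otimes>\<^sub>M gaussian {..<n})"
        using sp by (cases z) (simp add: space_pair_measure)
    qed
    have box: "(\<Pi>\<^sub>E p\<in>grid n (n - 1). A p) \<in> sets (gaussian (grid n (n - 1)))"
      by (rule sets_PiM_I_finite) (use A in auto)
    have "emeasure (distr (M \<Otimes>\<^sub>M gaussian {..<n}) (gaussian (grid n (n - 1))) array)
        (\<Pi>\<^sub>E p\<in>grid n (n - 1). A p) = emeasure (M \<Otimes>\<^sub>M gaussian {..<n}) (?E \<times> C)"
      by (simp only: emeasure_distr[OF array_measurable box] pre)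
    also have "\<dots> = emeasure M ?E * emeasure (gaussian {..<n}) C"
      by (rule G.emeasure_pair_measure_Times[OF E C])
    also have "emeasure (gaussian {..<n}) C = (\<Prod>i<n. emeasure std_normal_distribution (A (i, n - 2)))"
      unfolding C_def by (rule P1.emeasure_PiM) (use A n1 in auto)
    also have "emeasure M ?E * \<dots> = (\<Prod>i<n. \<Prod>k<n - 1. emeasure std_normal_distribution (A (i, k)))"
      unfolding E_eq n1 by (simp add: prod.distrib)
    also have "\<dots> = (\<Prod>p\<in>grid n (n - 1). emeasure std_normal_distribution (A p))"
      by (simp add: prod.cartesian_product)
    finally show "emeasure (distr (M \<Otimes>\<^sub>M gaussian {..<n}) (gaussian (grid n (n - 1))) array)
        (\<Pi>\<^sub>E p\<in>grid n (n - 1). A p) = \<dots>" .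
  qed simp_all
qed

abbreviation dependence :: "'a \<times> (nat \<Rightarrow> real) \<Rightarrow> nat \<Rightarrow> real" where
  "dependence z \<equiv> normal_vec n (n - 1) (array z)"

text \<open>The all-ones vector, the \<open>n - 2\<close> columns of coordinates and the auxiliary
  column have nonzero Gram-Schmidt vectors almost surely, so the vectors orthogonal to the first
  \<open>n - 1\<close> of them form the line through the last residual.\<close>

lemma AE_radon:
  "AE z in M \<Otimes>\<^sub>M gaussian {..<n}. inj_on (\<lambda>i. X i (fst z)) {..<n} \<and>
     (\<forall>P. radon_partition ((\<lambda>i. X i (fst z)) ` {..<n}) P \<longleftrightarrow>
        P = {(\<lambda>i. X i (fst z)) ` positives n (dependence z), (\<lambda>i. X i (fst z)) ` positives n (- dependence z)})"
proof -
  let ?G = "gaussian (grid n (n - 1))" and ?u = "frame n 1 (\<lambda>_. ones n)"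
  have "AE x in ?G. \<forall>j<1 + (n - 1). ip n (gs_vec n (?u x) j) (gs_vec n (?u x) j) \<noteq> 0"
    by (rule AE_gs_vec_frame) (use n in \<open>auto simp: ip_ones_ones\<close>)
  moreover have "AE x in ?G. \<forall>i<n. normal_vec n (n - 1) x i \<noteq> 0"
    by (rule normal_vec_nonzero) (use n in auto)
  ultimately have "AE x in ?G. (\<forall>j<n. ip n (gs_vec n (?u x) j) (gs_vec n (?u x) j) \<noteq> 0) \<and>
      (\<forall>i<n. normal_vec n (n - 1) x i \<noteq> 0)"
    by eventually_elim (use n in auto)
  then have "AE z in M \<Otimes>\<^sub>M gaussian {..<n}.
      (\<forall>j<n. ip n (gs_vec n (?u (array z)) j) (gs_vec n (?u (array z)) j) \<noteq> 0) \<and>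
      (\<forall>i<n. dependence z i \<noteq> 0)"
    by (rule AE_distrD[OF array_measurable, unfolded distr_array])
  moreover have "AE z in M \<Otimes>\<^sub>M gaussian {..<n}. z \<in> space (M \<Otimes>\<^sub>M gaussian {..<n})" by simp
  ultimately show ?thesis
  proof eventually_elim
    case (elim z)
    let ?t = "dependence z" and ?p = "\<lambda>i. X i (fst z)"
    have sp: "fst z \<in> space M" using elim(2) by (auto simp: space_pair_measure)
    \<comment> \<open>Frame index 0 is \<open>ones n\<close>, so index \<open>Suc k\<close> lists
      the \<open>k\<close>-th coordinates of the points, and orthogonality to it is the
      \<open>k\<close>-th equation of an affine dependence.\<close>
    have fr: "ip n y (?u (array z) (Suc k)) = (\<Sum>i<n. y i * ?p i k)" if "k < n - 2" for y k
    proof -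
      have "k < n - 1" using that by simp
      then show ?thesis
        unfolding ip_def using that by (intro sum.cong refl) (simp add: frame_def col_def array_def)
    qed
    have orth: "ip n ?t (?u (array z) j) = 0" if "j < n - 1" for j
      unfolding normal_vec_def by (rule ip_gs_residual_vec[OF that])
    have sum0: "(\<Sum>i<n. ?t i) = 0" using orth[of 0] n by (simp add: frame_def ip_ones)
    have dep: "(\<Sum>i<n. ?t i * ?p i k) = 0" if "k < n - 2" for k
      using orth[of "Suc k"] fr[OF that, of ?t] that by simp
    have line: "\<exists>c. \<forall>i<n. y i = c * ?t i"
      if y: "(\<Sum>i<n. y i) = 0" "\<And>k. k < n - 2 \<Longrightarrow> (\<Sum>i<n. y i * ?p i k) = 0" for y
      unfolding normal_vec_def
    proof (rule orthogonal_line)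
      show "ip n (gs_vec n (?u (array z)) j) (gs_vec n (?u (array z)) j) \<noteq> 0" if "j < n" for j
        using elim(1) that by blast
      show "ip n y (?u (array z) j) = 0" if "Suc j < n" for j
      proof (cases j)
        case 0
        then show ?thesis using y(1) by (simp add: frame_def ip_ones)
      next
        case (Suc k)
        then show ?thesis using fr[of k y] y(2)[of k] that by simp
      qed
    qed
    have nz: "?t i \<noteq> 0" if "i < n" for i using elim(1) that by blast
    have ext: "?p i k = undefined" if "i < n" "n - 2 \<le> k" for i k
      by (rule X_outside[OF that(1) sp that(2)])
    have pos: "positives n ?t = {i\<in>{..<n}. ?t i > 0}" "positives n (- ?t) = {i\<in>{..<n}. ?t i < 0}"
      by (auto simp: positives_def)
    show ?case
      unfolding pos
    proof (intro conjI allI)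
      show "inj_on ?p {..<n}"
        by (rule radon_partition_unique(1)[OF n ext nz sum0 dep line])
      show "radon_partition (?p ` {..<n}) P \<longleftrightarrow>
          P = {?p ` {i\<in>{..<n}. ?t i > 0}, ?p ` {i\<in>{..<n}. ?t i < 0}}" for P
        by (rule radon_partition_unique(2)[OF n ext nz sum0 dep line])
    qed
  qed
qed

text \<open>The statement does not mention the auxiliary vector, so for a given
  \<open>\<omega>\<close> it holds once it holds for almost every value of that vector.\<close>

lemma AE_unique_radon: "AE \<omega> in M. \<exists>!P. radon_partition ((\<lambda>i. X i \<omega>) ` {..<n}) P"
proof -
  interpret G: prob_space "gaussian {..<n}" by (rule prob_space_gaussian)
  interpret pair_prob_space M "gaussian {..<n}" ..
  have "AE \<omega> in M. AE g in gaussian {..<n}. \<exists>!P. radon_partition ((\<lambda>i. X i \<omega>) ` {..<n}) P"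
    using AE_pair[OF AE_radon]
  proof eventually_elim
    case (elim \<omega>)
    then show ?case by (rule eventually_mono) simp
  qed
  then show ?thesis by simp
qed

end

context gaussian_points
begin

lemma AE_fst:
  assumes "AE \<omega> in M. P \<omega>"
  shows "AE z in M \<Otimes>\<^sub>M gaussian {..<n}. P (fst z)"
proof -
  interpret G: prob_space "gaussian {..<n}" by (rule prob_space_gaussian)
  show ?thesis
    by (rule AE_distrD[OF measurable_fst[of M "gaussian {..<n}"], unfolded G.distr_pair_fst, OF assms])
qed

text \<open>Uniqueness identifies the unordered pair of index sets with the two sign sets, but which
  is which may vary with the sample. Only the sum of the two indicators is determined, hence the sum
  of probabilities.\<close>

lemma radon_parts_law:
  assumes AB: "A \<in> measurable M (count_space (Pow {..<n}))" "B \<in> measurable M (count_space (Pow {..<n}))"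
    and radon: "AE \<omega> in M. radon_partition ((\<lambda>i. X i \<omega>) ` {..<n}) {(\<lambda>i. X i \<omega>) ` A \<omega>, (\<lambda>i. X i \<omega>) ` B \<omega>}"
  shows "prob {\<omega>\<in>space M. Q (card (A \<omega>))} + prob {\<omega>\<in>space M. Q (card (B \<omega>))} =
    2 * measure (gaussian UNIV) {\<omega>\<in>space (gaussian UNIV). Q (card (above_mean n \<omega>))}"
proof -
  interpret G: prob_space "gaussian {..<n}" by (rule prob_space_gaussian)
  interpret MG: pair_prob_space M "gaussian {..<n}" ..
  let ?M' = "M \<Otimes>\<^sub>M gaussian {..<n}" and ?G = "gaussian (grid n (n - 1))"
  let ?p = "measure (gaussian UNIV) {\<omega>\<in>space (gaussian UNIV). Q (card (above_mean n \<omega>))}"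
  define E where "E C = {z\<in>space ?M'. Q (card (C (fst z)))}" for C :: "'a \<Rightarrow> nat set"
  have E: "E C \<in> sets ?M'" "measure ?M' (E C) = prob {\<omega>\<in>space M. Q (card (C \<omega>))}"
    if "C \<in> measurable M (count_space (Pow {..<n}))" for C
  proof -
    have pre: "C -` {a \<in> Pow {..<n}. Q (card a)} \<inter> space M = {\<omega>\<in>space M. Q (card (C \<omega>))}"
      using measurable_space[OF that] by auto
    have "{a \<in> Pow {..<n}. Q (card a)} \<in> sets (count_space (Pow {..<n}))" by auto
    from measurable_sets[OF that this] have ev: "{\<omega>\<in>space M. Q (card (C \<omega>))} \<in> events"
      unfolding pre .
    have eq: "E C = {\<omega>\<in>space M. Q (card (C \<omega>))} \<times> space (gaussian {..<n})"
      by (auto simp: E_def space_pair_measure)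
    show "E C \<in> sets ?M'" unfolding eq using ev by (rule pair_measureI) simp
    show "measure ?M' (E C) = prob {\<omega>\<in>space M. Q (card (C \<omega>))}"
      unfolding eq using ev by (simp add: measure_def G.emeasure_pair_measure_Times G.emeasure_space_1)
  qed
  define D where "D f = {z\<in>space ?M'. Q (card (positives n (f (normal_vec n (n - 1) (array z)))))}"
    for f :: "(nat \<Rightarrow> real) \<Rightarrow> nat \<Rightarrow> real"
  have eqn: "equivariant n (n - 1) (normal_vec n (n - 1))" by (rule equivariant_normal_vec) (use n in auto)
  have D: "D f \<in> sets ?M'" "measure ?M' (D f) = ?p" if "f = (\<lambda>x. x) \<or> f = uminus" for f
  proof -
    let ?S = "{x\<in>space ?G. Q (card (positives n (f (normal_vec n (n - 1) x))))}"
    have "(\<lambda>x. f (normal_vec n (n - 1) x) i) \<in> borel_measurable ?G" for i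
      using eqn that by (auto simp: equivariant_def)
    from positives_measurable[OF this, of "\<lambda>a. Q (card a)" n] have S: "?S \<in> sets ?G" by simp
    have pre: "array -` ?S \<inter> space ?M' = D f"
      using measurable_space[OF array_measurable] by (auto simp: D_def)
    show "D f \<in> sets ?M'" using measurable_sets[OF array_measurable S] unfolding pre .
    have "measure ?M' (D f) = measure ?G ?S"
      using measure_distr[OF array_measurable S] unfolding pre distr_array by simp
    also have "\<dots> = ?p"
      using that normal_vec_positives_law[OF n, of "\<lambda>a. Q (card a)"] by auto
    finally show "measure ?M' (D f) = ?p" .
  qed
  have AE_eq: "AE z in ?M'. indicator (E A) z + indicator (E B) z =
      (indicator (D (\<lambda>x. x)) z + indicator (D uminus) z :: real)"
    using AE_radon AE_fst[OF radon] AE_space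
  proof eventually_elim
    case (elim z)
    let ?p = "\<lambda>i. X i (fst z)" and ?t = "dependence z"
    have inj: "inj_on ?p {..<n}" using elim(1) by blast
    have "fst z \<in> space M" using elim(3) by (auto simp: space_pair_measure)
    from measurable_space[OF AB(1) this] measurable_space[OF AB(2) this]
    have sub: "A (fst z) \<subseteq> {..<n}" "B (fst z) \<subseteq> {..<n}"
      "positives n ?t \<subseteq> {..<n}" "positives n (- ?t) \<subseteq> {..<n}"
      by (auto simp: positives_def)
    have "{?p ` A (fst z), ?p ` B (fst z)} = {?p ` positives n ?t, ?p ` positives n (- ?t)}"
      by (rule conjunct2[OF elim(1), THEN spec, THEN iffD1, OF elim(2)])
    \<comment> \<open>Distinctness of the points turns equal point sets into equal index
      sets.\<close>
    then have "(A (fst z) = positives n ?t \<and> B (fst z) = positives n (- ?t)) \<or>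
        (A (fst z) = positives n (- ?t) \<and> B (fst z) = positives n ?t)"
      unfolding doubleton_eq_iff
        inj_on_image_eq_iff[OF inj sub(1) sub(3)] inj_on_image_eq_iff[OF inj sub(1) sub(4)]
        inj_on_image_eq_iff[OF inj sub(2) sub(3)] inj_on_image_eq_iff[OF inj sub(2) sub(4)] .
    then show ?case using elim(3) by (auto simp: E_def D_def indicator_def)
  qed
  have "measure ?M' (E A) + measure ?M' (E B) = (\<integral>z. indicator (E A) z + indicator (E B) z \<partial>?M')"
    using E(1)[OF AB(1)] E(1)[OF AB(2)]
    by (subst Bochner_Integration.integral_add) (auto simp: MG.emeasure_finite less_top[symmetric])
  also have "\<dots> = (\<integral>z. indicator (D (\<lambda>x. x)) z + indicator (D uminus) z \<partial>?M')"
    by (rule integral_cong_AE[OF _ _ AE_eq])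
       (use E(1)[OF AB(1)] E(1)[OF AB(2)] D(1) in \<open>auto intro!: borel_measurable_add borel_measurable_indicator\<close>)
  also have "\<dots> = measure ?M' (D (\<lambda>x. x)) + measure ?M' (D uminus)"
    using D(1) by (subst Bochner_Integration.integral_add) (auto simp: MG.emeasure_finite less_top[symmetric])
  finally show ?thesis using D(2) E(2)[OF AB(1)] E(2)[OF AB(2)] by simp
qed

text \<open>Independence of the coin from the labelled parts gives each part the weight 1/2, so the
  law of the size is the average of the laws of the two sizes.\<close>

lemma random_part_law:
  assumes radon: "AE \<omega> in M. radon_partition ((\<lambda>i. X i \<omega>) ` {..<n}) {(\<lambda>i. X i \<omega>) ` A \<omega>, (\<lambda>i. X i \<omega>) ` B \<omega>}"
    and fair: "distr M (count_space UNIV) coin = measure_pmf (bernoulli_pmf (1 / 2))"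
    and coin_indep: "indep_var2 (count_space UNIV) coin
        (PiM {..<n} (\<lambda>_. Rd (n - 2)) \<Otimes>\<^sub>M (count_space (Pow {..<n}) \<Otimes>\<^sub>M count_space (Pow {..<n})))
        (\<lambda>\<omega>. (\<lambda>i\<in>{..<n}. X i \<omega>, A \<omega>, B \<omega>))"
    and S: "\<And>\<omega>. \<omega> \<in> space M \<Longrightarrow> S \<omega> = (if coin \<omega> then (\<lambda>i. X i \<omega>) ` A \<omega> else (\<lambda>i. X i \<omega>) ` B \<omega>)"
  shows "(\<lambda>\<omega>. card (S \<omega>)) \<in> measurable M (count_space UNIV)"
    and "prob {\<omega>\<in>space M. Q (card (S \<omega>))} =
      measure (gaussian UNIV) {\<omega>\<in>space (gaussian UNIV). Q (card (above_mean n \<omega>))}"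
proof -
  let ?C = "count_space (Pow {..<n})"
  let ?T = "PiM {..<n} (\<lambda>_. Rd (n - 2)) \<Otimes>\<^sub>M (?C \<Otimes>\<^sub>M ?C)"
  let ?Y = "\<lambda>\<omega>. (\<lambda>i\<in>{..<n}. X i \<omega>, A \<omega>, B \<omega>)"
  have coin_rv[measurable]: "coin \<in> measurable M (count_space UNIV)"
    and Y: "?Y \<in> measurable M ?T"
    and ind: "indep_set (sigma_sets (space M) {coin -` C \<inter> space M | C. C \<in> sets (count_space UNIV)})
       (sigma_sets (space M) {?Y -` C \<inter> space M | C. C \<in> sets ?T})"
    using coin_indep unfolding indep_var2_def by blast+
  have A[measurable]: "A \<in> measurable M ?C"
    using measurable_compose[OF Y measurable_compose[OF measurable_snd measurable_fst]] by simp
  have B[measurable]: "B \<in> measurable M ?C"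
    using measurable_compose[OF Y measurable_compose[OF measurable_snd measurable_snd]] by simp
  \<comment> \<open>The index set takes finitely many values, so it suffices to treat each fixed
    index set.\<close>
  have card_im[measurable]: "(\<lambda>\<omega>. card ((\<lambda>i. X i \<omega>) ` D \<omega>)) \<in> measurable M (count_space UNIV)"
    if "D \<in> measurable M ?C" for D
    by (rule measurable_compose_countable'[OF _ that]) (auto intro: card_image_measurable countable_finite)
  have "card (S \<omega>) = (if coin \<omega> then card ((\<lambda>i. X i \<omega>) ` A \<omega>) else card ((\<lambda>i. X i \<omega>) ` B \<omega>))"
    if "\<omega> \<in> space M" for \<omega>
    using S[OF that] by simp
  moreover have "(\<lambda>\<omega>. if coin \<omega> then card ((\<lambda>i. X i \<omega>) ` A \<omega>) else card ((\<lambda>i. X i \<omega>) ` B \<omega>))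
      \<in> measurable M (count_space UNIV)"
    using card_im[OF A] card_im[OF B] by measurable
  ultimately show S_meas: "(\<lambda>\<omega>. card (S \<omega>)) \<in> measurable M (count_space UNIV)"
    by (simp cong: measurable_cong)
  define H where "H c = {\<omega>\<in>space M. coin \<omega> = c}" for c
  define EA where "EA = {\<omega>\<in>space M. Q (card (A \<omega>))}"
  define EB where "EB = {\<omega>\<in>space M. Q (card (B \<omega>))}"
  have H: "prob (H c) = 1 / 2" for c
  proof -
    have "prob (H c) = measure (distr M (count_space UNIV) coin) {c}"
      by (subst measure_distr) (auto simp: H_def intro!: arg_cong[where f=prob])
    also have "\<dots> = 1 / 2" unfolding fair by (cases c) (simp_all add: measure_pmf_single)
    finally show ?thesis .
  qed
  have H_in: "H c \<in> sigma_sets (space M) {coin -` C \<inter> space M | C. C \<in> sets (count_space UNIV)}" for c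
    by (rule sigma_sets.Basic) (auto simp: H_def intro!: exI[of _ "{c}"])
  have space_Y: "?Y \<omega> \<in> space ?T" if "\<omega> \<in> space M" for \<omega> using measurable_space[OF Y that] .
  have Y_in: "{\<omega>\<in>space M. P (A \<omega>, B \<omega>)} \<in> sigma_sets (space M) {?Y -` C \<inter> space M | C. C \<in> sets ?T}" for P
  proof (rule sigma_sets.Basic, rule CollectI, intro exI conjI)
    let ?V = "{ab \<in> Pow {..<n} \<times> Pow {..<n}. P ab}"
    have "?V \<in> sets (?C \<Otimes>\<^sub>M ?C)"
      by (subst pair_measure_countable) (auto intro: countable_finite)
    then show "space (PiM {..<n} (\<lambda>_. Rd (n - 2))) \<times> ?V \<in> sets ?T" by (intro pair_measureI) auto
    show "{\<omega>\<in>space M. P (A \<omega>, B \<omega>)} = ?Y -` (space (PiM {..<n} (\<lambda>_. Rd (n - 2))) \<times> ?V) \<inter> space M"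
      using space_Y by (auto simp: space_pair_measure)
  qed
  have EA: "EA \<in> sigma_sets (space M) {?Y -` C \<inter> space M | C. C \<in> sets ?T}"
    and EB: "EB \<in> sigma_sets (space M) {?Y -` C \<inter> space M | C. C \<in> sets ?T}"
    using Y_in[of "\<lambda>(a, b). Q (card a)"] Y_in[of "\<lambda>(a, b). Q (card b)"] by (simp_all add: EA_def EB_def)
  have ev: "EA \<in> events" "EB \<in> events" "H c \<in> events" for c
    unfolding EA_def EB_def H_def by measurable
  have AE_inj: "AE \<omega> in M. inj_on (\<lambda>i. X i \<omega>) {..<n}"
  proof -
    interpret G: prob_space "gaussian {..<n}" by (rule prob_space_gaussian)
    interpret MG: pair_prob_space M "gaussian {..<n}" ..
    have "AE z in M \<Otimes>\<^sub>M gaussian {..<n}. inj_on (\<lambda>i. X i (fst z)) {..<n}"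
      using AE_radon by (rule eventually_mono) blast
    from MG.AE_pair[OF this] show ?thesis by simp
  qed
  \<comment> \<open>Almost surely the points are distinct, so a part has as many points as its index
    set has elements.\<close>
  have "prob {\<omega>\<in>space M. Q (card (S \<omega>))} = prob ((H True \<inter> EA) \<union> (H False \<inter> EB))"
  proof (rule measure_eq_AE)
    show "AE \<omega> in M. \<omega> \<in> {\<omega>\<in>space M. Q (card (S \<omega>))} \<longleftrightarrow> \<omega> \<in> (H True \<inter> EA) \<union> (H False \<inter> EB)"
      using AE_inj AE_space
    proof eventually_elim
      case (elim \<omega>)
      have "card ((\<lambda>i. X i \<omega>) ` A \<omega>) = card (A \<omega>)" "card ((\<lambda>i. X i \<omega>) ` B \<omega>) = card (B \<omega>)"
        using measurable_space[OF A elim(2)] measurable_space[OF B elim(2)]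
        by (auto intro!: card_image inj_on_subset[OF elim(1)])
      then show ?case using elim(2) S[OF elim(2)] by (auto simp: H_def EA_def EB_def)
    qed
    show "{\<omega>\<in>space M. Q (card (S \<omega>))} \<in> events"
      using measurable_sets[OF S_meas, of "{c. Q c}"] by (simp add: vimage_def Int_def conj_commute)
  qed (use ev in auto)
  also have "\<dots> = prob (H True \<inter> EA) + prob (H False \<inter> EB)"
    by (rule finite_measure_Union) (use ev in \<open>auto simp: H_def\<close>)
  also have "\<dots> = (prob EA + prob EB) / 2"
    using indep_setD[OF ind H_in EA, of True] indep_setD[OF ind H_in EB, of False] H by simp
  also have "\<dots> = measure (gaussian UNIV) {\<omega>\<in>space (gaussian UNIV). Q (card (above_mean n \<omega>))}"
    using radon_parts_law[OF A B radon, of Q] by (simp add: EA_def EB_def)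
  finally show "prob {\<omega>\<in>space M. Q (card (S \<omega>))} = \<dots>" .
qed

end

theorem theorem2p3:
  fixes M :: "nat \<Rightarrow> 'a measure"
    and X :: "nat \<Rightarrow> nat \<Rightarrow> 'a \<Rightarrow> (nat \<Rightarrow> real)"
    and A B :: "nat \<Rightarrow> 'a \<Rightarrow> nat set"
    and coin :: "nat \<Rightarrow> 'a \<Rightarrow> bool"
    and S :: "nat \<Rightarrow> 'a \<Rightarrow> (nat \<Rightarrow> real) set"
    and \<sigma> :: real
  assumes prob: "\<And>n. n \<ge> 3 \<Longrightarrow> prob_space (M n)"
    and X_indep: "\<And>n. n \<ge> 3 \<Longrightarrow>
          prob_space.indep_vars (M n) (\<lambda>_. Rd (n - 2)) (X n) {..<n}"
    and X_normal: "\<And>n i. n \<ge> 3 \<Longrightarrow> i < n \<Longrightarrow>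
          distr (M n) (Rd (n - 2)) (X n i) = std_normal_vector (n - 2)"
    \<comment> \<open>the parts are the point sets indexed by the random index sets \<open>A n\<close> and \<open>B n\<close>\<close>
    and radon: "\<And>n. n \<ge> 3 \<Longrightarrow>
          (AE \<omega> in M n. radon_partition ((\<lambda>i. X n i \<omega>) ` {..<n})
                          {(\<lambda>i. X n i \<omega>) ` A n \<omega>, (\<lambda>i. X n i \<omega>) ` B n \<omega>})"
    \<comment> \<open>a fair coin, independent of the points and of the labelling of the two parts;
        \<open>indep_var2\<close> includes measurability of \<open>coin n\<close>, \<open>A n\<close> and \<open>B n\<close>\<close>
    and coin_fair: "\<And>n. n \<ge> 3 \<Longrightarrow>
          distr (M n) (count_space UNIV) (coin n) = measure_pmf (bernoulli_pmf (1 / 2))"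
    and coin_indep: "\<And>n. n \<ge> 3 \<Longrightarrow>
          prob_space.indep_var2 (M n)
            (count_space UNIV) (coin n)
            (PiM {..<n} (\<lambda>_. Rd (n - 2)) \<Otimes>\<^sub>M
               (count_space (Pow {..<n}) \<Otimes>\<^sub>M count_space (Pow {..<n})))
            (\<lambda>\<omega>. (\<lambda>i\<in>{..<n}. X n i \<omega>, A n \<omega>, B n \<omega>))"
    and S_eq: "\<And>n \<omega>. n \<ge> 3 \<Longrightarrow> \<omega> \<in> space (M n) \<Longrightarrow>
          S n \<omega> = (if coin n \<omega> then (\<lambda>i. X n i \<omega>) ` A n \<omega> else (\<lambda>i. X n i \<omega>) ` B n \<omega>)"
    and \<sigma>_pos: "\<sigma> > 0"
    and \<sigma>_sq: "\<sigma>\<^sup>2 = 1 / 4 - 1 / (2 * pi)"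
  shows "(\<forall>n\<ge>3. AE \<omega> in M n. \<exists>!P. radon_partition ((\<lambda>i. X n i \<omega>) ` {..<n}) P) \<and>
         weak_conv_m
           (\<lambda>n. distr (M n) borel
                  (\<lambda>\<omega>. (real (card (S n \<omega>)) - real n / 2) / (\<sigma> * sqrt (real n))))
           std_normal_distribution"
proof
  have gp: "gaussian_points (M n) n (X n)" if n: "n \<ge> 3" for n
    using prob[OF n] X_indep[OF n] X_normal[OF n] n
    by (auto simp: gaussian_points_def gaussian_points_axioms_def)
  show "\<forall>n\<ge>3. AE \<omega> in M n. \<exists>!P. radon_partition ((\<lambda>i. X n i \<omega>) ` {..<n}) P"
    using gaussian_points.AE_unique_radon[OF gp] by blast
  let ?N = "\<lambda>n c. (real c - real n / 2) / (\<sigma> * sqrt (real n))"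
  \<comment> \<open>The laws agree exactly for each \<open>n \<ge> 3\<close>. The spaces
    \<open>M n\<close> are unrelated, so the comparison goes through distribution functions.\<close>
  have cdf_eq: "cdf (distr (M n) borel (\<lambda>\<omega>. ?N n (card (S n \<omega>)))) x =
      cdf (distr (gaussian UNIV) borel (\<lambda>\<omega>. ?N n (card (above_mean n \<omega>)))) x" if n: "n \<ge> 3" for n x
  proof -
    note law = gaussian_points.random_part_law[OF gp[OF n] radon[OF n] coin_fair[OF n] coin_indep[OF n] S_eq[OF n]]
    have "(\<lambda>\<omega>. ?N n (card (S n \<omega>))) \<in> borel_measurable (M n)"
      using measurable_compose[OF law(1), of "?N n" borel] by simp
    then have "cdf (distr (M n) borel (\<lambda>\<omega>. ?N n (card (S n \<omega>)))) x =
        measure (M n) {\<omega>\<in>space (M n). ?N n (card (S n \<omega>)) \<le> x}"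
      by (simp add: cdf_def measure_distr vimage_def Int_def conj_commute)
    also have "\<dots> = measure (gaussian UNIV) {\<omega>\<in>space (gaussian UNIV). ?N n (card (above_mean n \<omega>)) \<le> x}"
      by (rule law(2))
    also have "\<dots> = cdf (distr (gaussian UNIV) borel (\<lambda>\<omega>. ?N n (card (above_mean n \<omega>)))) x"
    proof -
      have "(\<lambda>\<omega>. ?N n (card (above_mean n \<omega>))) \<in> borel_measurable (gaussian UNIV)"
        by (rule borel_measurableI_le) (rule above_mean_measurable)
      then show ?thesis by (simp add: cdf_def measure_distr vimage_def Int_def conj_commute)
    qed
    finally show ?thesis .
  qed
  show "weak_conv_m (\<lambda>n. distr (M n) borel (\<lambda>\<omega>. ?N n (card (S n \<omega>)))) std_normal_distribution"
    unfolding weak_conv_m_def weak_conv_def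
  proof (intro allI impI)
    fix x assume "isCont (cdf std_normal_distribution) x"
    with clt_above_mean[OF \<sigma>_pos \<sigma>_sq]
    have "(\<lambda>n. cdf (distr (gaussian UNIV) borel (\<lambda>\<omega>. ?N n (card (above_mean n \<omega>)))) x)
        \<longlonglongrightarrow> cdf std_normal_distribution x"
      by (simp add: weak_conv_m_def weak_conv_def above_mean_def)
    \<comment> \<open>Nothing is assumed about \<open>M n\<close> for \<open>n < 3\<close>, so the
      sequences are identified only from 3 on.\<close>
    moreover have "\<forall>\<^sub>F n in sequentially. cdf (distr (gaussian UNIV) borel (\<lambda>\<omega>. ?N n (card (above_mean n \<omega>)))) x =
        cdf (distr (M n) borel (\<lambda>\<omega>. ?N n (card (S n \<omega>)))) x"
      using eventually_ge_at_top[of 3] by eventually_elim (simp add: cdf_eq)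
    ultimately show "(\<lambda>n. cdf (distr (M n) borel (\<lambda>\<omega>. ?N n (card (S n \<omega>)))) x)
        \<longlonglongrightarrow> cdf std_normal_distribution x"
      by (rule Lim_transform_eventually)
  qed
qed

end
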